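(* Let $t\in\mathbb{R}$, $t\ne0$. Among the $U(2)$-invariant metrics $g=C\left(\frac{1}{4F}dz^2+F(\eta^1)^2+(\eta^2)^2+(\eta^3)^2\right)$, $F=F(z)>0$, $C=C(z)>0$, the space of solutions to the $B^t$-flat equations is 7-dimensional. Up to homothety these constitute a 5-parameter family of metrics, and the constant scalar curvature (CSC) $B^t$-flat metrics constitute a 4-parameter family of metrics (up to homothety). There exist CSC $B^t$-flat metrics that are not conformal to any extremal K\"ahler metric.
   Context: Let $\eta^1,\eta^2,\eta^3$ be the left-invariant coframe on $\mathbb{S}^3$ with $d\eta^1=-2\eta^2\wedge\eta^3$ and cyclic permutations. The metric lives on $I\times\mathbb{S}^3$, $I$ an interval with coordinate $z$. A metric is $B^t$-flat if it satisfies the Euler-Lagrange equations of $B^t(g)=\int|W|^2+t\int s^2$ ($W$ the Weyl tensor, $s$ the scalar curvature). These equations are $-4Bach+t\,\mathcal{C}=0$ with $\mathcal{C}=2\left(\nabla^2s-(\triangle s)g-s\mathring{\mathrm{Ric}}\right)$, where $Bach_{ij}=W_{sijt}{}^{,st}+\frac12W_{sijt}\mathrm{Ric}^{st}$ and $\mathring{\mathrm{Ric}}$ is the trace-free Ricci tensor; for $t\neq0$ they are equivalent to $\triangle s=0$ and $2Bach+t(s\mathring{\mathrm{Ric}}-\nabla^2s)=0$. For the metrics above these become ODEs in $z$; the dimension of the solution space is the number of free real parameters (initial conditions) in the local solutions $(F,C)$. "Up to homothety" means modulo translation in $z$ and multiplication of $g$ by a positive constant. A K\"ahler metric is extremal if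 it is critical for $\int s^2\,dVol$ under variations preserving the K\"ahler class; equivalently $J\nabla s$ is Killing. *)

theory Defs
  imports "HOL-Analysis.Analysis"
begin

section \<open>The manifold \<open>I \<times> S\<^sup>3\<close> and its frame\<close>

text \<open>
  A pair \<open>(a, b)\<close> of complex numbers stands for the quaternion \<open>a + b j\<close>, so that \<open>S\<^sup>3\<close> is the
  group of unit quaternions.
\<close>

type_synonym point = "real \<times> complex \<times> complex"

definition cyl :: "real set \<Rightarrow> point set" where
  "cyl I = I \<times> sphere 0 1"

text \<open>
  Frame indices have the type \<^typ>\<open>4\<close>, whose elements are 0, 1, 2, 3 (the library often
  writes 4 for 0). The index 0 belongs to \<open>\<partial>/\<partial>z\<close>; the indices 1, 2, 3 belong to
  the left-invariant fields dual to \<open>\<eta>\<^sup>1, \<eta>\<^sup>2, \<eta>\<^sup>3\<close>, whose values at \<open>q\<close> are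
  \<open>q i\<close>, \<open>q j\<close>, \<open>q k\<close>. The value of \<open>rmul\<close> at the index 0 is irrelevant.
\<close>

definition rmul :: "4 \<Rightarrow> complex \<times> complex \<Rightarrow> complex \<times> complex" where
  "rmul i = (\<lambda>(a, b).
     if i = 1 then (\<i> * a, - \<i> * b) else if i = 2 then (- b, a) else (\<i> * b, \<i> * a))"

text \<open>The flow of the \<open>i\<close>-th frame field: \<open>cos h + sin h e\<close> is the exponential of \<open>h e\<close>
  for an imaginary unit \<open>e\<close>.\<close>

definition flow :: "4 \<Rightarrow> real \<Rightarrow> point \<Rightarrow> point" where
  "flow i h = (\<lambda>(z, q).
     if i = 0 then (z + h, q) else (z, cos h *\<^sub>R q + sin h *\<^sub>R rmul i q))"

definition frame_D :: "4 \<Rightarrow> (point \<Rightarrow> real) \<Rightarrow> point \<Rightarrow> real" where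
  "frame_D i f p = deriv (\<lambda>h. f (flow i h p)) 0"

text \<open>
  Structure functions: \<open>[E\<^sub>i, E\<^sub>j] = (\<Sum>k. struct i j k * E\<^sub>k)\<close>. Since
  \<open>d\<eta>(X, Y) = - \<eta>([X, Y])\<close> for left-invariant \<open>\<eta>, X, Y\<close>, this is the coframe normalisation
  \<open>d\<eta>\<^sup>1 = -2 \<eta>\<^sup>2 \<and> \<eta>\<^sup>3\<close> and its cyclic permutations.
\<close>

definition struct :: "4 \<Rightarrow> 4 \<Rightarrow> 4 \<Rightarrow> real" where
  "struct i j k =
     (if (i, j, k) \<in> {(1, 2, 3), (2, 3, 1), (3, 1, 2)} then 2
      else if (j, i, k) \<in> {(1, 2, 3), (2, 3, 1), (3, 1, 2)} then - 2 else 0)"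

text \<open>The linear vector fields \<open>q \<mapsto> A q\<close>, \<open>q \<mapsto> B q\<close> have the Lie bracket \<open>q \<mapsto> (B A - A B) q\<close>,
  so the following says that the fields given by \<open>rmul\<close> have these structure constants.\<close>

lemma rmul_bracket:
  assumes "i \<noteq> 0" "j \<noteq> 0"
  shows "rmul j (rmul i q) - rmul i (rmul j q) = (\<Sum>k\<in>UNIV. struct i j k *\<^sub>R rmul k q)"
  using assms exhaust_4[of i] exhaust_4[of j]
  by (cases q) (auto simp: sum_4 rmul_def struct_def algebra_simps scaleR_conv_of_real)

lemma flow_in_cyl:
  assumes "i \<noteq> 0" "p \<in> cyl I"
  shows "flow i h p \<in> cyl I"
proof -
  obtain z q where p: "p = (z, q)" by (cases p)
  with assms have z: "z \<in> I" and q: "q \<bullet> q = 1"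
    by (auto simp: cyl_def norm_eq_1)
  have orth: "q \<bullet> rmul i q = 0" "rmul i q \<bullet> rmul i q = q \<bullet> q"
    using assms(1) exhaust_4[of i]
    by (cases q; auto simp: rmul_def inner_prod_def inner_complex_def algebra_simps)+
  have "(cos h *\<^sub>R q + sin h *\<^sub>R rmul i q) \<bullet> (cos h *\<^sub>R q + sin h *\<^sub>R rmul i q) = 1"
    using orth q sin_cos_squared_add2[of h]
    by (simp add: inner_add_left inner_add_right inner_commute power2_eq_square)
  then show ?thesis
    using p z assms(1) by (simp add: flow_def cyl_def norm_eq_1)
qed

primrec frame_Ds :: "4 list \<Rightarrow> (point \<Rightarrow> real) \<Rightarrow> point \<Rightarrow> real" where
  "frame_Ds [] f = f"
| "frame_Ds (i # is) f = frame_D i (frame_Ds is f)"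

definition smooth_fun :: "real set \<Rightarrow> (point \<Rightarrow> real) \<Rightarrow> bool" where
  "smooth_fun I f \<longleftrightarrow>
     (\<forall>is. continuous_on (cyl I) (frame_Ds is f) \<and>
        (\<forall>i. \<forall>p\<in>cyl I. (\<lambda>h. frame_Ds is f (flow i h p)) differentiable (at 0)))"


section \<open>Riemannian geometry in the frame\<close>

text \<open>A metric is given by its matrix in the frame; covariant tensors of any rank are given by
  their components, indexed by a list of frame indices.\<close>

type_synonym metric = "point \<Rightarrow> real^4^4"
type_synonym tensor = "4 list \<Rightarrow> point \<Rightarrow> real"

definition ginv :: "metric \<Rightarrow> 4 \<Rightarrow> 4 \<Rightarrow> point \<Rightarrow> real" where
  "ginv g i j p = matrix_inv (g p) $ i $ j"

text \<open>Koszul's formula for \<open>g(\<nabla>\<^sub>i E\<^sub>j, E\<^sub>k)\<close>, and \<open>\<nabla>\<^sub>i E\<^sub>j = (\<Sum>k. christoffel g i j k * E\<^sub>k)\<close>.\<close>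

definition koszul :: "metric \<Rightarrow> 4 \<Rightarrow> 4 \<Rightarrow> 4 \<Rightarrow> point \<Rightarrow> real" where
  "koszul g i j k p =
     (frame_D i (\<lambda>p. g p $ j $ k) p + frame_D j (\<lambda>p. g p $ i $ k) p
        - frame_D k (\<lambda>p. g p $ i $ j) p
      + (\<Sum>l\<in>UNIV. struct i j l * g p $ l $ k - struct i k l * g p $ l $ j
                   - struct j k l * g p $ l $ i)) / 2"

definition christoffel :: "metric \<Rightarrow> 4 \<Rightarrow> 4 \<Rightarrow> 4 \<Rightarrow> point \<Rightarrow> real" where
  "christoffel g i j k p = (\<Sum>l\<in>UNIV. koszul g i j l p * ginv g l k p)"

text \<open>The new index of the covariant derivative comes first:
  \<open>cov g T (a # is) = (\<nabla>\<^sub>a T)\<^sub>i\<^sub>s\<close>. Hence \<open>cov g (cov g T) (b # a # is)\<close> is \<open>T\<^sub>i\<^sub>s\<close> differentiated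
  first in the direction \<open>a\<close> and then in the direction \<open>b\<close>.\<close>

fun cov :: "metric \<Rightarrow> tensor \<Rightarrow> tensor" where
  "cov g T [] p = 0"
| "cov g T (a # is) p =
     frame_D a (T is) p
     - (\<Sum>m<length is. \<Sum>c\<in>UNIV. christoffel g a (is ! m) c p * T (is[m := c]) p)"

text \<open>\<open>curv g i j k l\<close> is the \<open>E\<^sub>l\<close>-component of
  \<open>R(E\<^sub>i, E\<^sub>j)E\<^sub>k = \<nabla>\<^sub>i \<nabla>\<^sub>j E\<^sub>k - \<nabla>\<^sub>j \<nabla>\<^sub>i E\<^sub>k - \<nabla>\<^bsub>[E\<^sub>i, E\<^sub>j]\<^esub> E\<^sub>k\<close>.\<close>

definition curv :: "metric \<Rightarrow> 4 \<Rightarrow> 4 \<Rightarrow> 4 \<Rightarrow> 4 \<Rightarrow> point \<Rightarrow> real" where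
  "curv g i j k l p =
     frame_D i (christoffel g j k l) p - frame_D j (christoffel g i k l) p
     + (\<Sum>m\<in>UNIV. christoffel g j k m p * christoffel g i m l p
                  - christoffel g i k m p * christoffel g j m l p
                  - struct i j m * christoffel g m k l p)"

text \<open>With this convention \<open>Rm\<^sub>1\<^sub>2\<^sub>2\<^sub>1 > 0\<close> on round spheres, and the Ricci tensor is the trace over
  the two outer indices, as in the contraction \<open>W\<^sub>s\<^sub>i\<^sub>j\<^sub>t Ric\<^sup>s\<^sup>t\<close> in the Bach tensor.\<close>

definition Rm :: "metric \<Rightarrow> 4 \<Rightarrow> 4 \<Rightarrow> 4 \<Rightarrow> 4 \<Rightarrow> point \<Rightarrow> real" where
  "Rm g i j k l p = (\<Sum>m\<in>UNIV. curv g i j k m p * g p $ m $ l)"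

definition Ric :: "metric \<Rightarrow> 4 \<Rightarrow> 4 \<Rightarrow> point \<Rightarrow> real" where
  "Ric g i j p = (\<Sum>s\<in>UNIV. \<Sum>u\<in>UNIV. ginv g s u p * Rm g s i j u p)"

definition scal :: "metric \<Rightarrow> point \<Rightarrow> real" where
  "scal g p = (\<Sum>i\<in>UNIV. \<Sum>j\<in>UNIV. ginv g i j p * Ric g i j p)"

definition Ric0 :: "metric \<Rightarrow> 4 \<Rightarrow> 4 \<Rightarrow> point \<Rightarrow> real" where
  "Ric0 g i j p = Ric g i j p - scal g p / 4 * g p $ i $ j"

text \<open>The Weyl tensor in dimension four.\<close>

definition Weyl :: "metric \<Rightarrow> 4 \<Rightarrow> 4 \<Rightarrow> 4 \<Rightarrow> 4 \<Rightarrow> point \<Rightarrow> real" where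
  "Weyl g i j k l p =
     Rm g i j k l p
     - (g p $ i $ l * Ric g j k p + g p $ j $ k * Ric g i l p
        - g p $ i $ k * Ric g j l p - g p $ j $ l * Ric g i k p) / 2
     + scal g p / 6 * (g p $ i $ l * g p $ j $ k - g p $ i $ k * g p $ j $ l)"

definition Weyl_tensor :: "metric \<Rightarrow> tensor" where
  "Weyl_tensor g is = Weyl g (is ! 0) (is ! 1) (is ! 2) (is ! 3)"

text \<open>\<open>W\<^sub>s\<^sub>i\<^sub>j\<^sub>t\<^sub>,\<^sup>s\<^sup>t + (1/2) W\<^sub>s\<^sub>i\<^sub>j\<^sub>t Ric\<^sup>s\<^sup>t\<close>\<close>

definition Bach :: "metric \<Rightarrow> 4 \<Rightarrow> 4 \<Rightarrow> point \<Rightarrow> real" where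
  "Bach g i j p =
     (\<Sum>s\<in>UNIV. \<Sum>u\<in>UNIV. \<Sum>v\<in>UNIV. \<Sum>w\<in>UNIV. ginv g s v p * ginv g u w p *
        (cov g (cov g (Weyl_tensor g)) [w, v, s, i, j, u] p
         + Weyl g s i j u p * Ric g v w p / 2))"

definition hess :: "metric \<Rightarrow> (point \<Rightarrow> real) \<Rightarrow> 4 \<Rightarrow> 4 \<Rightarrow> point \<Rightarrow> real" where
  "hess g f i j p = cov g (cov g (\<lambda>_. f)) [i, j] p"

definition laplacian :: "metric \<Rightarrow> (point \<Rightarrow> real) \<Rightarrow> point \<Rightarrow> real" where
  "laplacian g f p = (\<Sum>i\<in>UNIV. \<Sum>j\<in>UNIV. ginv g i j p * hess g f i j p)"

definition S_grad :: "metric \<Rightarrow> 4 \<Rightarrow> 4 \<Rightarrow> point \<Rightarrow> real" where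
  "S_grad g i j p =
     2 * (hess g (scal g) i j p - laplacian g (scal g) p * g p $ i $ j
          - scal g p * Ric0 g i j p)"

definition Bt_flat :: "real \<Rightarrow> real set \<Rightarrow> metric \<Rightarrow> bool" where
  "Bt_flat t I g \<longleftrightarrow> (\<forall>p\<in>cyl I. \<forall>i j. - 4 * Bach g i j p + t * S_grad g i j p = 0)"

definition csc :: "real set \<Rightarrow> metric \<Rightarrow> bool" where
  "csc I g \<longleftrightarrow> (\<exists>s0. \<forall>p\<in>cyl I. scal g p = s0)"


section \<open>Extremal Kaehler metrics\<close>

text \<open>An endomorphism field \<open>J\<close> is given by its matrix, \<open>J E\<^sub>a = (\<Sum>b. J p $ a $ b * E\<^sub>b)\<close>;
  \<open>cov_endo g J c a b\<close> is the \<open>E\<^sub>b\<close>-component of \<open>(\<nabla>\<^sub>c J) E\<^sub>a\<close>.\<close>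

definition cov_endo :: "metric \<Rightarrow> (point \<Rightarrow> real^4^4) \<Rightarrow> 4 \<Rightarrow> 4 \<Rightarrow> 4 \<Rightarrow> point \<Rightarrow> real" where
  "cov_endo g J c a b p =
     frame_D c (\<lambda>p. J p $ a $ b) p
     + (\<Sum>d\<in>UNIV. christoffel g c d b p * J p $ a $ d - christoffel g c a d p * J p $ d $ b)"

text \<open>A Kaehler structure: a smooth orthogonal almost complex structure that is parallel for the
  Levi-Civita connection.\<close>

definition kaehler :: "real set \<Rightarrow> metric \<Rightarrow> (point \<Rightarrow> real^4^4) \<Rightarrow> bool" where
  "kaehler I g J \<longleftrightarrow>
     (\<forall>a b. smooth_fun I (\<lambda>p. J p $ a $ b)) \<and>
     (\<forall>p\<in>cyl I. J p ** J p = - mat 1 \<and> J p ** g p ** transpose (J p) = g p \<and>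
        (\<forall>c a b. cov_endo g J c a b p = 0))"

definition J_grad :: "metric \<Rightarrow> (point \<Rightarrow> real^4^4) \<Rightarrow> (point \<Rightarrow> real) \<Rightarrow> 4 \<Rightarrow> point \<Rightarrow> real" where
  "J_grad g J f b p = (\<Sum>a\<in>UNIV. \<Sum>e\<in>UNIV. ginv g e a p * frame_D e f p * J p $ a $ b)"

text \<open>\<open>X\<close> is given by its components; Killing's equation is \<open>\<nabla>\<^sub>a X\<^sub>b + \<nabla>\<^sub>b X\<^sub>a = 0\<close>.\<close>

definition lower :: "metric \<Rightarrow> (4 \<Rightarrow> point \<Rightarrow> real) \<Rightarrow> tensor" where
  "lower g X is p = (\<Sum>b\<in>UNIV. X b p * g p $ b $ (is ! 0))"

definition killing :: "real set \<Rightarrow> metric \<Rightarrow> (4 \<Rightarrow> point \<Rightarrow> real) \<Rightarrow> bool" where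
  "killing I g X \<longleftrightarrow>
     (\<forall>p\<in>cyl I. \<forall>a b. cov g (lower g X) [a, b] p + cov g (lower g X) [b, a] p = 0)"

definition extremal_kaehler :: "real set \<Rightarrow> metric \<Rightarrow> (point \<Rightarrow> real^4^4) \<Rightarrow> bool" where
  "extremal_kaehler I g J \<longleftrightarrow> kaehler I g J \<and> killing I g (J_grad g J (scal g))"

definition conformal_to_extremal_kaehler :: "real set \<Rightarrow> metric \<Rightarrow> bool" where
  "conformal_to_extremal_kaehler I g \<longleftrightarrow>
     (\<exists>u J. smooth_fun I u \<and> (\<forall>p\<in>cyl I. u p > 0) \<and>
        extremal_kaehler I (\<lambda>p. u p *\<^sub>R g p) J)"


section \<open>\<open>U(2)\<close>-invariant metrics and their initial data\<close>

definition u2_metric :: "(real \<Rightarrow> real) \<Rightarrow> (real \<Rightarrow> real) \<Rightarrow> metric" where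
  "u2_metric F C p =
     (let z = fst p in
      (\<chi> i j. if i \<noteq> j then 0
              else C z * (if i = 0 then 1 / (4 * F z) else if i = 1 then F z else 1)))"

definition open_interval :: "real set \<Rightarrow> bool" where
  "open_interval I \<longleftrightarrow> open I \<and> is_interval I \<and> I \<noteq> {}"

definition smooth_on :: "real set \<Rightarrow> (real \<Rightarrow> real) \<Rightarrow> bool" where
  "smooth_on I f \<longleftrightarrow> (\<forall>k. (deriv ^^ k) f differentiable_on I)"

type_synonym local_metrics = "real set \<Rightarrow> (real \<Rightarrow> real) \<Rightarrow> (real \<Rightarrow> real) \<Rightarrow> bool"

definition Bt_flat_solution :: "real \<Rightarrow> local_metrics" where
  "Bt_flat_solution t I F C \<longleftrightarrow>
     open_interval I \<and> smooth_on I F \<and> smooth_on I C \<and> (\<forall>z\<in>I. F z > 0 \<and> C z > 0) \<and>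
     Bt_flat t I (u2_metric F C)"

definition csc_Bt_flat_solution :: "real \<Rightarrow> local_metrics" where
  "csc_Bt_flat_solution t I F C \<longleftrightarrow> Bt_flat_solution t I F C \<and> csc I (u2_metric F C)"

text \<open>The equations are of fourth order in \<open>F\<close> and \<open>C\<close>, so the initial data at a point are
  the two 3-jets there.\<close>

type_synonym jets = "(real \<times> real \<times> real \<times> real) \<times> (real \<times> real \<times> real \<times> real)"

definition jet3 :: "(real \<Rightarrow> real) \<Rightarrow> real \<Rightarrow> real \<times> real \<times> real \<times> real" where
  "jet3 f z = (f z, deriv f z, (deriv ^^ 2) f z, (deriv ^^ 3) f z)"

definition data :: "(real \<Rightarrow> real) \<Rightarrow> (real \<Rightarrow> real) \<Rightarrow> real \<Rightarrow> jets" where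
  "data F C z = (jet3 F z, jet3 C z)"

definition initial_data :: "local_metrics \<Rightarrow> real \<Rightarrow> jets set" where
  "initial_data S z0 = {data F C z0 | I F C. S I F C \<and> z0 \<in> I}"

definition determined_by_data :: "local_metrics \<Rightarrow> real \<Rightarrow> bool" where
  "determined_by_data S z0 \<longleftrightarrow>
     (\<forall>I F C I' F' C'. S I F C \<and> S I' F' C' \<and> z0 \<in> I \<inter> I' \<and> data F C z0 = data F' C' z0
        \<longrightarrow> (\<forall>z\<in>I \<inter> I'. F z = F' z \<and> C z = C' z))"

text \<open>
  Two initial data at \<open>z0\<close> are homothetic if the local metrics they determine are related by a
  translation in \<open>z\<close> and multiplication by a positive constant. Since a local solution is
  translated along the whole interval on which it exists, the second one has
  to be compared with a translate of an extension of the first one.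
\<close>

definition homothetic_data :: "local_metrics \<Rightarrow> real \<Rightarrow> jets \<Rightarrow> jets \<Rightarrow> bool" where
  "homothetic_data S z0 x y \<longleftrightarrow>
     (\<exists>I F C a c. S I F C \<and> z0 \<in> I \<and> z0 + a \<in> I \<and> c > 0 \<and>
        x = data F C z0 \<and> y = data (\<lambda>z. F (z + a)) (\<lambda>z. c * C (z + a)) z0)"

definition C1_map_on :: "'p::euclidean_space set \<Rightarrow> ('p \<Rightarrow> 'a::euclidean_space)
    \<Rightarrow> ('p \<Rightarrow> 'p \<Rightarrow>\<^sub>L 'a) \<Rightarrow> bool" where
  "C1_map_on U \<phi> \<phi>' \<longleftrightarrow>
     open U \<and> (\<forall>x\<in>U. (\<phi> has_derivative blinfun_apply (\<phi>' x)) (at x)) \<and> continuous_on U \<phi>'"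

text \<open>
  \<open>A\<close> modulo the relation \<open>E\<close> has exactly \<open>DIM('p)\<close> parameters.
  At least: there is an injectively immersed open patch of parameters in \<open>A\<close> in which every
  element is equivalent to at most countably many others (a discrete set of coincidences does
  not affect the number of parameters). At most: up to \<open>E\<close>, countably many differentiable
  families with \<open>DIM('p)\<close> parameters exhaust \<open>A\<close>. With equality for \<open>E\<close> this is the dimension of
  the set \<open>A\<close>, which need not be a manifold everywhere.
\<close>

definition has_parameters ::
  "'p::euclidean_space itself \<Rightarrow> 'a::euclidean_space set \<Rightarrow> ('a \<Rightarrow> 'a \<Rightarrow> bool) \<Rightarrow> bool" where
  "has_parameters _ A E \<longleftrightarrow>
     (\<exists>(U::'p set) \<phi> \<phi>'. C1_map_on U \<phi> \<phi>' \<and> U \<noteq> {} \<and> inj_on \<phi> U \<and>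
        (\<forall>x\<in>U. inj (blinfun_apply (\<phi>' x))) \<and> \<phi> ` U \<subseteq> A \<and>
        (\<forall>x\<in>U. countable {y \<in> U. E (\<phi> x) (\<phi> y)})) \<and>
     (\<exists>(V::nat \<Rightarrow> 'p set) \<psi> \<psi>'. (\<forall>n. C1_map_on (V n) (\<psi> n) (\<psi>' n)) \<and>
        (\<forall>x\<in>A. \<exists>n. \<exists>y\<in>V n. E x (\<psi> n y)))"

end

theory Submission
  imports Defs "HOL-Real_Asymp.Real_Asymp"
begin

text \<open>
  Every assertion can be turned into one about ordinary differential equations.

  In the frame \<open>E\<^sub>0 = \<partial>/\<partial>z, E\<^sub>1, E\<^sub>2, E\<^sub>3\<close> the metric is diagonal with entries that depend on \<open>z\<close>
  only, and so all its curvature quantities are rational functions of the derivatives of \<open>F\<close> and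
  \<open>C\<close> at \<open>z\<close>. Computing them shows (\<open>Bt_flat_iff\<close>) that being \<open>B\<^sup>t\<close>-flat amounts to three scalar
  equations: \<open>w = 0\<close>, which says that the scalar curvature \<open>s\<close> is harmonic and is solved for
  the fourth derivative of \<open>C\<close>; \<open>e\<^sub>1 + N = 0\<close> with \<open>e\<^sub>1 = F'''' - 5 F'' + 4 F - 4\<close>, which is solved for
  the fourth derivative of \<open>F\<close>; and the third order equation \<open>K = 0\<close>, which comes from the
  \<open>zz\<close>-component. The equations are the Euler-Lagrange equations of a Lagrangian in which \<open>z\<close> does
  not occur, and \<open>K\<close> is the corresponding energy: it is constant along solutions of the other two
  equations (\<open>K_derivative\<close>). Hence the germs of solutions at \<open>z\<^sub>0\<close> correspond to the points of the
  hypersurface \<open>K = 0\<close> in the eight-dimensional space of pairs of 3-jets, by the theorem of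
  Picard and Lindeloef. That is the seven-dimensional solution space.

  A translation moves a germ along its solution curve, and scaling multiplies the jet of \<open>C\<close>. Both
  are divided out by the slices \<open>C = 1\<close>, \<open>F = q\<close>. Where \<open>F' \<noteq> 0\<close> a solution crosses a given slice only
  at isolated points, hence countably often; and it meets one with rational \<open>q\<close>
  unless \<open>F\<close> is constant, which leaves a four-parameter family. So five parameters remain. For
  solutions \<open>(C F s')' = 0\<close>, so constant scalar curvature is the single additional condition
  \<open>s'(z\<^sub>0) = 0\<close> on the jet, and four parameters remain.

  For the last assertion, suppose that the conformal class contains a Kaehler metric \<open>(v h, J)\<close>,
  where \<open>h\<close> is the metric with \<open>C = 1\<close>. The (anti-)self-dual parts of the Kaehler form are parallel,
  hence annihilated by the curvature of \<open>\<Lambda>\<^sup>\<plusminus>\<close>, which on the bivectors of the same type is the Weyl tensor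
  \<open>W\<^sup>\<plusminus>\<close> up to a multiple of the identity. It has a simple eigenvalue on the invariant form and a double one
  on the complement; their difference is a multiple of \<open>F'' \<minusplus> 3 F' + 2 F - 2\<close>. If these two expressions
  vanish nowhere, the Kaehler form is a multiple of the invariant one (\<open>curvature_2\<close>,
  \<open>curvature_3\<close>). Being parallel, it then forces \<open>v = k exp (\<plusminus> z)\<close> (\<open>structure_determined\<close>), and
  Killing's equation for \<open>J\<nabla>s\<close> becomes \<open>e\<^sub>1 = 0\<close> (\<open>extremal_equation\<close>). On the other hand \<open>e\<^sub>1 = - N\<close> for a \<open>B\<^sup>t\<close>-flat metric,
  and there are initial data of constant scalar curvature at which \<open>N\<close> and both expressions
  are different from zero.
\<close>

section \<open>Smooth functions of one variable\<close>

text \<open>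
  The condition \<open>smooth_on\<close> speaks of the iterated \<^const>\<open>deriv\<close>, which is awkward for products and
  quotients. Having \<open>n\<close> successive derivatives, whatever they are called, passes through
  the rules of calculus by induction on \<open>n\<close>; on open sets smoothness is the conjunction over all \<open>n\<close>.
\<close>

primrec has_derivs :: "nat \<Rightarrow> real set \<Rightarrow> (real \<Rightarrow> real) \<Rightarrow> bool" where
  "has_derivs 0 I f = True"
| "has_derivs (Suc n) I f =
     (\<exists>f'. (\<forall>z\<in>I. (f has_real_derivative f' z) (at z)) \<and> has_derivs n I f')"

lemma has_real_derivative_cong_open:
  assumes "(f has_real_derivative d) (at z)" "open I" "z \<in> I" "\<And>w. w \<in> I \<Longrightarrow> f w = g w"
  shows "(g has_real_derivative d) (at z)"
  by (rule has_field_derivative_transform_within_open[OF assms(1-3)]) (use assms in auto)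

lemma has_derivs_Suc_I:
  "(\<And>z. z \<in> I \<Longrightarrow> (f has_real_derivative f' z) (at z)) \<Longrightarrow> has_derivs n I f' \<Longrightarrow> has_derivs (Suc n) I f"
  by auto

lemma has_derivs_cong:
  assumes "open I" "has_derivs n I f" "\<And>z. z \<in> I \<Longrightarrow> f z = g z"
  shows "has_derivs n I g"
proof (cases n)
  case (Suc m)
  then obtain f' where f': "\<And>z. z \<in> I \<Longrightarrow> (f has_real_derivative f' z) (at z)" "has_derivs m I f'"
    using assms(2) by auto
  show ?thesis
    unfolding Suc
    by (rule has_derivs_Suc_I[OF _ f'(2)], rule has_real_derivative_cong_open[OF f'(1) assms(1)])
       (use assms(3) in auto)
qed simp

lemma has_derivs_Suc_imp: "has_derivs (Suc n) I f \<Longrightarrow> has_derivs n I f"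
proof (induction n arbitrary: f)
  case (Suc n)
  then obtain f' where f': "\<And>z. z \<in> I \<Longrightarrow> (f has_real_derivative f' z) (at z)" "has_derivs (Suc n) I f'"
    unfolding has_derivs.simps(2)[of "Suc n"] by blast
  show ?case by (rule has_derivs_Suc_I[OF f'(1) Suc.IH[OF f'(2)]])
qed simp

lemma has_derivs_const: "has_derivs n I (\<lambda>z. c)"
proof (induction n arbitrary: c)
  case (Suc n)
  show ?case by (rule has_derivs_Suc_I[OF _ Suc[of 0]]) simp
qed simp

lemma has_derivs_add: "has_derivs n I f \<Longrightarrow> has_derivs n I g \<Longrightarrow> has_derivs n I (\<lambda>z. f z + g z)"
proof (induction n arbitrary: f g)
  case (Suc n)
  then obtain f' g' where *: "has_derivs n I f'" "has_derivs n I g'"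
    "\<And>z. z \<in> I \<Longrightarrow> (f has_real_derivative f' z) (at z)"
    "\<And>z. z \<in> I \<Longrightarrow> (g has_real_derivative g' z) (at z)"
    by auto
  have "\<forall>z\<in>I. ((\<lambda>z. f z + g z) has_real_derivative f' z + g' z) (at z)"
    by (auto intro!: DERIV_add *)
  with Suc.IH[OF *(1,2)] show ?case by auto
qed simp

lemma has_derivs_mult: "has_derivs n I f \<Longrightarrow> has_derivs n I g \<Longrightarrow> has_derivs n I (\<lambda>z. f z * g z)"
proof (induction n arbitrary: f g)
  case (Suc n)
  then obtain f' g' where *: "has_derivs n I f'" "has_derivs n I g'"
    "\<And>z. z \<in> I \<Longrightarrow> (f has_real_derivative f' z) (at z)"
    "\<And>z. z \<in> I \<Longrightarrow> (g has_real_derivative g' z) (at z)"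
    by auto
  have d: "\<forall>z\<in>I. ((\<lambda>z. f z * g z) has_real_derivative f' z * g z + g' z * f z) (at z)"
    by (auto intro!: DERIV_mult *)
  have "has_derivs n I (\<lambda>z. f' z * g z + g' z * f z)"
    by (intro has_derivs_add Suc.IH * has_derivs_Suc_imp[OF Suc.prems(1)] has_derivs_Suc_imp[OF Suc.prems(2)])
  with d show ?case by auto
qed simp

lemma has_derivs_inverse: "has_derivs n I f \<Longrightarrow> (\<And>z. z \<in> I \<Longrightarrow> f z \<noteq> 0) \<Longrightarrow> has_derivs n I (\<lambda>z. inverse (f z))"
proof (induction n arbitrary: f)
  case (Suc n)
  then obtain f' where *: "has_derivs n I f'"
    "\<And>z. z \<in> I \<Longrightarrow> (f has_real_derivative f' z) (at z)"
    by auto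
  have d: "\<forall>z\<in>I. ((\<lambda>z. inverse (f z)) has_real_derivative
      (- 1) * (f' z * (inverse (f z) * inverse (f z)))) (at z)"
    using Suc.prems(2) by (auto intro!: derivative_eq_intros *)
  have "has_derivs n I (\<lambda>z. (- 1) * (f' z * (inverse (f z) * inverse (f z))))"
    using Suc.prems(2) by (intro has_derivs_mult has_derivs_const Suc.IH * has_derivs_Suc_imp[OF Suc.prems(1)])
  with d show ?case by auto
qed simp

lemma smooth_on_iff_has_derivs:
  assumes I: "open I"
  shows "smooth_on I f \<longleftrightarrow> (\<forall>n. has_derivs n I f)"
proof
  assume s: "smooth_on I f"
  have "has_derivs n I ((deriv ^^ k) f)" for n k
  proof (induction n arbitrary: k)
    case (Suc n)
    have "\<forall>z\<in>I. ((deriv ^^ k) f has_real_derivative (deriv ^^ Suc k) f z) (at z)"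
      using s I by (auto simp: smooth_on_def differentiable_on_eq_differentiable_at
          simp flip: DERIV_deriv_iff_real_differentiable)
    then show ?case using Suc[of "Suc k"] by (auto simp del: funpow.simps)
  qed simp
  from this[of _ 0] show "\<forall>n. has_derivs n I f" by simp
next
  assume c: "\<forall>n. has_derivs n I f"
  have *: "\<forall>n. has_derivs n I ((deriv ^^ k) f)" for k
  proof (induction k)
    case (Suc k)
    show ?case
    proof
      fix n
      obtain f' where f': "\<And>z. z \<in> I \<Longrightarrow> ((deriv ^^ k) f has_real_derivative f' z) (at z)" "has_derivs n I f'"
        using spec[OF Suc, of "Suc n"] by auto
      show "has_derivs n I ((deriv ^^ Suc k) f)"
        by (rule has_derivs_cong[OF I f'(2)]) (simp add: DERIV_imp_deriv[OF f'(1)])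
    qed
  qed (use c in simp)
  have "(deriv ^^ k) f differentiable_on I" for k
  proof -
    have "has_derivs (Suc 0) I ((deriv ^^ k) f)" using * by blast
    then obtain f' where "\<And>z. z \<in> I \<Longrightarrow> ((deriv ^^ k) f has_real_derivative f' z) (at z)" by auto
    then show ?thesis
      using I by (auto simp: differentiable_on_eq_differentiable_at real_differentiable_def)
  qed
  then show "smooth_on I f" unfolding smooth_on_def by (rule allI)
qed

context
  fixes I :: "real set"
  assumes I: "open I"
begin

lemma smooth_on_const: "smooth_on I (\<lambda>z. c)"
  by (simp add: smooth_on_iff_has_derivs[OF I] has_derivs_const)

lemma smooth_on_add: "smooth_on I f \<Longrightarrow> smooth_on I g \<Longrightarrow> smooth_on I (\<lambda>z. f z + g z)"
  by (simp add: smooth_on_iff_has_derivs[OF I] has_derivs_add)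

lemma smooth_on_mult: "smooth_on I f \<Longrightarrow> smooth_on I g \<Longrightarrow> smooth_on I (\<lambda>z. f z * g z)"
  by (simp add: smooth_on_iff_has_derivs[OF I] has_derivs_mult)

lemma smooth_on_minus: "smooth_on I f \<Longrightarrow> smooth_on I (\<lambda>z. - f z)"
  using smooth_on_mult[OF smooth_on_const[of "- 1"]] by simp

lemma smooth_on_diff: "smooth_on I f \<Longrightarrow> smooth_on I g \<Longrightarrow> smooth_on I (\<lambda>z. f z - g z)"
  using smooth_on_add[OF _ smooth_on_minus] by simp

lemma smooth_on_divide:
  "smooth_on I f \<Longrightarrow> smooth_on I g \<Longrightarrow> (\<And>z. z \<in> I \<Longrightarrow> g z \<noteq> 0) \<Longrightarrow> smooth_on I (\<lambda>z. f z / g z)"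
  by (simp add: smooth_on_iff_has_derivs[OF I] divide_inverse has_derivs_mult has_derivs_inverse)

lemma smooth_on_power: "smooth_on I f \<Longrightarrow> smooth_on I (\<lambda>z. f z ^ n)"
  by (induction n) (simp_all add: smooth_on_const smooth_on_mult)

lemma smooth_on_sum: "(\<And>x. x \<in> A \<Longrightarrow> smooth_on I (f x)) \<Longrightarrow> smooth_on I (\<lambda>z. \<Sum>x\<in>A. f x z)"
  by (induction A rule: infinite_finite_induct) (simp_all add: smooth_on_const smooth_on_add)

lemma smooth_on_has_derivative:
  "smooth_on I f \<Longrightarrow> z \<in> I \<Longrightarrow> (f has_real_derivative deriv f z) (at z)"
  using I by (auto simp: smooth_on_def differentiable_on_eq_differentiable_at
      DERIV_deriv_iff_real_differentiable dest!: spec[of _ 0])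

end

lemma smooth_on_deriv: "smooth_on I f \<Longrightarrow> smooth_on I (deriv f)"
proof -
  assume "smooth_on I f"
  then have "(deriv ^^ Suc k) f differentiable_on I" for k
    unfolding smooth_on_def by blast
  then show ?thesis
    unfolding smooth_on_def by (simp add: funpow_swap1)
qed

lemmas smooth_on_intros =
  smooth_on_const smooth_on_add smooth_on_mult smooth_on_minus smooth_on_diff smooth_on_divide
  smooth_on_power smooth_on_sum smooth_on_deriv

section \<open>Frame derivatives\<close>

text \<open>
  Case distinctions from \<open>exhaust_4\<close> produce the index 4, which is the index 0 of \<open>\<partial>/\<partial>z\<close>.
\<close>

lemma zero_in_4: "(4::4) = 0"
  by simp

lemma flow_0: "flow i 0 p = p"
  by (cases p) (simp add: flow_def)

lemma fst_flow: "fst (flow i h p) = (if i = 0 then fst p + h else fst p)"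
  by (cases p) (simp add: flow_def)

lemma eventually_flow_in_cyl:
  assumes "open I" "p \<in> cyl I"
  shows "\<forall>\<^sub>F h in nhds 0. flow i h p \<in> cyl I"
proof (cases "i = 0")
  case True
  obtain z q where p: "p = (z, q)" by (cases p)
  have "((\<lambda>h. z + h) \<longlongrightarrow> z + 0) (nhds 0)" by (intro tendsto_intros filterlim_ident)
  then have "\<forall>\<^sub>F h in nhds 0. z + h \<in> I"
    using assms p by (intro topological_tendstoD) (auto simp: cyl_def)
  then show ?thesis
    by eventually_elim (use assms p True in \<open>auto simp: flow_def cyl_def\<close>)
next
  case False
  then show ?thesis using flow_in_cyl[OF False assms(2)] by simp
qed

lemma frame_D_cong:
  assumes "open I" "p \<in> cyl I" "\<And>q. q \<in> cyl I \<Longrightarrow> f q = g q"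
  shows "frame_D i f p = frame_D i g p"
proof -
  have "\<forall>\<^sub>F h in nhds 0. f (flow i h p) = g (flow i h p)"
    using eventually_flow_in_cyl[OF assms(1,2)] by eventually_elim (rule assms(3))
  then show ?thesis unfolding frame_D_def by (rule deriv_cong_ev) simp
qed

lemma frame_D_fst: "frame_D i (\<lambda>p. \<phi> (fst p)) p = (if i = 0 then deriv \<phi> (fst p) else 0)"
proof (cases "i = 0")
  case True
  have "deriv (\<lambda>h. \<phi> (fst p + h)) 0 = deriv \<phi> (fst p)"
    by (subst (2) deriv_shift_0) (simp add: comp_def)
  then show ?thesis by (simp add: frame_D_def fst_flow True)
qed (simp add: frame_D_def fst_flow)

lemma frame_D_fst_cong:
  assumes "open I" "p \<in> cyl I" "\<And>q. q \<in> cyl I \<Longrightarrow> f q = \<phi> (fst q)"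
  shows "frame_D i f p = (if i = 0 then deriv \<phi> (fst p) else 0)"
  using frame_D_cong[OF assms(1,2), of f "\<lambda>p. \<phi> (fst p)"] assms(3) frame_D_fst by metis

lemma fst_in_I: "p \<in> cyl I \<Longrightarrow> fst p \<in> I"
  by (auto simp: cyl_def)

section \<open>Invariant tensors\<close>

text \<open>
  The covariant derivative of a tensor whose components, like the Christoffel symbols \<open>G\<close>, depend on
  \<open>z\<close> only: frame derivatives other than \<open>E\<^sub>0\<close> drop out.
\<close>

definition covz :: "(4 \<Rightarrow> 4 \<Rightarrow> 4 \<Rightarrow> real \<Rightarrow> real) \<Rightarrow> (4 list \<Rightarrow> real \<Rightarrow> real) \<Rightarrow> 4 list \<Rightarrow> real \<Rightarrow> real" where
  "covz G T is z = (case is of [] \<Rightarrow> 0 | a # is \<Rightarrow> (if a = 0 then deriv (T is) z else 0)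
     - (\<Sum>m<length is. \<Sum>c\<in>UNIV. G a (is ! m) c z * T (is[m := c]) z))"

lemma cov_invariant:
  assumes "open I" "p \<in> cyl I" "\<And>q is. q \<in> cyl I \<Longrightarrow> T is q = \<tau> is (fst q)"
    "\<And>q i j k. q \<in> cyl I \<Longrightarrow> christoffel g i j k q = G i j k (fst q)"
  shows "cov g T is p = covz G \<tau> is (fst p)"
  using assms(2-4) frame_D_fst_cong[OF assms(1,2), of "T (tl is)" "\<tau> (tl is)"]
  by (cases "is") (simp_all add: covz_def)

lemma smooth_on_covz:
  assumes "open I" "\<And>i j k. smooth_on I (G i j k)" "\<And>is. smooth_on I (T is)"
  shows "smooth_on I (covz G T is)"
proof (cases "is")
  case Nil
  then show ?thesis by (simp add: covz_def[abs_def] smooth_on_const[OF assms(1)])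
next
  case (Cons a js)
  have "covz G T is = (\<lambda>z. (if a = 0 then deriv (T js) z else 0)
     - (\<Sum>m<length js. \<Sum>c\<in>UNIV. G a (js ! m) c z * T (js[m := c]) z))"
    by (simp add: covz_def[abs_def] Cons)
  then show ?thesis
    by (cases "a = 0") (simp_all, (rule smooth_on_intros assms)+)
qed

text \<open>
  Contracting two indices with the inverse metric commutes with the covariant derivative, because the
  inverse metric \<open>\<gamma>\<close> is parallel. This reduces the second divergence of the Weyl tensor to
  a first divergence of a tensor that has only a few components.
\<close>

lemma covz_contract:
  assumes I: "open I" "z \<in> I" and G: "\<And>s. smooth_on I (\<gamma> s)" and T: "\<And>is. smooth_on I (T is)"
    and metric: "\<And>u s c. \<gamma> s z * G u s c z + \<gamma> c z * G u c s z
       = (if u = 0 \<and> s = c then - deriv (\<gamma> s) z else 0)"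
  shows "(\<Sum>s\<in>UNIV. \<gamma> s z * covz G T (u # s # s # is) z)
       = covz G (\<lambda>is z. \<Sum>s\<in>UNIV. \<gamma> s z * T (s # s # is) z) (u # is) z"
proof -
  have split: "(\<Sum>m<length (s # s # is). \<Sum>c\<in>UNIV. G u ((s # s # is) ! m) c z * T ((s # s # is)[m := c]) z)
     = (\<Sum>c\<in>UNIV. G u s c z * T (c # s # is) z) + (\<Sum>c\<in>UNIV. G u s c z * T (s # c # is) z)
     + (\<Sum>m<length is. \<Sum>c\<in>UNIV. G u (is ! m) c z * T (s # s # is[m := c]) z)" for s
    by (simp add: sum.lessThan_Suc_shift del: sum.lessThan_Suc)
  have "(\<Sum>s\<in>UNIV. \<gamma> s z * (\<Sum>c\<in>UNIV. G u s c z * T (c # s # is) z))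
      + (\<Sum>s\<in>UNIV. \<gamma> s z * (\<Sum>c\<in>UNIV. G u s c z * T (s # c # is) z))
      = (\<Sum>s\<in>UNIV. \<Sum>c\<in>UNIV. (\<gamma> s z * G u s c z + \<gamma> c z * G u c s z) * T (c # s # is) z)"
    unfolding sum_distrib_left distrib_right sum.distrib
    by (subst (2) sum.swap) (simp add: mult.assoc)
  also have "\<dots> = (if u = 0 then - (\<Sum>s\<in>UNIV. deriv (\<gamma> s) z * T (s # s # is) z) else 0)"
  proof (cases "u = 0")
    case True
    have "(\<Sum>c\<in>UNIV. (\<gamma> s z * G u s c z + \<gamma> c z * G u c s z) * T (c # s # is) z)
        = - deriv (\<gamma> s) z * T (s # s # is) z" for s
      unfolding metric using True by (subst sum.remove[of _ s]) auto
    then show ?thesis using True by (simp add: sum_negf)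
  next
    case False
    then show ?thesis unfolding metric by simp
  qed
  finally have *: "(\<Sum>s\<in>UNIV. \<gamma> s z * (\<Sum>c\<in>UNIV. G u s c z * T (c # s # is) z))
      + (\<Sum>s\<in>UNIV. \<gamma> s z * (\<Sum>c\<in>UNIV. G u s c z * T (s # c # is) z))
      = (if u = 0 then - (\<Sum>s\<in>UNIV. deriv (\<gamma> s) z * T (s # s # is) z) else 0)" .
  have d: "deriv (\<lambda>z. \<Sum>s\<in>UNIV. \<gamma> s z * T (s # s # is) z) z
      = (\<Sum>s\<in>UNIV. deriv (\<gamma> s) z * T (s # s # is) z) + (\<Sum>s\<in>UNIV. \<gamma> s z * deriv (T (s # s # is)) z)"
    unfolding sum.distrib[symmetric]
    by (rule DERIV_imp_deriv, rule DERIV_sum)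
       (auto intro!: derivative_eq_intros smooth_on_has_derivative[OF I(1) G I(2)]
         smooth_on_has_derivative[OF I(1) T I(2)])
  \<comment> \<open>The remaining slots are not contracted, and the two summations are interchanged there.\<close>
  have sw: "(\<Sum>s\<in>UNIV. \<gamma> s z * (\<Sum>m<length is. \<Sum>c\<in>UNIV. G u (is ! m) c z * T (s # s # is[m := c]) z))
      = (\<Sum>m<length is. \<Sum>c\<in>UNIV. G u (is ! m) c z * (\<Sum>s\<in>UNIV. \<gamma> s z * T (s # s # is[m := c]) z))"
    unfolding sum_distrib_left
    by (subst sum.swap, rule sum.cong[OF refl], subst sum.swap) (simp add: mult_ac)
  have "(\<Sum>s\<in>UNIV. \<gamma> s z * covz G T (u # s # s # is) z)
     = (\<Sum>s\<in>UNIV. \<gamma> s z * (if u = 0 then deriv (T (s # s # is)) z else 0))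
      - ((\<Sum>s\<in>UNIV. \<gamma> s z * (\<Sum>c\<in>UNIV. G u s c z * T (c # s # is) z))
      + (\<Sum>s\<in>UNIV. \<gamma> s z * (\<Sum>c\<in>UNIV. G u s c z * T (s # c # is) z)))
      - (\<Sum>s\<in>UNIV. \<gamma> s z * (\<Sum>m<length is. \<Sum>c\<in>UNIV. G u (is ! m) c z * T (s # s # is[m := c]) z))"
    unfolding covz_def list.case split
    by (simp add: right_diff_distrib distrib_left sum_subtractf sum.distrib)
  also have "\<dots> = covz G (\<lambda>is z. \<Sum>s\<in>UNIV. \<gamma> s z * T (s # s # is) z) (u # is) z"
    unfolding * sw by (simp add: covz_def d)
  finally show ?thesis .
qed

section \<open>Curvature of the metrics\<close>

lemma matrix_inv_eqI: "A ** B = mat 1 \<Longrightarrow> B ** A = mat 1 \<Longrightarrow> matrix_inv A = (B :: real^'n^'n)"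
proof -
  assume AB: "A ** B = mat 1" and BA: "B ** A = mat 1"
  then have "A ** matrix_inv A = mat 1 \<and> matrix_inv A ** A = mat 1"
    unfolding matrix_inv_def by (rule_tac someI[of _ B]) simp
  then have "B ** (A ** matrix_inv A) = B" by simp
  then show "matrix_inv A = B"
    unfolding matrix_mul_assoc BA by simp
qed

lemma matrix_inv_diagonal:
  fixes d :: "'n::finite \<Rightarrow> real"
  assumes "\<And>i. d i \<noteq> 0"
  shows "matrix_inv (\<chi> i j. if i = j then d i else 0) = (\<chi> i j. if i = j then 1 / d i else 0)"
  by (rule matrix_inv_eqI)
     (auto simp: matrix_matrix_mult_def mat_def vec_eq_iff if_distrib[of "\<lambda>x. x * _"] assms cong: if_cong)

definition u2_g :: "(real \<Rightarrow> real) \<Rightarrow> (real \<Rightarrow> real) \<Rightarrow> 4 \<Rightarrow> real \<Rightarrow> real" where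
  "u2_g F C i z = (if i = 0 then C z / (4 * F z) else if i = 1 then C z * F z else C z)"

definition u2_ginv :: "(real \<Rightarrow> real) \<Rightarrow> (real \<Rightarrow> real) \<Rightarrow> 4 \<Rightarrow> real \<Rightarrow> real" where
  "u2_ginv F C i z = (if i = 0 then 4 * F z / C z else if i = 1 then 1 / (C z * F z) else 1 / C z)"

text \<open>
  The Christoffel symbols: \<open>u2_log i\<close> is the logarithmic derivative of the length of \<open>E\<^sub>i\<close>,
  \<open>- u2_warp i\<close> is the \<open>E\<^sub>0\<close>-component of \<open>\<nabla>\<^sub>i E\<^sub>i\<close>, and \<open>u2_rot\<close> gives the Levi-Civita connection of the
  Berger sphere in which \<open>E\<^sub>1\<close> has squared length \<open>F\<close>.
\<close>

definition u2_log :: "(real \<Rightarrow> real) \<Rightarrow> (real \<Rightarrow> real) \<Rightarrow> 4 \<Rightarrow> real \<Rightarrow> real" where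
  "u2_log F C i z = deriv C z / (2 * C z) +
     (if i = 0 then - 1 else if i = 1 then 1 else 0) * (deriv F z / (2 * F z))"

definition u2_warp :: "(real \<Rightarrow> real) \<Rightarrow> (real \<Rightarrow> real) \<Rightarrow> 4 \<Rightarrow> real \<Rightarrow> real" where
  "u2_warp F C i z = (if i = 1 then 2 * F z * (F z * deriv C z / C z + deriv F z)
     else 2 * F z * deriv C z / C z)"

definition u2_rot :: "(real \<Rightarrow> real) \<Rightarrow> 4 \<Rightarrow> 4 \<Rightarrow> real \<Rightarrow> real" where
  "u2_rot F i k z = (if i = 1 then 2 - F z else if k = 1 then 1 else F z)"

definition u2_chr :: "(real \<Rightarrow> real) \<Rightarrow> (real \<Rightarrow> real) \<Rightarrow> 4 \<Rightarrow> 4 \<Rightarrow> 4 \<Rightarrow> real \<Rightarrow> real" where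
  "u2_chr F C i j k z =
     (if i = 0 then if j = k then u2_log F C j z else 0
      else if j = 0 then if k = i then u2_log F C i z else 0
      else if k = 0 then if j = i then - u2_warp F C i z else 0
      else struct i j k / 2 * u2_rot F i k z)"

text \<open>
  The components \<open>R\<^sub>i\<^sub>j\<^sub>j\<^sub>i\<close>. Dividing derivatives by the function itself keeps the formulas polynomial.
\<close>

definition u2_sec :: "(real \<Rightarrow> real) \<Rightarrow> (real \<Rightarrow> real) \<Rightarrow> 4 \<Rightarrow> 4 \<Rightarrow> real \<Rightarrow> real" where
  "u2_sec F C i j z =
     (let f = F z; f1 = deriv F z / F z; f2 = deriv (deriv F) z / F z;
          c = C z; c1 = deriv C z / C z; c2 = deriv (deriv C) z / C z in
      if {i, j} = {0, 1} then - f * c * (c2 - c1\<^sup>2 + f1 * c1 + f2) / 2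
      else if i = 0 \<or> j = 0 then - c * (2 * (c2 - c1\<^sup>2) + f1 * c1) / 4
      else if i = 1 \<or> j = 1 then f\<^sup>2 * c * (1 - c1\<^sup>2 - f1 * c1)
      else c * (4 - 3 * f - f * c1\<^sup>2))"

text \<open>
  The only other components of the curvature tensor have four different indices. The weights \<open>- 1/2, 1/4, 1/4\<close>
  have sum zero, as the Bianchi identity demands.
\<close>

definition u2_mix :: "4 \<Rightarrow> 4 \<Rightarrow> 4 \<Rightarrow> 4 \<Rightarrow> real" where
  "u2_mix i j k l = 
     (let m = (\<lambda>a. if a = 1 then - 1 / 2 else 1 / 4) in
      if i = 0 then m j * struct k l j else if j = 0 then - m i * struct k l i
      else if k = 0 then m l * struct i j l else if l = 0 then - m k * struct i j k else 0)"

definition u2_Rm :: "(real \<Rightarrow> real) \<Rightarrow> (real \<Rightarrow> real) \<Rightarrow> 4 \<Rightarrow> 4 \<Rightarrow> 4 \<Rightarrow> 4 \<Rightarrow> real \<Rightarrow> real" where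
  "u2_Rm F C i j k l z =
     (if i = l \<and> j = k then u2_sec F C i j z else 0) - (if i = k \<and> j = l then u2_sec F C i j z else 0)
     + deriv F z * C z * u2_mix i j k l"

lemma smooth_on_if:
  "(b \<Longrightarrow> smooth_on I f) \<Longrightarrow> (\<not> b \<Longrightarrow> smooth_on I g) \<Longrightarrow> smooth_on I (\<lambda>z. if b then f z else g z)"
  by (cases b) simp_all

locale u2 =
  fixes I :: "real set" and F C :: "real \<Rightarrow> real"
  assumes open_I: "open I" and smooth: "smooth_on I F" "smooth_on I C"
    and pos: "\<And>z. z \<in> I \<Longrightarrow> F z > 0" "\<And>z. z \<in> I \<Longrightarrow> C z > 0"
begin

abbreviation "g \<equiv> u2_metric F C"

lemma smooth_derivs:
  "smooth_on I (deriv F)" "smooth_on I (deriv (deriv F))" "smooth_on I (deriv (deriv (deriv F)))"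
  "smooth_on I (deriv C)" "smooth_on I (deriv (deriv C))" "smooth_on I (deriv (deriv (deriv C)))"
  by (intro smooth_on_deriv smooth)+

lemmas deriv_FC =
  smooth_on_has_derivative[OF open_I smooth(1)] smooth_on_has_derivative[OF open_I smooth(2)]
  smooth_on_has_derivative[OF open_I smooth_derivs(1)]
  smooth_on_has_derivative[OF open_I smooth_derivs(2)]
  smooth_on_has_derivative[OF open_I smooth_derivs(3)]
  smooth_on_has_derivative[OF open_I smooth_derivs(4)]
  smooth_on_has_derivative[OF open_I smooth_derivs(5)]
  smooth_on_has_derivative[OF open_I smooth_derivs(6)]

lemma nonzero: "z \<in> I \<Longrightarrow> F z \<noteq> 0" "z \<in> I \<Longrightarrow> C z \<noteq> 0"
  using pos by force+

lemma g_entry: "g p $ i $ j = (if i = j then u2_g F C i (fst p) else 0)"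
  by (simp add: u2_metric_def u2_g_def Let_def)

lemma ginv_entry:
  assumes "p \<in> cyl I"
  shows "ginv g i j p = (if i = j then u2_ginv F C i (fst p) else 0)"
proof -
  note nz = nonzero[OF fst_in_I[OF assms]]
  have "g p = (\<chi> i j. if i = j then u2_g F C i (fst p) else 0)"
    by (simp add: vec_eq_iff g_entry)
  then have "ginv g i j p = (if i = j then 1 / u2_g F C i (fst p) else 0)"
    unfolding ginv_def using nz by (subst \<open>g p = _\<close>, subst matrix_inv_diagonal) (auto simp: u2_g_def)
  then show ?thesis by (auto simp: u2_g_def u2_ginv_def)
qed

lemma deriv_g:
  assumes "z \<in> I"
  shows "deriv (u2_g F C i) z = 2 * u2_log F C i z * u2_g F C i z"
  unfolding u2_g_def u2_log_def using nonzero[OF assms] 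
  by (cases "i = 0"; cases "i = 1"; intro DERIV_imp_deriv)
     (auto intro!: derivative_eq_intros deriv_FC assms simp: field_simps power2_eq_square)

lemma christoffel_entry:
  assumes p: "p \<in> cyl I"
  shows "christoffel g i j k p = u2_chr F C i j k (fst p)"
proof -
  define z where "z = fst p"
  have z: "z \<in> I" using p fst_in_I by (simp add: z_def)
  note nz = nonzero[OF z]
  have D: "frame_D a (\<lambda>p. g p $ i $ j) p =
      (if a = 0 \<and> i = j then 2 * u2_log F C i z * u2_g F C i z else 0)" for a i j
    using deriv_g[OF z] by (simp add: g_entry frame_D_fst[of _ "\<lambda>z. if i = j then u2_g F C i z else 0"] z_def)
  have "\<forall>i j k. koszul g i j k p * u2_ginv F C k z = u2_chr F C i j k z"
    unfolding koszul_def D forall_4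
    using nz by (simp add: sum_4 g_entry struct_def u2_g_def u2_ginv_def u2_chr_def u2_log_def
        u2_warp_def u2_rot_def flip: z_def) (simp add: field_simps)
  then show ?thesis
    by (simp add: christoffel_def ginv_entry[OF p] if_distrib z_def cong: if_cong)
qed

lemma smooth_log: "smooth_on I (u2_log F C i)"
  unfolding u2_log_def[abs_def] by (intro smooth_on_intros open_I smooth) (simp_all add: nonzero)

lemma smooth_warp: "smooth_on I (u2_warp F C i)"
  unfolding u2_warp_def[abs_def]
  by (cases "i = 1"; simp; intro smooth_on_intros open_I smooth; simp add: nonzero)

lemma smooth_rot: "smooth_on I (u2_rot F i k)"
  unfolding u2_rot_def[abs_def]
  by (cases "i = 1"; cases "k = 1"; simp; intro smooth_on_intros open_I smooth)

lemma smooth_chr: "smooth_on I (u2_chr F C i j k)"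
  unfolding u2_chr_def[abs_def]
  by (intro smooth_log smooth_warp smooth_rot smooth_on_if smooth_on_intros open_I) simp

lemma deriv_log:
  assumes "z \<in> I"
  shows "deriv (u2_log F C i) z = (deriv (deriv C) z * C z - (deriv C z)\<^sup>2) / (2 * (C z)\<^sup>2) +
     (if i = 0 then - 1 else if i = 1 then 1 else 0) * ((deriv (deriv F) z * F z - (deriv F z)\<^sup>2) / (2 * (F z)\<^sup>2))"
  unfolding u2_log_def using nonzero[OF assms] 
  by (cases "i = 0"; cases "i = 1"; intro DERIV_imp_deriv)
     (auto intro!: derivative_eq_intros deriv_FC assms simp: field_simps power2_eq_square)

lemma deriv_warp:
  assumes "z \<in> I"
  shows "deriv (u2_warp F C i) z = (if i = 1 then
     2 * (deriv F z * (F z * deriv C z / C z + deriv F z) +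
       F z * (deriv F z * deriv C z / C z + F z * ((deriv (deriv C) z * C z - (deriv C z)\<^sup>2) / (C z)\<^sup>2)
         + deriv (deriv F) z))
     else 2 * (deriv F z * deriv C z / C z + F z * ((deriv (deriv C) z * C z - (deriv C z)\<^sup>2) / (C z)\<^sup>2)))"
  unfolding u2_warp_def using nonzero[OF assms] 
  by (cases "i = 0"; cases "i = 1"; intro DERIV_imp_deriv)
     (auto intro!: derivative_eq_intros deriv_FC assms simp: field_simps power2_eq_square)

lemma deriv_rot:
  assumes "z \<in> I"
  shows "deriv (u2_rot F i k) z = (if i = 1 then - deriv F z else if k = 1 then 0 else deriv F z)"
  unfolding u2_rot_def
  by (cases "i = 1"; cases "k = 1"; intro DERIV_imp_deriv) (auto intro!: derivative_eq_intros deriv_FC assms)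

lemma deriv_chr:
  assumes "z \<in> I"
  shows "deriv (u2_chr F C i j k) z =
    (if i = 0 then if j = k then deriv (u2_log F C j) z else 0
      else if j = 0 then if k = i then deriv (u2_log F C i) z else 0
      else if k = 0 then if j = i then - deriv (u2_warp F C i) z else 0
      else struct i j k / 2 * deriv (u2_rot F i k) z)"
proof -
  have warp: "(u2_warp F C i has_real_derivative deriv (u2_warp F C i) z) (at z)"
    and rot: "(u2_rot F i k has_real_derivative deriv (u2_rot F i k) z) (at z)"
    using smooth_on_has_derivative[OF open_I smooth_warp assms]
      smooth_on_has_derivative[OF open_I smooth_rot assms] by auto
  have "deriv (\<lambda>z. - u2_warp F C i z) z = - deriv (u2_warp F C i) z"
    "deriv (\<lambda>z. struct i j k / 2 * u2_rot F i k z) z = struct i j k / 2 * deriv (u2_rot F i k) z"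
    by (intro DERIV_imp_deriv DERIV_minus warp DERIV_cmult rot)+
  then show ?thesis
    unfolding u2_chr_def[abs_def] by simp
qed

end

definition u2_Ric :: "(real \<Rightarrow> real) \<Rightarrow> (real \<Rightarrow> real) \<Rightarrow> 4 \<Rightarrow> real \<Rightarrow> real" where
  "u2_Ric F C i z =
     (let f = F z; f1 = deriv F z / F z; f2 = deriv (deriv F) z / F z;
          c1 = deriv C z / C z; c2 = deriv (deriv C) z / C z in
      if i = 0 then 3 / 2 * (c1\<^sup>2 - c2) - f1 * c1 - f2 / 2
      else if i = 1 then 2 * f\<^sup>2 * (1 - c2 - 2 * f1 * c1 - f2)
      else 4 - 2 * f * (1 + c2 + f1 * c1))"

definition u2_scal :: "(real \<Rightarrow> real) \<Rightarrow> (real \<Rightarrow> real) \<Rightarrow> real \<Rightarrow> real" where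
  "u2_scal F C z =
     (let f = F z; f1 = deriv F z / F z; f2 = deriv (deriv F) z / F z;
          c1 = deriv C z / C z; c2 = deriv (deriv C) z / C z in
      (8 - 2 * f * (1 + 2 * f2 + 6 * c2 + 6 * f1 * c1 - 3 * c1\<^sup>2)) / C z)"

text \<open>
  The Weyl tensor of \<open>C h\<close> is \<open>C\<close> times that of \<open>h\<close>. On the bivectors \<open>e\<^sub>0\<^sub>1 \<plusminus> e\<^sub>2\<^sub>3\<close> of an
  orthonormal frame it acts by multiples of \<open>F'' \<minusplus> 3 F' + 2 F - 2\<close>.
\<close>

definition u2_wsec :: "(real \<Rightarrow> real) \<Rightarrow> 4 \<Rightarrow> 4 \<Rightarrow> real \<Rightarrow> real" where
  "u2_wsec F i j z = (deriv (deriv F) z + 2 * F z - 2) *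
     (if {i, j} = {0, 1} then - 1 / 6 else if i = 0 \<or> j = 0 then 1 / (12 * F z)
      else if i = 1 \<or> j = 1 then F z / 3 else - 2 / 3)"

definition u2_Weyl :: "(real \<Rightarrow> real) \<Rightarrow> (real \<Rightarrow> real) \<Rightarrow> 4 \<Rightarrow> 4 \<Rightarrow> 4 \<Rightarrow> 4 \<Rightarrow> real \<Rightarrow> real" where
  "u2_Weyl F C i j k l z = C z *
     ((if i = l \<and> j = k then u2_wsec F i j z else 0) - (if i = k \<and> j = l then u2_wsec F i j z else 0)
     + deriv F z * u2_mix i j k l)"

lemma if_zero_mult: "(if b then x else 0) * y = (if b then x * y else (0::real))"
  by simp

lemma factor_if:
  "(if P then c * w else 0) - (if Q then c * w else 0) + f * c * m
     = c * ((if P then w else 0) - (if Q then w else 0) + f * (m :: real))"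
  by (simp add: algebra_simps)

lemma sign_swap:
  "Q' = Q \<Longrightarrow> P' = P \<Longrightarrow> (if Q' then s else 0) - (if P' then s else 0) + c * - m
     = - ((if P then s else 0) - (if Q then s else 0) + c * (m :: real))"
  by simp

context u2 begin

text \<open>
  By skew symmetry in the first two indices it is enough to compute six of the sixteen blocks; within a
  block all components are compared at once.
\<close>

lemma Rm_entry:
  assumes p: "p \<in> cyl I"
  shows "Rm g i j k l p = u2_Rm F C i j k l (fst p)"
proof -
  define z where "z = fst p"
  have z: "z \<in> I" using p fst_in_I by (simp add: z_def)
  define f c a1 a2 b1 b2 where v: "f = F z" "c = C z" "a1 = deriv C z / C z"
    "a2 = deriv (deriv C) z / C z" "b1 = deriv F z / F z" "b2 = deriv (deriv F) z / F z"
  have nz: "f \<noteq> 0" "c \<noteq> 0" using nonzero[OF z] by (simp_all add: v)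
  have r: "F z = f" "C z = c" "deriv C z = a1 * c" "deriv (deriv C) z = a2 * c" "deriv F z = b1 * f"
    "deriv (deriv F) z = b2 * f"
    using nonzero[OF z] by (simp_all add: v)
  have D: "frame_D a (christoffel g i j k) p = (if a = 0 then deriv (u2_chr F C i j k) z else 0)" for a i j k
    unfolding z_def by (rule frame_D_fst_cong[OF open_I p]) (rule christoffel_entry)
  let ?\<sigma> = "\<lambda>i::4. if i = 0 then - 1 else if i = 1 then 1 else (0::real)"
  have log: "u2_log F C i z = (a1 + ?\<sigma> i * b1) / 2"
      "deriv (u2_log F C i) z = (a2 - a1\<^sup>2 + ?\<sigma> i * (b2 - b1\<^sup>2)) / 2"
    and warp: "u2_warp F C i z = (if i = 1 then 2 * f\<^sup>2 * (a1 + b1) else 2 * f * a1)"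
      "deriv (u2_warp F C i) z = (if i = 1 then 2 * f\<^sup>2 * (2 * a1 * b1 + b1\<^sup>2 + a2 - a1\<^sup>2 + b2)
         else 2 * f * (a1 * b1 + a2 - a1\<^sup>2))"
    and rot: "deriv (u2_rot F i k) z = (if i = 1 then - (b1 * f) else if k = 1 then 0 else b1 * f)"
      "u2_rot F i k z = (if i = 1 then 2 - f else if k = 1 then 1 else f)" for i k
    unfolding deriv_log[OF z] deriv_warp[OF z] deriv_rot[OF z] u2_log_def u2_warp_def u2_rot_def r
    using nz by (simp_all add: power2_eq_square field_simps)
  note E = D christoffel_entry[OF p] z_def[symmetric] deriv_chr[OF z] log warp rot
  note S = curv_def E u2_chr_def u2_Rm_def u2_sec_def u2_g_def Let_def r
  note N = sum_4 struct_def u2_mix_def Let_def doubleton_eq_iff nz log warp rot r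
  note A = field_simps power2_eq_square nz
  have c01: "\<forall>k l. curv g 0 1 k l p * u2_g F C l z = u2_Rm F C 0 1 k l z"
    unfolding forall_4 S by (intro conjI, simp_all add: N, simp_all add: A)
  have c02: "\<forall>k l. curv g 0 2 k l p * u2_g F C l z = u2_Rm F C 0 2 k l z"
    unfolding forall_4 S by (intro conjI, simp_all add: N, simp_all add: A)
  have c03: "\<forall>k l. curv g 0 3 k l p * u2_g F C l z = u2_Rm F C 0 3 k l z"
    unfolding forall_4 S by (intro conjI, simp_all add: N, simp_all add: A)
  have c12: "\<forall>k l. curv g 1 2 k l p * u2_g F C l z = u2_Rm F C 1 2 k l z"
    unfolding forall_4 S by (intro conjI, simp_all add: N, simp_all add: A)
  have c13: "\<forall>k l. curv g 1 3 k l p * u2_g F C l z = u2_Rm F C 1 3 k l z"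
    unfolding forall_4 S by (intro conjI, simp_all add: N, simp_all add: A)
  have c23: "\<forall>k l. curv g 2 3 k l p * u2_g F C l z = u2_Rm F C 2 3 k l z"
    unfolding forall_4 S by (intro conjI, simp_all add: N, simp_all add: A)
  have skew: "curv g j i k l p = - curv g i j k l p" "u2_Rm F C j i k l z = - u2_Rm F C i j k l z" 
    for i j k l
  proof -
    have "struct j i m = - struct i j m" for m
      by (simp add: struct_def)
    note struct_skew = this
    have "(\<Sum>m\<in>UNIV. a m - b m - struct j i m * d m) =
        - (\<Sum>m\<in>UNIV. b m - a m - struct i j m * d m)" for a b d
      unfolding sum_negf[symmetric] by (rule sum.cong) (simp_all add: struct_skew)
    then show "curv g j i k l p = - curv g i j k l p"
      unfolding curv_def by simp
    have "struct i j 0 = 0" "struct j i 0 = 0" "struct k l 0 = 0"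
      by (simp_all add: struct_def)
    then have mix: "u2_mix j i k l = - u2_mix i j k l"
      using struct_skew[of k] struct_skew[of l]
      by (simp add: u2_mix_def Let_def)
    have sec: "u2_sec F C j i z = u2_sec F C i j z"
      by (cases "i = 0"; cases "j = 0"; cases "i = 1"; cases "j = 1") (simp_all add: u2_sec_def insert_commute Let_def)
    show "u2_Rm F C j i k l z = - u2_Rm F C i j k l z"
      unfolding u2_Rm_def mix sec by (rule sign_swap) (rule conj_commute)+
  qed
  have "curv g i j k l p * u2_g F C l z = u2_Rm F C i j k l z" for i j k l
  proof -
    note c = c01[rule_format] c02[rule_format] c03[rule_format] c12[rule_format] c13[rule_format]
      c23[rule_format]
    have pairs: "i = 0 \<and> j = 1 \<or> i = 0 \<and> j = 2 \<or> i = 0 \<and> j = 3 \<or> i = 1 \<and> j = 2 \<or>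
        i = 1 \<and> j = 3 \<or> i = 2 \<and> j = 3 \<Longrightarrow>
        curv g i j k l p * u2_g F C l z = u2_Rm F C i j k l z" for i j k l
      by (elim disjE conjE; hypsubst; rule c)
    consider "i = 0 \<and> j = 1 \<or> i = 0 \<and> j = 2 \<or> i = 0 \<and> j = 3 \<or> i = 1 \<and> j = 2 \<or>
        i = 1 \<and> j = 3 \<or> i = 2 \<and> j = 3"
      | "j = 0 \<and> i = 1 \<or> j = 0 \<and> i = 2 \<or> j = 0 \<and> i = 3 \<or> j = 1 \<and> i = 2 \<or>
        j = 1 \<and> i = 3 \<or> j = 2 \<and> i = 3" | "i = j"
      using exhaust_4[of i] exhaust_4[of j] by auto
    then show ?thesis
    proof cases
      case 1
      then show ?thesis by (rule pairs)
    next
      case 2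
      from pairs[OF this, of k l] show ?thesis using skew[of j i k l] by simp
    next
      case 3
      then show ?thesis using skew[of i i k l] by simp
    qed
  qed
  then show ?thesis
    by (simp add: Rm_def g_entry z_def if_distrib[of "\<lambda>x. _ * x"] cong: if_cong)
qed

lemma Ric_entry:
  assumes p: "p \<in> cyl I"
  shows "Ric g i j p = (if i = j then u2_Ric F C i (fst p) else 0)"
proof -
  define z where "z = fst p"
  have z: "z \<in> I" using p fst_in_I by (simp add: z_def)
  define f c a1 a2 b1 b2 where v: "f = F z" "c = C z" "a1 = deriv C z / C z"
    "a2 = deriv (deriv C) z / C z" "b1 = deriv F z / F z" "b2 = deriv (deriv F) z / F z"
  have nz: "f \<noteq> 0" "c \<noteq> 0" using nonzero[OF z] by (simp_all add: v)
  have r: "F z = f" "C z = c" "deriv C z = a1 * c" "deriv (deriv C) z = a2 * c" "deriv F z = b1 * f"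
    "deriv (deriv F) z = b2 * f"
    using nonzero[OF z] by (simp_all add: v)
  have R: "Ric g i j p = (\<Sum>s\<in>UNIV. u2_ginv F C s z * u2_Rm F C s i j s z)"
    by (simp add: Ric_def ginv_entry[OF p] Rm_entry[OF p] if_zero_mult z_def)
  have "\<forall>i j. (\<Sum>s\<in>UNIV. u2_ginv F C s z * u2_Rm F C s i j s z) = (if i = j then u2_Ric F C i z else 0)"
    unfolding forall_4 u2_ginv_def u2_Rm_def u2_Ric_def u2_sec_def Let_def r
    by (intro conjI; simp add: sum_4 u2_mix_def struct_def Let_def doubleton_eq_iff nz;
        (simp add: nz field_simps power2_eq_square)?)
  then show ?thesis using R by (simp add: z_def)
qed

lemma scal_entry:
  assumes p: "p \<in> cyl I"
  shows "scal g p = u2_scal F C (fst p)"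
proof -
  define z where "z = fst p"
  have z: "z \<in> I" using p fst_in_I by (simp add: z_def)
  define f c a1 a2 b1 b2 where v: "f = F z" "c = C z" "a1 = deriv C z / C z"
    "a2 = deriv (deriv C) z / C z" "b1 = deriv F z / F z" "b2 = deriv (deriv F) z / F z"
  have nz: "f \<noteq> 0" "c \<noteq> 0" using nonzero[OF z] by (simp_all add: v)
  have r: "F z = f" "C z = c" "deriv C z = a1 * c" "deriv (deriv C) z = a2 * c" "deriv F z = b1 * f"
    "deriv (deriv F) z = b2 * f"
    using nonzero[OF z] by (simp_all add: v)
  have "scal g p = (\<Sum>s\<in>UNIV. u2_ginv F C s z * u2_Ric F C s z)"
    by (simp add: scal_def ginv_entry[OF p] Ric_entry[OF p] if_zero_mult z_def)
  also have "\<dots> = u2_scal F C z"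
    unfolding sum_4 u2_ginv_def u2_Ric_def u2_scal_def Let_def r
    by (simp add: nz; (simp add: nz field_simps power2_eq_square)?)
  finally show ?thesis by (simp add: z_def)
qed

lemma Weyl_entry:
  assumes p: "p \<in> cyl I"
  shows "Weyl g i j k l p = u2_Weyl F C i j k l (fst p)"
proof -
  define z where "z = fst p"
  have z: "z \<in> I" using p fst_in_I by (simp add: z_def)
  define f c a1 a2 b1 b2 where v: "f = F z" "c = C z" "a1 = deriv C z / C z"
    "a2 = deriv (deriv C) z / C z" "b1 = deriv F z / F z" "b2 = deriv (deriv F) z / F z"
  have nz: "f \<noteq> 0" "c \<noteq> 0" using nonzero[OF z] by (simp_all add: v)
  have r: "F z = f" "C z = c" "deriv C z = a1 * c" "deriv (deriv C) z = a2 * c" "deriv F z = b1 * f"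
    "deriv (deriv F) z = b2 * f"
    using nonzero[OF z] by (simp_all add: v)
  define K where "K i j = u2_sec F C i j z - (u2_g F C i z * u2_Ric F C j z
     + u2_g F C j z * u2_Ric F C i z) / 2 + u2_scal F C z / 6 * u2_g F C i z * u2_g F C j z" for i j
  have R: "Weyl g i j k l p = (if i = l \<and> j = k then K i j else 0)
     - (if i = k \<and> j = l then K i j else 0) + deriv F z * C z * u2_mix i j k l"
    unfolding Weyl_def Ric_entry[OF p] scal_entry[OF p] Rm_entry[OF p] g_entry u2_Rm_def z_def[symmetric]
    by (cases "i = l"; cases "j = k"; cases "i = k"; cases "j = l"; simp add: K_def; (simp add: field_simps)?)
  have *: "\<forall>i j. i \<noteq> j \<longrightarrow> K i j = C z * u2_wsec F i j z"
    unfolding forall_4 K_def u2_g_def u2_sec_def u2_Ric_def u2_scal_def u2_wsec_def Let_def r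
    by (intro conjI impI; simp add: nz doubleton_eq_iff;
        (simp add: nz field_simps power2_eq_square)?)
  have kw: "K i j = C z * u2_wsec F i j z" if "i \<noteq> j"
    using that * by blast
  show ?thesis
  proof (cases "i = j")
    case True
    then show ?thesis
      unfolding R u2_Weyl_def z_def[symmetric] by (simp add: conj_commute)
  next
    case False
    show ?thesis
      unfolding R u2_Weyl_def z_def[symmetric] kw[OF False] by (rule factor_if)
  qed
qed

end

section \<open>The Bach tensor\<close>

text \<open>
  The divergence \<open>W\<^sub>s\<^sub>i\<^sub>j\<^sub>k\<^sup>,\<^sup>s\<close>. Like the Cotton tensor it is skew in the last two indices. Only the components with indices
  \<open>(i, i, 0)\<close>, \<open>(i, 0, i)\<close> or a permutation of 1, 2, 3 are different from zero.
\<close>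

definition u2_div :: "(real \<Rightarrow> real) \<Rightarrow> (real \<Rightarrow> real) \<Rightarrow> 4 list \<Rightarrow> real \<Rightarrow> real" where
  "u2_div F C is z =
     (let i = is ! 0; j = is ! 1; k = is ! 2;
          q = deriv C z / C z * (deriv (deriv F) z + 2 * F z - 2) / 6 - 5 / 6 * deriv F z
            + deriv (deriv (deriv F)) z / 3;
          e = if i = 1 then - 2 * F z * q else q;
          r = F z * (deriv (deriv F) z + deriv C z / C z * deriv F z - 2 * F z + 2) in
      if i = 0 then 0 else if j = i \<and> k = 0 then e else if k = i \<and> j = 0 then - e
      else struct j k i / 2 * (if i = 1 then - 2 * r else r))"

context u2 begin

lemma smooth_ginv: "smooth_on I (u2_ginv F C s)"
  unfolding u2_ginv_def[abs_def]
  by (intro smooth_on_if smooth_on_intros open_I smooth) (simp_all add: nonzero)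

lemma smooth_wsec: "smooth_on I (u2_wsec F i j)"
  unfolding u2_wsec_def[abs_def]
  by (intro smooth_on_if smooth_on_intros open_I smooth) (simp_all add: nonzero)

lemma smooth_Weyl: "smooth_on I (u2_Weyl F C i j k l)"
  unfolding u2_Weyl_def[abs_def]
  by (intro smooth_on_if smooth_wsec smooth_on_intros open_I smooth)

lemma deriv_ginv:
  assumes "z \<in> I"
  shows "deriv (u2_ginv F C i) z = - 2 * u2_log F C i z * u2_ginv F C i z"
  unfolding u2_ginv_def u2_log_def using nonzero[OF assms] 
  by (cases "i = 0"; cases "i = 1"; intro DERIV_imp_deriv)
     (auto intro!: derivative_eq_intros deriv_FC assms simp: field_simps power2_eq_square)

text \<open>
  The inverse metric is parallel, in the form that the contraction lemma needs.
\<close>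

lemma metric_parallel:
  assumes z: "z \<in> I"
  shows "u2_ginv F C s z * u2_chr F C u s c z + u2_ginv F C c z * u2_chr F C u c s z
       = (if u = 0 \<and> s = c then - deriv (u2_ginv F C s) z else 0)"
proof -
  have "\<forall>u s c. u2_ginv F C s z * u2_chr F C u s c z + u2_ginv F C c z * u2_chr F C u c s z
       = (if u = 0 \<and> s = c then - deriv (u2_ginv F C s) z else 0)"
    unfolding forall_4 deriv_ginv[OF z]
    by (intro conjI, simp_all add: u2_chr_def u2_ginv_def u2_log_def u2_warp_def u2_rot_def struct_def,
        simp_all add: nonzero[OF z] field_simps power2_eq_square)
  then show ?thesis by blast
qed

definition "u2_Weyl_tensor is = u2_Weyl F C (is ! 0) (is ! 1) (is ! 2) (is ! 3)"

lemma deriv_Weyl: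
  assumes z: "z \<in> I"
  shows "deriv (u2_Weyl F C i j k l) z = deriv C z *
     ((if i = l \<and> j = k then u2_wsec F i j z else 0) - (if i = k \<and> j = l then u2_wsec F i j z else 0)
     + deriv F z * u2_mix i j k l) + C z *
     ((if i = l \<and> j = k then deriv (u2_wsec F i j) z else 0)
      - (if i = k \<and> j = l then deriv (u2_wsec F i j) z else 0)
     + deriv (deriv F) z * u2_mix i j k l)"
proof -
  have w: "(u2_wsec F i j has_real_derivative deriv (u2_wsec F i j) z) (at z)"
    by (rule smooth_on_has_derivative[OF open_I smooth_wsec z])
  have "((\<lambda>z. if P then u2_wsec F i j z else 0) has_real_derivative
      (if P then deriv (u2_wsec F i j) z else 0)) (at z)" for P
    using w by simp
  then show ?thesis
    unfolding u2_Weyl_def[abs_def]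
    by (intro DERIV_imp_deriv) (rule derivative_eq_intros deriv_FC[OF z] refl | assumption | simp add: mult.commute)+
qed

lemma deriv_wsec:
  assumes z: "z \<in> I"
  shows "deriv (u2_wsec F i j) z = (deriv (deriv (deriv F)) z + 2 * deriv F z) *
     (if {i, j} = {0, 1} then - 1 / 6 else if i = 0 \<or> j = 0 then 1 / (12 * F z)
      else if i = 1 \<or> j = 1 then F z / 3 else - 2 / 3) +
     (deriv (deriv F) z + 2 * F z - 2) *
     (if {i, j} = {0, 1} then 0 else if i = 0 \<or> j = 0 then - deriv F z / (12 * (F z)\<^sup>2)
      else if i = 1 \<or> j = 1 then deriv F z / 3 else 0)"
proof -
  define w where "w = (\<lambda>z. if {i, j} = {0, 1} then - 1 / 6 else if i = 0 \<or> j = 0 then 1 / (12 * F z)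
      else if i = 1 \<or> j = 1 then F z / 3 else - 2 / 3)"
  have w: "(w has_real_derivative (if {i, j} = {0, 1} then 0 else if i = 0 \<or> j = 0
      then - deriv F z / (12 * (F z)\<^sup>2) else if i = 1 \<or> j = 1 then deriv F z / 3 else 0)) (at z)"
    (is "(w has_real_derivative ?d) _")
  proof -
    have "((\<lambda>z. 1 / (12 * F z)) has_real_derivative - deriv F z / (12 * (F z)\<^sup>2)) (at z)"
      using nonzero[OF z] by (auto intro!: derivative_eq_intros deriv_FC z simp: power2_eq_square)
    moreover have "((\<lambda>z. F z / 3) has_real_derivative deriv F z / 3) (at z)"
      by (auto intro!: derivative_eq_intros deriv_FC z)
    ultimately show ?thesis
      unfolding w_def by simp
  qed
  have "((\<lambda>z. (deriv (deriv F) z + 2 * F z - 2) * w z) has_real_derivative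
      (deriv (deriv (deriv F)) z + 2 * deriv F z) * w z + (deriv (deriv F) z + 2 * F z - 2) * ?d) (at z)"
    by (rule derivative_eq_intros deriv_FC[OF z] w refl)+ simp
  then show ?thesis
    unfolding w_def u2_wsec_def[abs_def] by (rule DERIV_imp_deriv)
qed

text \<open>
  All sixty-four components are computed, split by the first index to keep the formulas small.
\<close>

lemma div_entry:
  assumes z: "z \<in> I"
  shows "(\<Sum>s\<in>UNIV. u2_ginv F C s z * covz (u2_chr F C) u2_Weyl_tensor [s, s, i, j, k] z) = u2_div F C [i, j, k] z"
proof -
  define f c a1 b1 b2 b3 where v: "f = F z" "c = C z" "a1 = deriv C z / C z"
    "b1 = deriv F z / F z" "b2 = deriv (deriv F) z / F z" "b3 = deriv (deriv (deriv F)) z / F z"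
  have nz: "f \<noteq> 0" "c \<noteq> 0" using nonzero[OF z] by (simp_all add: v)
  have r: "F z = f" "C z = c" "deriv C z = a1 * c" "deriv F z = b1 * f"
    "deriv (deriv F) z = b2 * f" "deriv (deriv (deriv F)) z = b3 * f"
    using nonzero[OF z] by (simp_all add: v)
  have u2_Weyl_tensor: "u2_Weyl_tensor [i, j, k, l] = u2_Weyl F C i j k l" for i j k l
    by (simp add: u2_Weyl_tensor_def)
  have cov: "covz (u2_chr F C) u2_Weyl_tensor [s, s, i, j, k] z =
      (if s = 0 then deriv (u2_Weyl F C s i j k) z else 0)
      - (\<Sum>c\<in>UNIV. u2_chr F C s s c z * u2_Weyl F C c i j k z + u2_chr F C s i c z * u2_Weyl F C s c j k z
          + u2_chr F C s j c z * u2_Weyl F C s i c k z + u2_chr F C s k c z * u2_Weyl F C s i j c z)" for s i j k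
    by (simp add: covz_def u2_Weyl_tensor eval_nat_numeral sum.distrib)
  note S = cov deriv_Weyl[OF z] deriv_wsec[OF z] u2_Weyl_def u2_wsec_def u2_chr_def u2_log_def u2_warp_def u2_rot_def
      u2_ginv_def u2_div_def Let_def r
  note N = sum_4 struct_def u2_mix_def doubleton_eq_iff nz Let_def
  note A = field_simps power2_eq_square nz
  have c0: "\<forall>j k. (\<Sum>s\<in>UNIV. u2_ginv F C s z * covz (u2_chr F C) u2_Weyl_tensor [s, s, 0, j, k] z) = u2_div F C [0, j, k] z"
    unfolding forall_4 S by (intro conjI, simp_all add: N)
  have c1: "\<forall>j k. (\<Sum>s\<in>UNIV. u2_ginv F C s z * covz (u2_chr F C) u2_Weyl_tensor [s, s, 1, j, k] z) = u2_div F C [1, j, k] z"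
    unfolding forall_4 S by (intro conjI, simp_all add: N, simp_all add: A)
  have c2: "\<forall>j k. (\<Sum>s\<in>UNIV. u2_ginv F C s z * covz (u2_chr F C) u2_Weyl_tensor [s, s, 2, j, k] z) = u2_div F C [2, j, k] z"
    unfolding forall_4 S by (intro conjI, simp_all add: N, simp_all add: A)
  have c3: "\<forall>j k. (\<Sum>s\<in>UNIV. u2_ginv F C s z * covz (u2_chr F C) u2_Weyl_tensor [s, s, 3, j, k] z) = u2_div F C [3, j, k] z"
    unfolding forall_4 S by (intro conjI, simp_all add: N, simp_all add: A)
  note c = c0[rule_format] c1[rule_format] c2[rule_format] c3[rule_format]
  have "i = 1 \<or> i = 2 \<or> i = 3 \<or> i = 0 \<Longrightarrow> ?thesis"
    by (elim disjE; hypsubst; rule c)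
  then show ?thesis
    using exhaust_4[of i] zero_in_4 by metis
qed

end

lemma covz_3:
  "covz G T [u, i, j, k] z = (if u = 0 then deriv (T [i, j, k]) z else 0)
      - (\<Sum>c\<in>UNIV. G u i c z * T [c, j, k] z + G u j c z * T [i, c, k] z + G u k c z * T [i, j, c] z)"
  by (simp add: covz_def eval_nat_numeral sum.distrib)

lemma nth_triple: "[i, j, k] ! 0 = i" "[i, j, k] ! 1 = j" "[i, j, k] ! 2 = k"
  by simp_all

lemma has_real_derivative_if:
  "(b \<Longrightarrow> (f has_real_derivative d) A) \<Longrightarrow> (\<not> b \<Longrightarrow> (g has_real_derivative e) A) \<Longrightarrow>
    ((\<lambda>z. if b then f z else g z) has_real_derivative (if b then d else e)) A"
  by (cases b) simp_all

text \<open>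
  The Bach tensor is determined by \<open>e\<^sub>0\<close> and \<open>e\<^sub>1\<close>, which do not involve \<open>C\<close> since it is conformally
  covariant. The derivative of \<open>e\<^sub>0\<close> is \<open>- 2 F' e\<^sub>1\<close>.
\<close>

definition u2_e0 :: "(real \<Rightarrow> real) \<Rightarrow> real \<Rightarrow> real" where
  "u2_e0 F z = - 2 * deriv F z * deriv (deriv (deriv F)) z + (deriv (deriv F) z)\<^sup>2 + 5 * (deriv F z)\<^sup>2
     - 4 * (F z - 1)\<^sup>2"

definition u2_e1 :: "(real \<Rightarrow> real) \<Rightarrow> real \<Rightarrow> real" where
  "u2_e1 F z = deriv (deriv (deriv (deriv F))) z - 5 * deriv (deriv F) z + 4 * F z - 4"

definition u2_Bach :: "(real \<Rightarrow> real) \<Rightarrow> (real \<Rightarrow> real) \<Rightarrow> 4 \<Rightarrow> real \<Rightarrow> real" where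
  "u2_Bach F C i z = (if i = 0 then u2_e0 F z / (6 * F z * C z)
     else if i = 1 then (2 / 3 * F z * u2_e0 F z - 8 / 3 * (F z)\<^sup>2 * u2_e1 F z) / C z
     else (4 / 3 * F z * u2_e1 F z - 2 / 3 * u2_e0 F z) / C z)"

context u2 begin

lemma cov_cov_Weyl_entry:
  assumes p: "p \<in> cyl I"
  shows "cov g (cov g (Weyl_tensor g)) is p = covz (u2_chr F C) (covz (u2_chr F C) u2_Weyl_tensor) is (fst p)"
proof (rule cov_invariant[OF open_I p _ christoffel_entry])
  fix q :: point and js assume q: "q \<in> cyl I"
  show "cov g (Weyl_tensor g) js q = covz (u2_chr F C) u2_Weyl_tensor js (fst q)"
    by (rule cov_invariant[OF open_I q _ christoffel_entry])
       (simp_all add: Weyl_tensor_def u2_Weyl_tensor_def Weyl_entry)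
qed

lemma smooth_Weyl_tensor: "smooth_on I (u2_Weyl_tensor is)"
  unfolding u2_Weyl_tensor_def[abs_def] by (rule smooth_Weyl)

lemma smooth_cov_Weyl_tensor: "smooth_on I (covz (u2_chr F C) u2_Weyl_tensor is)"
  by (rule smooth_on_covz[OF open_I smooth_chr smooth_Weyl_tensor])

text \<open>
  Both double sums collapse since the metric is diagonal, and contracting \<open>s\<close> first leaves the
  covariant derivative of the divergence of the Weyl tensor.
\<close>

lemma Bach_reduce:
  assumes p: "p \<in> cyl I" and z_def: "z = fst p"
  shows "Bach g i j p = (\<Sum>u\<in>UNIV. u2_ginv F C u z * covz (u2_chr F C) (u2_div F C) [u, i, j, u] z)
     + (\<Sum>s\<in>UNIV. (u2_ginv F C s z)\<^sup>2 * u2_Weyl F C s i j s z * u2_Ric F C s z) / 2"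
proof -
  have z: "z \<in> I" using fst_in_I[OF p] z_def by simp
  let ?\<gamma> = "\<lambda>s. u2_ginv F C s z" and ?V = "covz (u2_chr F C) u2_Weyl_tensor"
  have "Bach g i j p = (\<Sum>s\<in>UNIV. \<Sum>u\<in>UNIV. ?\<gamma> s * ?\<gamma> u *
      (covz (u2_chr F C) ?V [u, s, s, i, j, u] z + u2_Weyl F C s i j u z * (if s = u then u2_Ric F C s z else 0) / 2))"
    unfolding Bach_def cov_cov_Weyl_entry[OF p] Weyl_entry[OF p] Ric_entry[OF p] ginv_entry[OF p] z_def[symmetric]
    by (simp add: if_zero_mult if_distrib[of "\<lambda>x. _ * x"] cong: if_cong)
  also have "\<dots> = (\<Sum>s\<in>UNIV. \<Sum>u\<in>UNIV. ?\<gamma> u * (?\<gamma> s * covz (u2_chr F C) ?V [u, s, s, i, j, u] z))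
     + (\<Sum>s\<in>UNIV. \<Sum>u\<in>UNIV. if s = u then (?\<gamma> s)\<^sup>2 * u2_Weyl F C s i j s z * u2_Ric F C s z / 2 else 0)"
    unfolding sum.distrib[symmetric]
    by (intro sum.cong refl) (simp add: distrib_left power2_eq_square mult_ac)
  also have "(\<Sum>s\<in>UNIV. \<Sum>u\<in>UNIV. ?\<gamma> u * (?\<gamma> s * covz (u2_chr F C) ?V [u, s, s, i, j, u] z))
     = (\<Sum>u\<in>UNIV. ?\<gamma> u * (\<Sum>s\<in>UNIV. ?\<gamma> s * covz (u2_chr F C) ?V [u, s, s, i, j, u] z))"
    by (subst sum.swap) (simp add: sum_distrib_left)
  also have "\<dots> = (\<Sum>u\<in>UNIV. ?\<gamma> u * covz (u2_chr F C)
      (\<lambda>is z. \<Sum>s\<in>UNIV. u2_ginv F C s z * ?V (s # s # is) z) [u, i, j, u] z)"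
    by (rule sum.cong[OF refl], rule arg_cong[of _ _ "(*) _"],
        rule covz_contract[OF open_I z smooth_ginv smooth_cov_Weyl_tensor], rule metric_parallel[OF z])
  also have "\<dots> = (\<Sum>u\<in>UNIV. ?\<gamma> u * covz (u2_chr F C) (u2_div F C) [u, i, j, u] z)"
  proof -
    let ?T = "\<lambda>is z. \<Sum>s\<in>UNIV. u2_ginv F C s z * ?V (s # s # is) z"
    have *: "?T [i, j, k] w = u2_div F C [i, j, k] w" if "w \<in> I" for i j k w
      using div_entry[OF that] .
    have d: "deriv (?T [i, j, k]) z = deriv (u2_div F C [i, j, k]) z" for i j k
      by (rule deriv_cong_ev)
         (use * open_I z in \<open>auto simp: eventually_nhds intro!: exI[of _ I]\<close>)
    show ?thesis
      unfolding covz_3 *[OF z] d ..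
  qed
  finally show ?thesis by (simp add: sum_divide_distrib)
qed

lemma deriv_div:
  assumes z: "z \<in> I"
  shows "deriv (u2_div F C [i, j, k]) z =
     (let q = deriv C z / C z * (deriv (deriv F) z + 2 * F z - 2) / 6 - 5 / 6 * deriv F z
            + deriv (deriv (deriv F)) z / 3;
          q' = (deriv (deriv C) z / C z - (deriv C z / C z)\<^sup>2) * (deriv (deriv F) z + 2 * F z - 2) / 6
            + deriv C z / C z * (deriv (deriv (deriv F)) z + 2 * deriv F z) / 6
            - 5 / 6 * deriv (deriv F) z + deriv (deriv (deriv (deriv F))) z / 3;
          e = if i = 1 then - 2 * (deriv F z * q + F z * q') else q';
          r = F z * (deriv (deriv F) z + deriv C z / C z * deriv F z - 2 * F z + 2);
          r' = deriv F z * (deriv (deriv F) z + deriv C z / C z * deriv F z - 2 * F z + 2) +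
               F z * (deriv (deriv (deriv F)) z
                 + (deriv (deriv C) z / C z - (deriv C z / C z)\<^sup>2) * deriv F z
                 + deriv C z / C z * deriv (deriv F) z - 2 * deriv F z) in
      if i = 0 then 0 else if j = i \<and> k = 0 then e else if k = i \<and> j = 0 then - e
      else struct j k i / 2 * (if i = 1 then - 2 * r' else r'))"
proof -
  define a where "a = (\<lambda>z. deriv C z / C z)"
  define q where "q = (\<lambda>z. a z * (deriv (deriv F) z + 2 * F z - 2) / 6 - 5 / 6 * deriv F z
            + deriv (deriv (deriv F)) z / 3)"
  define r where "r = (\<lambda>z. F z * (deriv (deriv F) z + a z * deriv F z - 2 * F z + 2))"
  define a' where "a' = deriv (deriv C) z / C z - (a z)\<^sup>2"
  define q' where "q' = a' * (deriv (deriv F) z + 2 * F z - 2) / 6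
            + a z * (deriv (deriv (deriv F)) z + 2 * deriv F z) / 6
            - 5 / 6 * deriv (deriv F) z + deriv (deriv (deriv (deriv F))) z / 3"
  define r' where "r' = deriv F z * (deriv (deriv F) z + a z * deriv F z - 2 * F z + 2) +
               F z * (deriv (deriv (deriv F)) z + a' * deriv F z
                 + a z * deriv (deriv F) z - 2 * deriv F z)"
  have p: "(a has_real_derivative a') (at z)"
    unfolding a_def a'_def using nonzero[OF z] by (auto intro!: derivative_eq_intros deriv_FC z simp: field_simps power2_eq_square)
  have q: "(q has_real_derivative q') (at z)"
    unfolding q_def q'_def by (auto intro!: derivative_eq_intros p deriv_FC z simp: field_simps)
  have r: "(r has_real_derivative r') (at z)"
  proof -
    have "((\<lambda>z. deriv (deriv F) z + a z * deriv F z - 2 * F z + 2) has_real_derivative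
        deriv (deriv (deriv F)) z + a' * deriv F z + a z * deriv (deriv F) z - 2 * deriv F z) (at z)"
      by (auto intro!: derivative_eq_intros p deriv_FC z)
    from DERIV_mult[OF deriv_FC(1)[OF z] this] show ?thesis
      unfolding r_def r'_def by (simp only: mult.commute)
  qed
  have Fq: "((\<lambda>z. - 2 * F z * q z) has_real_derivative - 2 * (deriv F z * q z + F z * q')) (at z)"
    by (rule derivative_eq_intros q deriv_FC[OF z] refl)+ (simp add: algebra_simps)
  have "u2_div F C [i, j, k] = (\<lambda>z. 
      if i = 0 then 0 else if j = i \<and> k = 0 then if i = 1 then - 2 * F z * q z else q z
      else if k = i \<and> j = 0 then - (if i = 1 then - 2 * F z * q z else q z)
      else struct j k i / 2 * (if i = 1 then - 2 * r z else r z))"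
    by (rule ext) (simp only: u2_div_def q_def r_def a_def Let_def nth_triple)
  moreover have "(\<dots> has_real_derivative (
      if i = 0 then 0 else if j = i \<and> k = 0 then if i = 1 then - 2 * (deriv F z * q z + F z * q') else q'
      else if k = i \<and> j = 0 then - (if i = 1 then - 2 * (deriv F z * q z + F z * q') else q')
      else struct j k i / 2 * (if i = 1 then - 2 * r' else r'))) (at z)"
    by (intro has_real_derivative_if DERIV_const DERIV_minus DERIV_cmult Fq q r)
  ultimately show ?thesis
    by (simp add: DERIV_imp_deriv Let_def q_def q'_def r_def r'_def a_def a'_def)
qed

lemma Bach_entry:
  assumes p: "p \<in> cyl I"
  shows "Bach g i j p = (if i = j then u2_Bach F C i (fst p) else 0)"
proof -
  define z where z_def: "z = fst p"
  have z: "z \<in> I" using p fst_in_I by (simp add: z_def)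
  define f c a1 a2 b1 b2 b3 b4 where v: "f = F z" "c = C z" "a1 = deriv C z / C z" "a2 = deriv (deriv C) z / C z"
    "b1 = deriv F z / F z" "b2 = deriv (deriv F) z / F z" "b3 = deriv (deriv (deriv F)) z / F z"
    "b4 = deriv (deriv (deriv (deriv F))) z / F z"
  have nz: "f \<noteq> 0" "c \<noteq> 0" using nonzero[OF z] by (simp_all add: v)
  have r: "F z = f" "C z = c" "deriv C z = a1 * c" "deriv (deriv C) z = a2 * c" "deriv F z = b1 * f"
    "deriv (deriv F) z = b2 * f" "deriv (deriv (deriv F)) z = b3 * f"
    "deriv (deriv (deriv (deriv F))) z = b4 * f"
    using nonzero[OF z] by (simp_all add: v)
  have cov: "covz (u2_chr F C) (u2_div F C) [u, i, j, u] z =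
      (if u = 0 then deriv (u2_div F C [i, j, u]) z else 0)
      - (\<Sum>c\<in>UNIV. u2_chr F C u i c z * u2_div F C [c, j, u] z + u2_chr F C u j c z * u2_div F C [i, c, u] z
          + u2_chr F C u u c z * u2_div F C [i, j, c] z)" for i j u
    by (rule covz_3)
  define P where "P = deriv (deriv F) z + 2 * F z - 2"
  define q where "q = deriv C z / C z * P / 6 - 5 / 6 * deriv F z + deriv (deriv (deriv F)) z / 3"
  define q' where "q' = (deriv (deriv C) z / C z - (deriv C z / C z)\<^sup>2) * P / 6
       + deriv C z / C z * (deriv (deriv (deriv F)) z + 2 * deriv F z) / 6
       - 5 / 6 * deriv (deriv F) z + deriv (deriv (deriv (deriv F))) z / 3"
  define rr where "rr = F z * (deriv (deriv F) z + deriv C z / C z * deriv F z - 2 * F z + 2)"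
  define r' where "r' = deriv F z * (deriv (deriv F) z + deriv C z / C z * deriv F z - 2 * F z + 2) +
       F z * (deriv (deriv (deriv F)) z + (deriv (deriv C) z / C z - (deriv C z / C z)\<^sup>2) * deriv F z
         + deriv C z / C z * deriv (deriv F) z - 2 * deriv F z)"
  have div: "u2_div F C [i, j, k] z = (if i = 0 then 0
      else if j = i \<and> k = 0 then if i = 1 then - 2 * F z * q else q
      else if k = i \<and> j = 0 then - (if i = 1 then - 2 * F z * q else q)
      else struct j k i / 2 * (if i = 1 then - 2 * rr else rr))" for i j k
    by (simp only: u2_div_def Let_def nth_triple q_def rr_def P_def)
  have ddiv: "deriv (u2_div F C [i, j, k]) z = (if i = 0 then 0
      else if j = i \<and> k = 0 then if i = 1 then - 2 * (deriv F z * q + F z * q') else q'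
      else if k = i \<and> j = 0 then - (if i = 1 then - 2 * (deriv F z * q + F z * q') else q')
      else struct j k i / 2 * (if i = 1 then - 2 * r' else r'))" for i j k
    by (simp only: deriv_div[OF z] Let_def q_def q'_def r'_def P_def)
  have d: "P = b2 * f + 2 * f - 2" "q = a1 * P / 6 - 5 / 6 * (b1 * f) + b3 * f / 3"
    "q' = (a2 - a1\<^sup>2) * P / 6 + a1 * (b3 * f + 2 * (b1 * f)) / 6 - 5 / 6 * (b2 * f) + b4 * f / 3"
    "rr = f * (b2 * f + a1 * (b1 * f) - 2 * f + 2)"
    "r' = b1 * f * (b2 * f + a1 * (b1 * f) - 2 * f + 2) +
       f * (b3 * f + (a2 - a1\<^sup>2) * (b1 * f) + a1 * (b2 * f) - 2 * (b1 * f))"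
    unfolding P_def q_def q'_def rr_def r'_def r using nz by simp_all
  have "\<forall>s i j. u2_mix s i j s = 0"
    unfolding forall_4 by (simp add: u2_mix_def struct_def)
  then have W: "u2_Weyl F C s i j s z = (if s = i \<or> s = j \<or> i \<noteq> j then 0 else
      c * P * (if {s, i} = {0, 1} then - 1 / 6 else if s = 0 \<or> i = 0 then 1 / (12 * f)
        else if s = 1 \<or> i = 1 then f / 3 else - 2 / 3))" for s i j
    unfolding u2_Weyl_def u2_wsec_def P_def r by simp
  have L: "u2_log F C i z = (a1 + (if i = 0 then - 1 else if i = 1 then 1 else 0) * b1) / 2"
      "u2_warp F C i z = (if i = 1 then 2 * f\<^sup>2 * (a1 + b1) else 2 * f * a1)" for i
    unfolding u2_log_def u2_warp_def r
    using nz by (simp_all add: power2_eq_square field_simps)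
  note S = cov ddiv div W u2_chr_def L u2_rot_def u2_ginv_def r
  note N = sum_4 struct_def doubleton_eq_iff nz
  note A = d field_simps power2_eq_square nz
  have off: "\<forall>i j. i \<noteq> j \<longrightarrow> (\<Sum>u\<in>UNIV. u2_ginv F C u z * covz (u2_chr F C) (u2_div F C) [u, i, j, u] z)
     + (\<Sum>s\<in>UNIV. (u2_ginv F C s z)\<^sup>2 * u2_Weyl F C s i j s z * u2_Ric F C s z) / 2 = 0"
    unfolding forall_4 S by (intro conjI impI, simp_all add: N)
  have diag: "\<forall>i. (\<Sum>u\<in>UNIV. u2_ginv F C u z * covz (u2_chr F C) (u2_div F C) [u, i, i, u] z)
     + (\<Sum>s\<in>UNIV. (u2_ginv F C s z)\<^sup>2 * u2_Weyl F C s i i s z * u2_Ric F C s z) / 2 = u2_Bach F C i z"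
    unfolding forall_4 S u2_Ric_def u2_Bach_def u2_e0_def u2_e1_def Let_def
    by (intro conjI, simp_all add: N, simp_all add: A r)
  have "(\<Sum>u\<in>UNIV. u2_ginv F C u z * covz (u2_chr F C) (u2_div F C) [u, i, j, u] z)
     + (\<Sum>s\<in>UNIV. (u2_ginv F C s z)\<^sup>2 * u2_Weyl F C s i j s z * u2_Ric F C s z) / 2 =
    (if i = j then u2_Bach F C i z else 0)"
    using off[rule_format, of i j] diag[rule_format, of i] by (cases "i = j") simp_all
  then show ?thesis
    unfolding Bach_reduce[OF p z_def] z_def[symmetric] .
qed

end

section \<open>The field equations as ordinary differential equations\<close>

text \<open>
  \<open>F C\<close> times the \<open>zz\<close>-component of the trace-free Ricci tensor.
\<close>

definition u2_rho :: "(real \<Rightarrow> real) \<Rightarrow> (real \<Rightarrow> real) \<Rightarrow> real \<Rightarrow> real" where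
  "u2_rho F C z = F z * C z / 8 - 3 / 4 * F z * deriv (deriv C) z + 9 / 8 * F z * (deriv C z)\<^sup>2 / C z
     - deriv F z * deriv C z / 4 - deriv (deriv F) z * C z / 4 - C z / 2"

text \<open>
  Up to the factor \<open>4 F / C\<close> the Laplacian of the scalar curvature.
\<close>

definition u2_w :: "(real \<Rightarrow> real) \<Rightarrow> (real \<Rightarrow> real) \<Rightarrow> real \<Rightarrow> real" where
  "u2_w F C z = deriv (deriv (u2_scal F C)) z + (deriv C z / C z + deriv F z / F z) * deriv (u2_scal F C) z"

text \<open>
  The \<open>zz\<close>-component of the field equations, up to a factor. It contains derivatives of at most third order.
\<close>

definition u2_K :: "real \<Rightarrow> (real \<Rightarrow> real) \<Rightarrow> (real \<Rightarrow> real) \<Rightarrow> real \<Rightarrow> real" where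
  "u2_K t F C z = u2_e0 F z + 3 * t * ((3 * F z * deriv C z + C z * deriv F z) / 2 * deriv (u2_scal F C) z
     + u2_scal F C z * u2_rho F C z)"

text \<open>
  The part of the field equations that has to be added to \<open>e\<^sub>1\<close> when \<open>t\<close> is not zero. The combination
  \<open>e\<^sub>1 + N\<close> is the sum of the \<open>11\<close>-equation and \<open>F\<close> times the \<open>22\<close>-equation, up to a factor and a multiple of \<open>w\<close>; in this sum \<open>e\<^sub>0\<close> cancels.
\<close>

definition u2_N :: "real \<Rightarrow> (real \<Rightarrow> real) \<Rightarrow> (real \<Rightarrow> real) \<Rightarrow> real \<Rightarrow> real" where
  "u2_N t F C z = 3 * t / 8 * (2 * (2 * F z * deriv C z + C z * deriv F z) * deriv (u2_scal F C) z / F z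
     - u2_scal F C z * (C z + 2 * deriv (deriv C) z - 3 * (deriv C z)\<^sup>2 / C z))"

lemma covz_2:
  "covz G T [i, j] z = (if i = 0 then deriv (T [j]) z else 0) - (\<Sum>c\<in>UNIV. G i j c z * T [c] z)"
  by (simp add: covz_def)

lemma covz_1: "covz G T [i] z = (if i = 0 then deriv (T []) z else 0)"
  by (simp add: covz_def)

context u2 begin

lemma smooth_scal: "smooth_on I (u2_scal F C)"
  unfolding u2_scal_def[abs_def] Let_def
  by (intro smooth_on_intros open_I smooth) (simp_all add: nonzero)

lemma hess_scal:
  assumes p: "p \<in> cyl I"
  shows "hess g (scal g) i j p = (if i = j then (if i = 0 then deriv (deriv (u2_scal F C)) (fst p) else 0)
     - u2_chr F C i i 0 (fst p) * deriv (u2_scal F C) (fst p) else 0)"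
proof -
  let ?\<tau> = "\<lambda>is::4 list. u2_scal F C"
  have "cov g (cov g (\<lambda>_. scal g)) [i, j] p = covz (u2_chr F C) (covz (u2_chr F C) ?\<tau>) [i, j] (fst p)"
  proof (rule cov_invariant[OF open_I p _ christoffel_entry])
    fix q :: point and js assume q: "q \<in> cyl I"
    show "cov g (\<lambda>_. scal g) js q = covz (u2_chr F C) ?\<tau> js (fst q)"
      by (rule cov_invariant[OF open_I q _ christoffel_entry]) (simp_all add: scal_entry)
  qed
  also have "\<dots> = (if i = 0 \<and> j = 0 then deriv (deriv (u2_scal F C)) (fst p) else 0)
      - u2_chr F C i j 0 (fst p) * deriv (u2_scal F C) (fst p)"
  proof -
    have "covz (u2_chr F C) ?\<tau> [j] = (\<lambda>z. if j = 0 then deriv (u2_scal F C) z else 0)" for j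
      by (simp add: covz_1 fun_eq_iff)
    then have "deriv (covz (u2_chr F C) ?\<tau> [j]) z = (if j = 0 then deriv (deriv (u2_scal F C)) z else 0)" for j z
      by simp
    then show ?thesis
      by (simp add: covz_2 covz_1 if_distrib[of "\<lambda>x. _ * x"] cong: if_cong)
  qed
  also have "u2_chr F C i j 0 (fst p) = (if i = j then u2_chr F C i i 0 (fst p) else 0)"
    by (auto simp: u2_chr_def)
  finally show ?thesis
    by (auto simp: hess_def)
qed

lemma laplacian_scal:
  assumes p: "p \<in> cyl I"
  shows "laplacian g (scal g) p = 4 * F (fst p) / C (fst p) * u2_w F C (fst p)"
proof -
  define z where "z = fst p"
  have z: "z \<in> I" using p fst_in_I by (simp add: z_def)
  have "laplacian g (scal g) p = (\<Sum>i\<in>UNIV. u2_ginv F C i z *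
     ((if i = 0 then deriv (deriv (u2_scal F C)) z else 0) - u2_chr F C i i 0 z * deriv (u2_scal F C) z))"
    unfolding z_def by (simp add: laplacian_def ginv_entry[OF p] hess_scal[OF p] if_zero_mult)
  also have "\<dots> = 4 * F z / C z * u2_w F C z"
    unfolding sum_4 u2_ginv_def u2_chr_def u2_log_def u2_warp_def u2_w_def
    by (simp add: nonzero[OF z]) (simp add: nonzero[OF z] field_simps power2_eq_square)
  finally show ?thesis by (simp add: z_def)
qed

definition "u2_E t i z = - 4 * u2_Bach F C i z + 2 * t * ((if i = 0 then deriv (deriv (u2_scal F C)) z else 0)
     - u2_chr F C i i 0 z * deriv (u2_scal F C) z - 4 * F z / C z * u2_w F C z * u2_g F C i z
     - u2_scal F C z * (u2_Ric F C i z - u2_scal F C z / 4 * u2_g F C i z))"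

lemma Bt_entry:
  assumes p: "p \<in> cyl I"
  shows "- 4 * Bach g i j p + t * S_grad g i j p = (if i = j then u2_E t i (fst p) else 0)"
  unfolding S_grad_def Bach_entry[OF p] hess_scal[OF p] laplacian_scal[OF p] Ric0_def scal_entry[OF p]
    Ric_entry[OF p] g_entry u2_E_def
  by simp

context
  fixes z t :: real assumes z: "z \<in> I"
begin

lemma E_0: "u2_E t 0 z = - 2 / (3 * F z * C z) * u2_K t F C z"
proof -
  define s s1 s2 where s: "s = u2_scal F C z" "s1 = deriv (u2_scal F C) z" "s2 = deriv (deriv (u2_scal F C)) z"
  define f c a1 a2 b1 b2 e0 where v: "f = F z" "c = C z" "a1 = deriv C z / C z" "a2 = deriv (deriv C) z / C z"
    "b1 = deriv F z / F z" "b2 = deriv (deriv F) z / F z" "e0 = u2_e0 F z"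
  have nz: "f \<noteq> 0" "c \<noteq> 0" using nonzero[OF z] by (simp_all add: v)
  have r: "F z = f" "C z = c" "deriv C z = a1 * c" "deriv (deriv C) z = a2 * c" "deriv F z = b1 * f"
    "deriv (deriv F) z = b2 * f" using nonzero[OF z] by (simp_all add: v)
  have rho: "u2_Ric F C 0 z - s / 4 * u2_g F C 0 z = u2_rho F C z / (f * c)"
    unfolding s u2_scal_def u2_Ric_def u2_g_def u2_rho_def Let_def r
    using nz by (simp add: field_simps power2_eq_square)
  have "u2_E t 0 z = - 4 * (e0 / (6 * f * c)) + 2 * t * (s2 - (a1 - b1) / 2 * s1 - (s2 + (a1 + b1) * s1)
      - s * (u2_rho F C z / (f * c)))"
    unfolding u2_E_def rho[symmetric] u2_Bach_def u2_w_def u2_g_def u2_chr_def u2_log_def s[symmetric] v(7)[symmetric] r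
    using nz by (simp add: field_simps)
  also have "\<dots> = - 2 / (3 * f * c) * (e0 + 3 * t * ((3 * f * (a1 * c) + c * (b1 * f)) / 2 * s1 + s * u2_rho F C z))"
    using nz by (simp add: field_simps)
  finally show ?thesis
    unfolding u2_K_def s[symmetric] v(7)[symmetric] r .
qed

lemma E_12: "u2_E t 1 z + F z * u2_E t 2 z
    = 16 / 3 * (F z)\<^sup>2 / C z * (u2_e1 F z + u2_N t F C z) - 16 * t * (F z)\<^sup>2 * u2_w F C z"
proof -
  define s s1 where s: "s = u2_scal F C z" "s1 = deriv (u2_scal F C) z"
  define w where "w = u2_w F C z"
  define f c a1 a2 b1 b2 e0 e1 where v: "f = F z" "c = C z" "a1 = deriv C z / C z" "a2 = deriv (deriv C) z / C z"
    "b1 = deriv F z / F z" "b2 = deriv (deriv F) z / F z" "e0 = u2_e0 F z" "e1 = u2_e1 F z"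
  have nz: "f \<noteq> 0" "c \<noteq> 0" using nonzero[OF z] by (simp_all add: v)
  have r: "F z = f" "C z = c" "deriv C z = a1 * c" "deriv (deriv C) z = a2 * c" "deriv F z = b1 * f"
    "deriv (deriv F) z = b2 * f" using nonzero[OF z] by (simp_all add: v)
  have q: "(u2_Ric F C 1 z - s / 4 * u2_g F C 1 z) + f * (u2_Ric F C 2 z - s / 4 * u2_g F C 2 z)
      = f\<^sup>2 * (1 + 2 * a2 - 3 * a1\<^sup>2)"
    unfolding s u2_scal_def u2_Ric_def u2_g_def Let_def r
    using nz by (simp add: field_simps power2_eq_square)
  have "u2_E t 1 z + f * u2_E t 2 z = 16 / 3 * f\<^sup>2 / c * e1 + 2 * t * (2 * f\<^sup>2 * (2 * a1 + b1) * s1 - 8 * f\<^sup>2 * w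
      - s * ((u2_Ric F C 1 z - s / 4 * u2_g F C 1 z) + f * (u2_Ric F C 2 z - s / 4 * u2_g F C 2 z)))"
    unfolding u2_E_def u2_Bach_def w_def[symmetric] u2_chr_def u2_warp_def s[symmetric] v(7,8)[symmetric] r
    using nz by (simp add: u2_g_def r) (simp add: field_simps power2_eq_square)
  also have "\<dots> = 16 / 3 * f\<^sup>2 / c * (e1 + 3 * t / 8 * (2 * (2 * f * (a1 * c) + c * (b1 * f)) * s1 / f
     - s * (c + 2 * (a2 * c) - 3 * (a1 * c)\<^sup>2 / c))) - 16 * t * f\<^sup>2 * w"
    unfolding q using nz by (simp add: field_simps power2_eq_square)
  finally show ?thesis
    unfolding u2_N_def s[symmetric] v(8)[symmetric] w_def[symmetric] r .
qed

text \<open>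
  The Bach tensor and the trace-free Ricci tensor have no trace, so the trace of the
  equations says that the scalar curvature is harmonic.
\<close>

lemma E_trace: "4 * F z / C z * u2_E t 0 z + u2_E t 1 z / (C z * F z) + 2 * u2_E t 2 z / C z
   = - 24 * t * F z / C z * u2_w F C z"
proof -
  define s s1 s2 where s: "s = u2_scal F C z" "s1 = deriv (u2_scal F C) z" "s2 = deriv (deriv (u2_scal F C)) z"
  define f c a1 a2 b1 b2 e0 e1 where v: "f = F z" "c = C z" "a1 = deriv C z / C z" "a2 = deriv (deriv C) z / C z"
    "b1 = deriv F z / F z" "b2 = deriv (deriv F) z / F z" "e0 = u2_e0 F z" "e1 = u2_e1 F z"
  have nz: "f \<noteq> 0" "c \<noteq> 0" using nonzero[OF z] by (simp_all add: v)
  have r: "F z = f" "C z = c" "deriv C z = a1 * c" "deriv (deriv C) z = a2 * c" "deriv F z = b1 * f"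
    "deriv (deriv F) z = b2 * f" using nonzero[OF z] by (simp_all add: v)
  define R where "R i = u2_Ric F C i z - s / 4 * u2_g F C i z" for i
  have R: "4 * f / c * R 0 + R 1 / (c * f) + 2 * R 2 / c = 0"
    unfolding R_def s u2_scal_def u2_Ric_def u2_g_def Let_def r
    using nz by (simp add: field_simps power2_eq_square)
  define w where "w = s2 + (a1 + b1) * s1"
  have w: "u2_w F C z = w"
    unfolding u2_w_def w_def r s[symmetric] using nz by simp
  have E0: "u2_E t 0 z = - 4 * (e0 / (6 * f * c)) + 2 * t * (s2 - (a1 - b1) / 2 * s1 - w - s * R 0)"
    unfolding u2_E_def R_def[symmetric] u2_Bach_def w u2_chr_def u2_log_def s[symmetric] R_def[symmetric] v(7,8)[symmetric] r
    using nz by (simp add: u2_g_def r)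
  have E1: "u2_E t 1 z = - 4 * ((2 / 3 * f * e0 - 8 / 3 * f\<^sup>2 * e1) / c) + 2 * t * (2 * f\<^sup>2 * (a1 + b1) * s1
      - 4 * f\<^sup>2 * w - s * R 1)"
    unfolding u2_E_def R_def[symmetric] u2_Bach_def w u2_chr_def u2_warp_def s[symmetric] R_def[symmetric] v(7,8)[symmetric] r
    using nz by (simp add: u2_g_def r) (simp add: field_simps power2_eq_square)
  have E2: "u2_E t 2 z = - 4 * ((4 / 3 * f * e1 - 2 / 3 * e0) / c) + 2 * t * (2 * f * a1 * s1
      - 4 * f * w - s * R 2)"
    unfolding u2_E_def R_def[symmetric] u2_Bach_def w u2_chr_def u2_warp_def s[symmetric] R_def[symmetric] v(7,8)[symmetric] r
    using nz by (simp add: u2_g_def r)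
  have "4 * f / c * u2_E t 0 z + u2_E t 1 z / (c * f) + 2 * u2_E t 2 z / c
     = - 24 * t * f / c * w - 2 * t * s * (4 * f / c * R 0 + R 1 / (c * f) + 2 * R 2 / c)"
    unfolding E0 E1 E2 w_def using nz by (simp add: field_simps power2_eq_square)
  then show ?thesis unfolding R w r by simp
qed

text \<open>
  The diagonal components 0, 1, 2 of the equations (component 3 equals component 2) are an invertible
  combination of the three scalar equations, where \<open>t \<noteq> 0\<close> makes the trace usable.
\<close>

lemma E_zero_iff:
  assumes t: "t \<noteq> 0"
  shows "(\<forall>i. u2_E t i z = 0) \<longleftrightarrow> u2_w F C z = 0 \<and> u2_K t F C z = 0 \<and> u2_e1 F z + u2_N t F C z = 0"
proof
  assume "\<forall>i. u2_E t i z = 0"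
  then have E: "u2_E t i z = 0" for i by blast
  note nz = nonzero[OF z]
  have w: "u2_w F C z = 0" using E_trace t nz by (simp add: E)
  then show "u2_w F C z = 0 \<and> u2_K t F C z = 0 \<and> u2_e1 F z + u2_N t F C z = 0"
    using E_0 E_12 nz by (simp add: E)
next
  assume *: "u2_w F C z = 0 \<and> u2_K t F C z = 0 \<and> u2_e1 F z + u2_N t F C z = 0"
  note nz = nonzero[OF z]
  have E0: "u2_E t 0 z = 0" using E_0 * by simp
  have E12: "u2_E t 1 z + F z * u2_E t 2 z = 0" using E_12 * by simp
  have "u2_E t 1 z + 2 * (F z * u2_E t 2 z) = 0"
    using E_trace * E0 nz by (simp add: field_simps)
  with E12 have "F z * u2_E t 2 z = 0" by linarith
  with nz have E2: "u2_E t 2 z = 0" by simp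
  have E1: "u2_E t 1 z = 0" using E12 E2 by simp
  have E3: "u2_E t 3 z = u2_E t 2 z"
    by (simp add: u2_E_def u2_Bach_def u2_chr_def u2_warp_def u2_g_def u2_Ric_def)
  show "\<forall>i. u2_E t i z = 0"
    unfolding forall_4 zero_in_4 using E0 E1 E2 E3 by simp
qed

end

lemma point_over: "z \<in> I \<Longrightarrow> (z, 1, 0) \<in> cyl I"
  by (simp add: cyl_def norm_Pair)

lemma Bt_flat_iff:
  assumes t: "t \<noteq> 0"
  shows "Bt_flat t I g \<longleftrightarrow>
    (\<forall>z\<in>I. u2_w F C z = 0 \<and> u2_K t F C z = 0 \<and> u2_e1 F z + u2_N t F C z = 0)"
proof -
  have "Bt_flat t I g \<longleftrightarrow> (\<forall>p\<in>cyl I. \<forall>i. u2_E t i (fst p) = 0)"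
  proof -
    have "(\<forall>i j. - 4 * Bach g i j p + t * S_grad g i j p = 0) \<longleftrightarrow> (\<forall>i. u2_E t i (fst p) = 0)"
      if "p \<in> cyl I" for p
      by (simp only: Bt_entry[OF that]) auto
    then show ?thesis by (simp only: Bt_flat_def cong: ball_cong)
  qed
  also have "\<dots> \<longleftrightarrow> (\<forall>z\<in>I. \<forall>i. u2_E t i z = 0)"
    using point_over fst_in_I by (metis fst_conv)
  also have "\<dots> \<longleftrightarrow> (\<forall>z\<in>I. u2_w F C z = 0 \<and> u2_K t F C z = 0 \<and> u2_e1 F z + u2_N t F C z = 0)"
    using E_zero_iff[OF _ t] by simp
  finally show ?thesis .
qed

text \<open>
  Conservation of the energy: the derivative of \<open>K\<close> is a combination of the left-hand sides of the other two equations.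
  Therefore \<open>K = 0\<close> is a condition on initial data only.
\<close>

lemma K_derivative:
  assumes z: "z \<in> I"
  shows "(u2_K t F C has_real_derivative - 2 * deriv F z * (u2_e1 F z + u2_N t F C z)
     + 3 * t / 2 * (3 * F z * deriv C z + C z * deriv F z) * u2_w F C z) (at z)"
proof -
  define s s1 s2 where s: "s = u2_scal F C z" "s1 = deriv (u2_scal F C) z" "s2 = deriv (deriv (u2_scal F C)) z"
  define f c a1 a2 a3 b1 b2 b3 where v: "f = F z" "c = C z" "a1 = deriv C z / C z" "a2 = deriv (deriv C) z / C z"
    "a3 = deriv (deriv (deriv C)) z / C z"
    "b1 = deriv F z / F z" "b2 = deriv (deriv F) z / F z" "b3 = deriv (deriv (deriv F)) z / F z"
  have nz: "f \<noteq> 0" "c \<noteq> 0" using nonzero[OF z] by (simp_all add: v)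
  have r: "F z = f" "C z = c" "deriv C z = a1 * c" "deriv (deriv C) z = a2 * c" "deriv F z = b1 * f"
    "deriv (deriv F) z = b2 * f" "deriv (deriv (deriv F)) z = b3 * f" "deriv (deriv (deriv C)) z = a3 * c"
    using nonzero[OF z] by (simp_all add: v)
  have e0: "(u2_e0 F has_real_derivative - 2 * deriv F z * u2_e1 F z) (at z)"
    unfolding u2_e0_def u2_e1_def 
    by (auto intro!: derivative_eq_intros deriv_FC z simp: algebra_simps)
  define X where "X = f * c / 8 - 3 / 4 * f * (a2 * c) + 9 / 8 * f * (a1\<^sup>2 * c) - b1 * f * (a1 * c) / 4 - b2 * f * c / 4 - c / 2"
  have rho0: "u2_rho F C z = X"
    unfolding u2_rho_def X_def r using nz by (simp add: power2_eq_square)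
  define Y where "Y = b1 * f * c / 8 + f * (a1 * c) / 8 - 3 / 4 * (b1 * f * (a2 * c) + f * (a3 * c))
     + 9 / 8 * c * (b1 * f * a1\<^sup>2 + 2 * f * a1 * a2 - f * a1 ^ 3)
     - (b2 * f * (a1 * c) + b1 * f * (a2 * c)) / 4 - (b3 * f * c + b2 * f * (a1 * c)) / 4 - a1 * c / 2"
  have rho: "(u2_rho F C has_real_derivative Y) (at z)"
    unfolding u2_rho_def[abs_def] Y_def
    using nz by (auto intro!: derivative_eq_intros deriv_FC z simp: r)
      (simp add: field_simps power2_eq_square power3_eq_cube)
  have sc: "(u2_scal F C has_real_derivative s1) (at z)" "(deriv (u2_scal F C) has_real_derivative s2) (at z)"
    unfolding s using smooth_on_has_derivative[OF open_I smooth_scal z]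
      smooth_on_has_derivative[OF open_I smooth_on_deriv[OF smooth_scal] z] by auto
  have s_eq: "s = (8 - 2 * f * (1 + 2 * b2 + 6 * a2 + 6 * b1 * a1 - 3 * a1\<^sup>2)) / c"
    unfolding s u2_scal_def Let_def r using nz by simp
  have s1_eq: "s1 = - 2 * f * (b1 + 2 * b3 + 6 * (b1 * a2 + a3 - a1 * a2) + 6 * (b2 * a1 + b1 * a2 - b1 * a1\<^sup>2)
       - 3 * (b1 * a1\<^sup>2 + 2 * a1 * a2 - 2 * a1 ^ 3)) / c - s * a1"
  proof -
    define n where "n = (\<lambda>z. 8 - 2 * F z - 4 * deriv (deriv F) z - 12 * (F z * deriv (deriv C) z / C z)
      - 12 * (deriv F z * deriv C z / C z) + 6 * (F z * (deriv C z / C z)\<^sup>2))"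
    have n: "(n has_real_derivative - 2 * f * (b1 + 2 * b3 + 6 * (b1 * a2 + a3 - a1 * a2)
        + 6 * (b2 * a1 + b1 * a2 - b1 * a1\<^sup>2) - 3 * (b1 * a1\<^sup>2 + 2 * a1 * a2 - 2 * a1 ^ 3))) (at z)"
      unfolding n_def using nz by (auto intro!: derivative_eq_intros deriv_FC z simp: r)
        (simp add: field_simps power2_eq_square power3_eq_cube)
    have sn: "n w / C w = u2_scal F C w" if "w \<in> I" for w
      unfolding n_def u2_scal_def Let_def using nonzero[OF that] by (simp add: field_simps power2_eq_square)
    have "((\<lambda>w. n w / C w) has_real_derivative (- 2 * f * (b1 + 2 * b3 + 6 * (b1 * a2 + a3 - a1 * a2)
        + 6 * (b2 * a1 + b1 * a2 - b1 * a1\<^sup>2) - 3 * (b1 * a1\<^sup>2 + 2 * a1 * a2 - 2 * a1 ^ 3)) * C z - n z * deriv C z)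
        / (C z * C z)) (at z)"
      using nonzero[OF z] by (intro DERIV_divide n deriv_FC z)
    from DERIV_unique[OF sc(1) has_real_derivative_cong_open[OF this open_I z sn]]
    have "s1 = (- 2 * f * (b1 + 2 * b3 + 6 * (b1 * a2 + a3 - a1 * a2)
        + 6 * (b2 * a1 + b1 * a2 - b1 * a1\<^sup>2) - 3 * (b1 * a1\<^sup>2 + 2 * a1 * a2 - 2 * a1 ^ 3)) * C z - n z * deriv C z)
        / (C z * C z)" .
    moreover have "n z = s * c" using sn[OF z] nz by (simp add: s r field_simps)
    ultimately show ?thesis
      unfolding r using nz by (simp add: diff_divide_distrib)
  qed
  define M M' where M: "M = 3 * f * (a1 * c) + c * (b1 * f)"
    "M' = 3 * (b1 * f * (a1 * c) + f * (a2 * c)) + a1 * c * (b1 * f) + c * (b2 * f)"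
  define Mf where "Mf = (\<lambda>z. 3 * F z * deriv C z + C z * deriv F z)"
  have Mz: "Mf z = M" by (simp add: Mf_def M r)
  have M_deriv: "(Mf has_real_derivative M') (at z)"
    unfolding Mf_def M by (auto intro!: derivative_eq_intros deriv_FC z simp: r algebra_simps)
  have N: "u2_N t F C z = 3 * t / 8 * (2 * (2 * a1 + b1) * c * s1 - s * c * (1 + 2 * a2 - 3 * a1\<^sup>2))"
    unfolding u2_N_def s[symmetric] r using nz by (simp add: field_simps power2_eq_square)
  have w: "u2_w F C z = s2 + (a1 + b1) * s1"
    unfolding u2_w_def s[symmetric] r using nz by simp
  \<comment> \<open>The terms with the first derivative of \<open>s\<close> and those with \<open>s\<close> itself are multiples of \<open>s s'\<close> that cancel.\<close>
  have 1: "M' / 2 - M * (a1 + b1) / 2 + X + b1 * f * c * (2 * a1 + b1) / 2 = - c\<^sup>2 / 16 * s"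
    unfolding M X_def s_eq using nz by (simp add: field_simps power2_eq_square)
  have 2: "Y - b1 * f * c * (1 + 2 * a2 - 3 * a1\<^sup>2) / 4 = c\<^sup>2 / 16 * s1"
    unfolding Y_def s1_eq unfolding s_eq using nz by (simp add: field_simps power2_eq_square power3_eq_cube)
  have K: "u2_K t F C = (\<lambda>z. u2_e0 F z + 3 * t * (Mf z / 2 * deriv (u2_scal F C) z + u2_scal F C z * u2_rho F C z))"
    by (rule ext) (simp only: u2_K_def Mf_def)
  have "(u2_K t F C has_real_derivative - 2 * deriv F z * u2_e1 F z
      + 3 * t * ((M' / 2 * s1 + M / 2 * s2) + (s1 * X + s * Y))) (at z)"
    unfolding K by (auto intro!: derivative_eq_intros e0 M_deriv sc rho simp: rho0 Mz s field_simps)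
  also have "- 2 * deriv F z * u2_e1 F z + 3 * t * ((M' / 2 * s1 + M / 2 * s2) + (s1 * X + s * Y))
     = - 2 * deriv F z * (u2_e1 F z + u2_N t F C z) + 3 * t / 2 * M * u2_w F C z + 3 * t *
      (s1 * (M' / 2 - M * (a1 + b1) / 2 + X + b1 * f * c * (2 * a1 + b1) / 2)
        + s * (Y - b1 * f * c * (1 + 2 * a2 - 3 * a1\<^sup>2) / 4))"
    unfolding N w r by (simp add: field_simps)
  also have "\<dots> = - 2 * deriv F z * (u2_e1 F z + u2_N t F C z) + 3 * t / 2 * Mf z * u2_w F C z"
    unfolding 1 2 Mz by simp
  finally show ?thesis
    unfolding Mf_def .
qed

end

section \<open>Continuously differentiable maps\<close>

definition C1 :: "'p::euclidean_space set \<Rightarrow> ('p \<Rightarrow> 'a::euclidean_space) \<Rightarrow> bool" where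
  "C1 U f \<longleftrightarrow> (\<exists>f'. C1_map_on U f f')"

lemma C1_open: "C1 U f \<Longrightarrow> open U"
  by (auto simp: C1_def C1_map_on_def)

lemma C1_const: "open U \<Longrightarrow> C1 U (\<lambda>x. c)"
proof -
  have "blinfun_apply (0 :: 'a \<Rightarrow>\<^sub>L 'b) = (\<lambda>_. 0)" by (rule ext) simp
  then show "open U \<Longrightarrow> C1 U (\<lambda>x::'a. c :: 'b)"
    unfolding C1_def C1_map_on_def by (intro exI[of _ "\<lambda>x. 0"]) simp
qed

lemma C1_linear_comp:
  assumes A: "bounded_linear A" and f: "C1 U f"
  shows "C1 U (\<lambda>x. A (f x))"
proof -
  obtain f' where f': "open U" "\<And>x. x \<in> U \<Longrightarrow> (f has_derivative blinfun_apply (f' x)) (at x)"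
    "continuous_on U f'"
    using f by (auto simp: C1_def C1_map_on_def)
  have "C1_map_on U (\<lambda>x. A (f x)) (\<lambda>x. Blinfun A o\<^sub>L f' x)"
    unfolding C1_map_on_def
  proof (intro conjI ballI f'(1))
    fix x assume "x \<in> U"
    from bounded_linear.has_derivative[OF A f'(2)[OF this]]
    show "((\<lambda>x. A (f x)) has_derivative blinfun_apply (Blinfun A o\<^sub>L f' x)) (at x)"
    proof -
      have "blinfun_apply (Blinfun A o\<^sub>L f' x) = (\<lambda>h. A (f' x h))"
        by (rule ext) (simp add: bounded_linear_Blinfun_apply[OF A])
      then show ?thesis
        using \<open>((\<lambda>x. A (f x)) has_derivative (\<lambda>h. A (f' x h))) (at x)\<close> by simp
    qed
  next
    show "continuous_on U (\<lambda>x. Blinfun A o\<^sub>L f' x)"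
      by (intro continuous_intros f'(3))
  qed
  then show ?thesis by (auto simp: C1_def)
qed

lemma C1_id: "open U \<Longrightarrow> C1 U (\<lambda>x. x)"
  unfolding C1_def C1_map_on_def by (intro exI[of _ "\<lambda>x. id_blinfun"]) (simp add: id_blinfun.rep_eq[abs_def])

lemma C1_linear: "open U \<Longrightarrow> bounded_linear A \<Longrightarrow> C1 U A"
  using C1_linear_comp[OF _ C1_id] by blast

lemma C1_add:
  assumes f: "C1 U f" and g: "C1 U g"
  shows "C1 U (\<lambda>x. f x + g x)"
proof -
  obtain f' g' where f': "C1_map_on U f f'" and g': "C1_map_on U g g'"
    using f g by (auto simp: C1_def)
  have "C1_map_on U (\<lambda>x. f x + g x) (\<lambda>x. f' x + g' x)"
    using f' g' unfolding C1_map_on_def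
    by (auto intro!: continuous_intros has_derivative_add simp: plus_blinfun.rep_eq)
  then show ?thesis by (auto simp: C1_def)
qed

lemma C1_mult:
  fixes f g :: "'p::euclidean_space \<Rightarrow> real"
  assumes f: "C1 U f" and g: "C1 U g"
  shows "C1 U (\<lambda>x. f x * g x)"
proof -
  obtain f' g' where f': "C1_map_on U f f'" and g': "C1_map_on U g g'"
    using f g by (auto simp: C1_def)
  have *: "C1_map_on U (\<lambda>x. f x * g x) (\<lambda>x. f x *\<^sub>R g' x + g x *\<^sub>R f' x)"
    unfolding C1_map_on_def
  proof (intro conjI ballI)
    fix x assume "x \<in> U"
    then have "(f has_derivative f' x) (at x)" "(g has_derivative g' x) (at x)"
      using f' g' by (auto simp: C1_map_on_def)
    from has_derivative_mult[OF this]
    show "((\<lambda>x. f x * g x) has_derivative blinfun_apply (f x *\<^sub>R g' x + g x *\<^sub>R f' x)) (at x)"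
      by (simp add: plus_blinfun.rep_eq scaleR_blinfun.rep_eq mult.commute)
  next
    have "continuous_on U f" "continuous_on U g"
      using f' g' by (auto simp: C1_map_on_def intro!: continuous_at_imp_continuous_on has_derivative_continuous)
    then show "continuous_on U (\<lambda>x. f x *\<^sub>R g' x + g x *\<^sub>R f' x)"
      using f' g' by (auto simp: C1_map_on_def intro!: continuous_intros)
  qed (use f' in \<open>auto simp: C1_map_on_def\<close>)
  then show ?thesis by (auto simp: C1_def)
qed

lemma C1_inverse:
  fixes f :: "'p::euclidean_space \<Rightarrow> real"
  assumes f: "C1 U f" and nz: "\<And>x. x \<in> U \<Longrightarrow> f x \<noteq> 0"
  shows "C1 U (\<lambda>x. inverse (f x))"
proof -
  obtain f' where f': "C1_map_on U f f'"
    using f by (auto simp: C1_def)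
  have *: "C1_map_on U (\<lambda>x. inverse (f x)) (\<lambda>x. (- (inverse (f x) * inverse (f x))) *\<^sub>R f' x)"
    unfolding C1_map_on_def
  proof (intro conjI ballI)
    fix x assume x: "x \<in> U"
    then have "(f has_derivative f' x) (at x)"
      using f' by (auto simp: C1_map_on_def)
    note d = Deriv.has_derivative_inverse[OF nz[OF x] this]
    have "blinfun_apply ((- (inverse (f x) * inverse (f x))) *\<^sub>R f' x)
        = (\<lambda>h. - (inverse (f x) * f' x h * inverse (f x)))"
      by (rule ext) (simp add: blinfun.bilinear_simps)
    then show "((\<lambda>x. inverse (f x)) has_derivative
        blinfun_apply ((- (inverse (f x) * inverse (f x))) *\<^sub>R f' x)) (at x)"
      using d by simp
  next
    have "continuous_on U f"
      using f' by (auto simp: C1_map_on_def intro!: continuous_at_imp_continuous_on has_derivative_continuous)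
    then show "continuous_on U (\<lambda>x. (- (inverse (f x) * inverse (f x))) *\<^sub>R f' x)"
      using f' nz by (auto simp: C1_map_on_def intro!: continuous_intros)
  qed (use f' in \<open>auto simp: C1_map_on_def\<close>)
  then show ?thesis by (auto simp: C1_def)
qed

lemma C1_minus: "C1 U f \<Longrightarrow> C1 U (\<lambda>x. - f x)"
  by (rule C1_linear_comp[OF bounded_linear_minus[OF bounded_linear_ident]])

lemma C1_diff: "C1 U f \<Longrightarrow> C1 U g \<Longrightarrow> C1 U (\<lambda>x. f x - g x)"
  using C1_add[OF _ C1_minus] by fastforce

lemma C1_divide:
  fixes f g :: "'p::euclidean_space \<Rightarrow> real"
  shows "C1 U f \<Longrightarrow> C1 U g \<Longrightarrow> (\<And>x. x \<in> U \<Longrightarrow> g x \<noteq> 0) \<Longrightarrow> C1 U (\<lambda>x. f x / g x)"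
  unfolding divide_inverse by (intro C1_mult C1_inverse)

lemma C1_power:
  fixes f :: "'p::euclidean_space \<Rightarrow> real"
  shows "C1 U f \<Longrightarrow> C1 U (\<lambda>x. f x ^ n)"
  by (induction n) (auto intro: C1_mult C1_const C1_open)

lemma C1_Pair:
  fixes f :: "'p::euclidean_space \<Rightarrow> 'a::euclidean_space" and g :: "'p \<Rightarrow> 'b::euclidean_space"
  assumes f: "C1 U f" and g: "C1 U g"
  shows "C1 U (\<lambda>x. (f x, g x))"
proof -
  have "bounded_linear (\<lambda>x::'a. (x, 0::'b))" "bounded_linear (\<lambda>x::'b. (0::'a, x))"
    by (intro bounded_linear_Pair bounded_linear_ident bounded_linear_zero)+
  from C1_add[OF C1_linear_comp[OF this(1) f] C1_linear_comp[OF this(2) g]] show ?thesis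
    by simp
qed

lemma C1_fst: "C1 U f \<Longrightarrow> C1 U (\<lambda>x. fst (f x))"
  by (rule C1_linear_comp[OF bounded_linear_fst])

lemma C1_snd: "C1 U f \<Longrightarrow> C1 U (\<lambda>x. snd (f x))"
  by (rule C1_linear_comp[OF bounded_linear_snd])

lemma C1_vec_nth: "open U \<Longrightarrow> C1 U (\<lambda>x. x $ i :: real)"
  by (rule C1_linear) (auto intro: bounded_linear_vec_nth)

lemmas C1_intros = C1_const C1_add C1_minus C1_diff C1_mult C1_divide C1_power C1_Pair C1_fst C1_snd
  C1_id C1_vec_nth

section \<open>Ordinary differential equations\<close>

definition locally_lipschitz :: "'a::euclidean_space set \<Rightarrow> ('a \<Rightarrow> 'a) \<Rightarrow> bool" where
  "locally_lipschitz U f \<longleftrightarrow> (\<forall>x\<in>U. \<exists>r>0. \<exists>L. cball x r \<subseteq> U \<and>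
     (\<forall>y\<in>cball x r. \<forall>w\<in>cball x r. norm (f y - f w) \<le> L * norm (y - w)))"

lemma C1_locally_lipschitz:
  assumes "C1 U f"
  shows "locally_lipschitz U f"
  unfolding locally_lipschitz_def
proof
  fix x assume x: "x \<in> U"
  obtain f' where U: "open U" and f': "\<And>x. x \<in> U \<Longrightarrow> (f has_derivative blinfun_apply (f' x)) (at x)"
    and c: "continuous_on U f'"
    using assms by (auto simp: C1_def C1_map_on_def)
  have "isCont f' x" using c U x by (simp add: continuous_on_eq_continuous_at)
  then obtain d where d: "d > 0" "\<And>y. dist y x < d \<Longrightarrow> dist (f' y) (f' x) < 1"
    unfolding continuous_at_eps_delta by (meson zero_less_one)
  obtain e where e: "e > 0" "cball x e \<subseteq> U" using U x open_contains_cball by blast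
  define r where "r = min e (d / 2)"
  have r: "r > 0" "cball x r \<subseteq> U" "\<And>y. y \<in> cball x r \<Longrightarrow> dist y x < d"
    using d(1) e by (auto simp: r_def dist_commute)
  have "norm (f y - f w) \<le> (norm (f' x) + 1) * norm (y - w)" if "y \<in> cball x r" "w \<in> cball x r" for y w
  proof (rule differentiable_bound[OF convex_cball[of x r] _ _ that(1) that(2)])
    fix v assume v: "v \<in> cball x r"
    then show "(f has_derivative blinfun_apply (f' v)) (at v within cball x r)"
      using f' r(2) has_derivative_at_withinI by blast
    have "norm (f' v) \<le> norm (f' x) + norm (f' v - f' x)"
      by (rule norm_triangle_sub)
    also have "\<dots> \<le> norm (f' x) + 1" using d(2)[OF r(3)[OF v]] by (simp add: dist_norm)
    finally show "onorm (blinfun_apply (f' v)) \<le> norm (f' x) + 1"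
      by (simp add: norm_blinfun.rep_eq)
  qed
  with r show "\<exists>r>0. \<exists>L. cball x r \<subseteq> U \<and>
     (\<forall>y\<in>cball x r. \<forall>w\<in>cball x r. norm (f y - f w) \<le> L * norm (y - w))" by blast
qed

text \<open>
  The derivative of a curve, seen as a linear map on the reals, is bounded by its velocity.
\<close>

lemma onorm_scaleR_le:
  assumes "norm v \<le> B"
  shows "onorm (\<lambda>h::real. h *\<^sub>R v) \<le> B"
proof (rule onorm_le)
  fix h :: real
  show "norm (h *\<^sub>R v) \<le> B * norm h"
    using mult_right_mono[OF assms, of "\<bar>h\<bar>"] by (simp add: mult.commute)
qed

text \<open>
  The vector field is extended from a closed ball to a globally Lipschitz field by composing it with
  the nearest-point projection \<open>P\<close>. The integral equation is then a contraction on all bounded continuous functions on the real line;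
  solutions are made constant outside \<open>[a, b]\<close> by the clamping function \<open>cl\<close>. For small \<open>T\<close> the fixed point
  stays in the ball, where the extension agrees with the given field.
\<close>

theorem picard_lindeloef:
  fixes f :: "'a::euclidean_space \<Rightarrow> 'a"
  assumes "locally_lipschitz U f" "y0 \<in> U"
  obtains T y where "T > 0" "y t0 = y0"
    "\<And>t. t \<in> {t0 - T<..<t0 + T} \<Longrightarrow> y t \<in> U \<and> (y has_vector_derivative f (y t)) (at t)"
proof -
  obtain r L0 where r: "r > 0" "cball y0 r \<subseteq> U"
    and lip0: "\<And>y w. y \<in> cball y0 r \<Longrightarrow> w \<in> cball y0 r \<Longrightarrow> norm (f y - f w) \<le> L0 * norm (y - w)"
    using assms unfolding locally_lipschitz_def by blast
  define L where "L = max L0 1"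
  have L: "L \<ge> 1" "L \<ge> L0" by (auto simp: L_def)
  define P where "P = closest_point (cball y0 r)"
  define h where "h = (\<lambda>y. f (P y))"
  have ball: "cball y0 r \<noteq> {}" "closed (cball y0 r)" "convex (cball y0 r)" using r by auto
  have P: "P y \<in> cball y0 r" for y unfolding P_def by (rule closest_point_in_set[OF ball(2,1)])
  have lip: "norm (h y - h w) \<le> L * norm (y - w)" for y w
  proof -
    have "norm (h y - h w) \<le> L0 * norm (P y - P w)" unfolding h_def by (rule lip0[OF P P])
    also have "\<dots> \<le> L * norm (P y - P w)" by (intro mult_right_mono L) simp
    also have "\<dots> \<le> L * norm (y - w)"
      using closest_point_lipschitz[OF ball(3,2,1)] L by (intro mult_left_mono) (auto simp: P_def dist_norm)
    finally show ?thesis .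
  qed
  have h_cont: "continuous_on UNIV h"
    by (rule continuous_on_iff[THEN iffD2], intro ballI allI impI)
      (use lip L in \<open>force simp: dist_norm intro!: exI[of _ "e / L" for e] 
        elim!: order.strict_trans1[OF lip] simp: field_simps\<close>)
  define M where "M = norm (f y0) + L * r"
  have M: "norm (h y) \<le> M" for y
  proof -
    have "norm (h y - f y0) \<le> L0 * norm (P y - y0)"
      unfolding h_def using r by (intro lip0[OF P]) auto
    also have "\<dots> \<le> L * norm (P y - y0)" by (intro mult_right_mono L) simp
    also have "\<dots> \<le> L * r"
      using P[of y] L by (intro mult_left_mono) (auto simp: dist_norm norm_minus_commute)
    finally have "norm (h y - f y0) \<le> L * r" .
    then show ?thesis unfolding M_def using norm_triangle_sub[of "h y" "f y0"] by linarith
  qed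
  have M0: "M \<ge> 0" using M[of y0] norm_ge_zero order_trans by blast
  \<comment> \<open>The first bound makes the integral operator a contraction, the second keeps the solution in the ball.\<close>
  define T where "T = min (1 / (8 * L)) (r / (M + 1))"
  have T: "T > 0" "T * L \<le> 1 / 8" "T * M \<le> r"
  proof -
    show "T > 0" using L M0 r by (simp add: T_def)
    have "T \<le> 1 / (8 * L)" by (simp add: T_def)
    then show "T * L \<le> 1 / 8" using L by (simp add: field_simps)
    have "T \<le> r / (M + 1)" by (simp add: T_def)
    then have "T * (M + 1) \<le> r" using M0 by (simp add: field_simps)
    then show "T * M \<le> r" using \<open>T > 0\<close> by (simp add: algebra_simps)
  qed
  define a b where ab: "a = t0 - T" "b = t0 + T"
  have ab': "a \<le> t0" "t0 \<le> b" "b - a = 2 * T" using T by (auto simp: ab)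
  define cl where "cl = (\<lambda>t. max a (min b t))"
  have cl: "cl t \<in> {a..b}" for t using ab' by (auto simp: cl_def)
  have cl_cont: "continuous_on UNIV cl" unfolding cl_def by (intro continuous_intros)
  have h_comp: "continuous_on S (\<lambda>s. h (apply_bcontfun y s))" for y :: "real \<Rightarrow>\<^sub>C 'a" and S
    by (rule continuous_on_compose2[OF h_cont]) auto
  have hint: "(\<lambda>s. h (apply_bcontfun y s)) integrable_on {u..v}" for y :: "real \<Rightarrow>\<^sub>C 'a" and u v
    by (intro integrable_continuous_real h_comp)
  \<comment> \<open>The integral from \<open>t0\<close> to \<open>cl t\<close>, written as a difference so that its orientation does not matter.\<close>
  define G0 where "G0 = (\<lambda>(y :: real \<Rightarrow>\<^sub>C 'a) t. y0 + integral {a..cl t} (\<lambda>s. h (apply_bcontfun y s))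
      - integral {a..t0} (\<lambda>s. h (apply_bcontfun y s)))"
  have intM: "norm (integral {a..v} (\<lambda>s. h (apply_bcontfun y s))) \<le> 2 * T * M" if "v \<in> {a..b}" for y v
  proof -
    have "norm (integral {a..v} (\<lambda>s. h (apply_bcontfun y s))) \<le> M * (v - a)"
      using that by (intro integral_bound h_comp M) auto
    also have "\<dots> \<le> M * (2 * T)" using that M0 ab' by (intro mult_left_mono) auto
    finally show ?thesis by (simp add: mult_ac)
  qed
  have G0: "G0 y \<in> bcontfun" for y
  proof (rule bcontfun_normI)
    have "continuous_on {a..b} (\<lambda>x. integral {a..x} (\<lambda>s. h (apply_bcontfun y s)))"
      by (rule indefinite_integral_continuous_1[OF hint])
    then have "continuous_on UNIV (\<lambda>t. integral {a..cl t} (\<lambda>s. h (apply_bcontfun y s)))"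
      by (rule continuous_on_compose2[OF _ cl_cont]) (use cl in auto)
    then show "continuous_on UNIV (G0 y)" unfolding G0_def by (intro continuous_intros)
    show "norm (G0 y t) \<le> norm y0 + 2 * T * M + 2 * T * M" for t
      unfolding G0_def using intM[OF cl[of t], of y] intM[of t0 y] ab'
      by (intro order_trans[OF norm_triangle_ineq4] add_mono order_trans[OF norm_triangle_ineq]) auto
  qed
  define G where "G = (\<lambda>y. Bcontfun (G0 y))"
  have G: "apply_bcontfun (G y) = G0 y" for y
    unfolding G_def by (rule Bcontfun_inverse[OF G0])
  have contraction: "dist (G x) (G y) \<le> 1 / 2 * dist x y" for x y
  proof (rule dist_bound)
    fix t
    have D: "norm (integral {a..v} (\<lambda>s. h (apply_bcontfun x s)) - integral {a..v} (\<lambda>s. h (apply_bcontfun y s)))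
        \<le> 1 / 4 * dist x y" if v: "v \<in> {a..b}" for v
    proof -
      have "norm (integral {a..v} (\<lambda>s. h (apply_bcontfun x s) - h (apply_bcontfun y s))) \<le> (L * dist x y) * (v - a)"
      proof (rule integral_bound)
        show "norm (h (apply_bcontfun x s) - h (apply_bcontfun y s)) \<le> L * dist x y" for s
        proof -
          have "norm (h (apply_bcontfun x s) - h (apply_bcontfun y s)) \<le> L * dist (apply_bcontfun x s) (apply_bcontfun y s)"
            unfolding dist_norm by (rule lip)
          also have "\<dots> \<le> L * dist x y" using L by (intro mult_left_mono dist_bounded) auto
          finally show ?thesis .
        qed
      qed (use v in \<open>auto intro!: continuous_intros h_comp\<close>)
      also have "\<dots> \<le> (L * dist x y) * (2 * T)"
        using v ab' L by (intro mult_left_mono) auto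
      also have "\<dots> \<le> 1 / 4 * dist x y"
        using mult_right_mono[OF T(2), of "2 * dist x y"] by (simp add: mult_ac)
      finally show ?thesis by (simp add: integral_diff[OF hint hint])
    qed
    have "dist (apply_bcontfun (G x) t) (apply_bcontfun (G y) t) \<le> 1 / 4 * dist x y + 1 / 4 * dist x y"
    proof -
      have "apply_bcontfun (G x) t - apply_bcontfun (G y) t
        = (integral {a..cl t} (\<lambda>s. h (apply_bcontfun x s)) - integral {a..cl t} (\<lambda>s. h (apply_bcontfun y s)))
        - (integral {a..t0} (\<lambda>s. h (apply_bcontfun x s)) - integral {a..t0} (\<lambda>s. h (apply_bcontfun y s)))"
        by (simp add: G G0_def)
      then have "dist (apply_bcontfun (G x) t) (apply_bcontfun (G y) t) \<le>
          norm (integral {a..cl t} (\<lambda>s. h (apply_bcontfun x s)) - integral {a..cl t} (\<lambda>s. h (apply_bcontfun y s)))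
        + norm (integral {a..t0} (\<lambda>s. h (apply_bcontfun x s)) - integral {a..t0} (\<lambda>s. h (apply_bcontfun y s)))"
        unfolding dist_norm[of "apply_bcontfun (G x) t"] by (simp only: norm_triangle_ineq4)
      also have "\<dots> \<le> 1 / 4 * dist x y + 1 / 4 * dist x y"
        using ab' by (intro add_mono D cl) auto
      finally show ?thesis .
    qed
    then show "dist (apply_bcontfun (G x) t) (apply_bcontfun (G y) t) \<le> 1 / 2 * dist x y" by simp
  qed
  have "\<exists>!y. G y = y"
    by (rule banach_fix_type[of "1 / 2"]) (use contraction in auto)
  then obtain Y where Y: "G Y = Y" by blast
  define y where "y = apply_bcontfun Y"
  have y_eq: "y t = y0 + integral {a..t} (\<lambda>s. h (y s)) - integral {a..t0} (\<lambda>s. h (y s))" if "t \<in> {a..b}" for t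
  proof -
    have "y t = G0 Y t" unfolding y_def by (metis G Y)
    moreover have "cl t = t" using that by (auto simp: cl_def)
    ultimately show ?thesis by (simp add: G0_def y_def)
  qed
  have y_t0: "y t0 = y0" using y_eq[of t0] ab' by simp
  have deriv_h: "(y has_vector_derivative h (y t)) (at t)" if t: "t \<in> {a<..<b}" for t
  proof -
    have "((\<lambda>u. integral {a..u} (\<lambda>s. h (y s))) has_vector_derivative h (y t)) (at t within {a..b})"
      unfolding y_def using t by (intro integral_has_vector_derivative h_comp) auto
    then have "((\<lambda>u. integral {a..u} (\<lambda>s. h (y s))) has_vector_derivative h (y t)) (at t)"
      using at_within_interior[of t "{a..b}"] t by simp
    then have "((\<lambda>u. y0 + integral {a..u} (\<lambda>s. h (y s)) - integral {a..t0} (\<lambda>s. h (y s)))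
        has_vector_derivative h (y t)) (at t)"
      by (auto intro!: derivative_eq_intros)
    then show ?thesis
      by (rule has_vector_derivative_transform_within_open[of _ _ _ "{a<..<b}"]) (use t y_eq in auto)
  qed
  have in_ball: "y t \<in> cball y0 r" if t: "t \<in> {a<..<b}" for t
  proof -
    have "norm (y t - y t0) \<le> M * norm (t - t0)"
    proof (rule differentiable_bound[of "{a<..<b}"])
      fix s assume "s \<in> {a<..<b}"
      then show "(y has_derivative (\<lambda>x. x *\<^sub>R h (y s))) (at s within {a<..<b})"
        using deriv_h has_derivative_at_withinI unfolding has_vector_derivative_def by blast
      show "onorm (\<lambda>x. x *\<^sub>R h (y s)) \<le> M"
        by (rule onorm_scaleR_le[OF M])
    qed (use t T ab in auto)
    also have "\<dots> \<le> M * T" using t M0 ab by (intro mult_left_mono) auto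
    also have "\<dots> \<le> r" using T by (simp add: mult.commute)
    finally show ?thesis by (simp add: y_t0 dist_norm norm_minus_commute)
  qed
  have "y t \<in> U \<and> (y has_vector_derivative f (y t)) (at t)" if t: "t \<in> {t0 - T<..<t0 + T}" for t
  proof -
    have "P (y t) = y t" unfolding P_def by (rule closest_point_self[OF in_ball]) (use t ab in auto)
    then show ?thesis using deriv_h[of t] in_ball[of t] r(2) t by (auto simp: h_def ab)
  qed
  with T(1) y_t0 that show thesis by blast
qed

text \<open>
  The set of times at which two solutions agree is closed; it is open because on a short interval the
  maximal distance \<open>B\<close> of the solutions satisfies \<open>B \<le> B / 2\<close>.
\<close>

theorem ode_unique:
  fixes f :: "'a::euclidean_space \<Rightarrow> 'a"
  assumes lip: "locally_lipschitz U f" and S: "open S" "connected S" "t0 \<in> S"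
    and x: "\<And>t. t \<in> S \<Longrightarrow> x t \<in> U \<and> (x has_vector_derivative f (x t)) (at t)"
    and y: "\<And>t. t \<in> S \<Longrightarrow> y t \<in> U \<and> (y has_vector_derivative f (y t)) (at t)"
    and eq: "x t0 = y t0" and t: "t \<in> S"
  shows "x t = y t"
proof -
  define E where "E = {t \<in> S. x t - y t = 0}"
  have xc: "continuous_on S x" and yc: "continuous_on S y"
    using x y by (auto intro!: continuous_at_imp_continuous_on dest: has_vector_derivative_continuous)
  have "closedin (top_of_set S) E"
    unfolding E_def by (intro continuous_closedin_preimage_constant continuous_intros xc yc)
  moreover have "open E"
    unfolding open_contains_ball
  proof
    fix t1 assume "t1 \<in> E"
    then have t1: "t1 \<in> S" "x t1 = y t1" by (auto simp: E_def)
    obtain r L where r: "r > 0" "\<And>u v. u \<in> cball (x t1) r \<Longrightarrow> v \<in> cball (x t1) r \<Longrightarrow> norm (f u - f v) \<le> L * norm (u - v)"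
      using lip x[OF t1(1)] unfolding locally_lipschitz_def by meson
    have "isCont x t1" "isCont y t1"
      using x y t1(1) has_vector_derivative_continuous by blast+
    then have "\<exists>d>0. \<forall>t. dist t t1 < d \<longrightarrow> dist (x t) (x t1) < r"
      "\<exists>d>0. \<forall>t. dist t t1 < d \<longrightarrow> dist (y t) (y t1) < r"
      using r(1) unfolding continuous_at_eps_delta by auto
    then obtain d1 d2 where d: "d1 > 0" "\<And>t. dist t t1 < d1 \<Longrightarrow> dist (x t) (x t1) < r"
       "d2 > 0" "\<And>t. dist t t1 < d2 \<Longrightarrow> dist (y t) (y t1) < r"
      by auto
    obtain d3 where d3: "d3 > 0" "ball t1 d3 \<subseteq> S" using S(1) t1(1) open_contains_ball by blast
    define e where "e = min (min (d1 / 2) (d2 / 2)) (min (d3 / 2) (1 / (2 * (\<bar>L\<bar> + 1))))"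
    have e: "e > 0" "e < d1" "e < d2" "e < d3" "e * (2 * (\<bar>L\<bar> + 1)) \<le> 1"
    proof -
      show "e > 0" "e < d1" "e < d2" "e < d3" using d d3 by (auto simp: e_def)
      have "e \<le> 1 / (2 * (\<bar>L\<bar> + 1))" by (simp add: e_def)
      then show "e * (2 * (\<bar>L\<bar> + 1)) \<le> 1" by (subst (asm) pos_le_divide_eq) auto
    qed
    define J where "J = cball t1 e"
    have J: "s \<in> S" "x s \<in> cball (x t1) r" "y s \<in> cball (x t1) r" if "s \<in> J" for s
      using that e d(2)[of s] d(4)[of s] d3(2) t1(2) unfolding J_def
      by (auto simp: dist_commute less_imp_le subset_iff)
    have JS: "J \<subseteq> S" using J by blast
    obtain \<tau> where \<tau>: "\<tau> \<in> J" "\<And>s. s \<in> J \<Longrightarrow> norm (x s - y s) \<le> norm (x \<tau> - y \<tau>)"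
    proof -
      have "continuous_on J (\<lambda>s. norm (x s - y s))"
        by (intro continuous_intros continuous_on_subset[OF xc JS] continuous_on_subset[OF yc JS])
      moreover have "compact J" "J \<noteq> {}" using e by (auto simp: J_def)
      ultimately show thesis using continuous_attains_sup that by meson
    qed
    let ?B = "norm (x \<tau> - y \<tau>)"
    have "norm ((x \<tau> - y \<tau>) - (x t1 - y t1)) \<le> (\<bar>L\<bar> * ?B) * norm (\<tau> - t1)"
    proof (rule differentiable_bound[of J])
      fix s assume s: "s \<in> J"
      have "((\<lambda>s. x s - y s) has_vector_derivative f (x s) - f (y s)) (at s)"
        using x y J(1)[OF s] by (intro has_vector_derivative_diff) auto
      then show "((\<lambda>s. x s - y s) has_derivative (\<lambda>h. h *\<^sub>R (f (x s) - f (y s)))) (at s within J)"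
        unfolding has_vector_derivative_def by (rule has_derivative_at_withinI)
      have "norm (f (x s) - f (y s)) \<le> L * norm (x s - y s)" by (rule r(2)[OF J(2,3)[OF s]])
      also have "\<dots> \<le> \<bar>L\<bar> * ?B" using \<tau>(2)[OF s] by (intro mult_mono) auto
      finally show "onorm (\<lambda>h. h *\<^sub>R (f (x s) - f (y s))) \<le> \<bar>L\<bar> * ?B"
        by (intro onorm_scaleR_le) simp
    qed (use \<tau> e in \<open>auto simp: J_def\<close>)
    also have "\<dots> \<le> (\<bar>L\<bar> * ?B) * e"
      using \<tau>(1) by (intro mult_left_mono) (auto simp: J_def dist_norm norm_minus_commute)
    also have "\<dots> \<le> ?B / 2"
    proof -
      have "0 \<le> e * ?B" using e(1) by simp
      then show ?thesis
        using mult_right_mono[OF e(5), of ?B] by (simp add: algebra_simps)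
    qed
    finally have "?B = 0" using t1(2) by simp
    then have "J \<subseteq> E" using \<tau>(2) J(1) unfolding E_def by fastforce
    then show "\<exists>e>0. ball t1 e \<subseteq> E" using e(1) ball_subset_cball unfolding J_def by blast
  qed
  then have "openin (top_of_set S) E" by (intro open_subset) (auto simp: E_def)
  ultimately have "E = {} \<or> E = S" using S(2) connected_clopen by blast
  moreover have "t0 \<in> E" using eq S(3) by (simp add: E_def)
  ultimately show ?thesis using t by (auto simp: E_def)
qed

section \<open>The equations on the space of jets\<close>

text \<open>
  With \<open>f\<^sub>i\<close> the derivatives of \<open>F\<close> and \<open>a\<^sub>i\<close> those of \<open>C\<close> divided by \<open>C\<close>, the numbers \<open>sc0\<close> and \<open>sc1\<close> are
  \<open>C s\<close> and \<open>C s'\<close>, and \<open>sc2\<close> is the part of \<open>C s''\<close> without the fourth derivatives.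
\<close>

definition sc0 :: "real \<Rightarrow> real \<Rightarrow> real \<Rightarrow> real \<Rightarrow> real \<Rightarrow> real" where
  "sc0 f0 f1 f2 a1 a2 = 8 - 2 * f0 - 4 * f2 - 12 * f0 * a2 - 12 * f1 * a1 + 6 * f0 * a1\<^sup>2"

definition sc1 :: "real \<Rightarrow> real \<Rightarrow> real \<Rightarrow> real \<Rightarrow> real \<Rightarrow> real \<Rightarrow> real \<Rightarrow> real" where
  "sc1 f0 f1 f2 f3 a1 a2 a3 = 2 * f0 * a1 + 36 * f0 * a1 * a2 - 18 * f0 * a1 ^ 3 - 2 * f1 - 24 * f1 * a2
     + 30 * f1 * a1\<^sup>2 - 8 * f2 * a1 - 8 * a1 - 12 * f0 * a3 - 4 * f3"

definition sc2 :: "real \<Rightarrow> real \<Rightarrow> real \<Rightarrow> real \<Rightarrow> real \<Rightarrow> real \<Rightarrow> real \<Rightarrow> real" where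
  "sc2 f0 f1 f2 f3 a1 a2 a3 = 2 * f0 * a2 - 4 * f0 * a1\<^sup>2 + 60 * f0 * a1 * a3 + 36 * f0 * a2\<^sup>2
     - 162 * f0 * a1\<^sup>2 * a2 + 72 * f0 * a1 ^ 4 + 4 * f1 * a1 - 36 * f1 * a3 + 144 * f1 * a1 * a2
     - 108 * f1 * a1 ^ 3 - 2 * f2 - 32 * f2 * a2 + 46 * f2 * a1\<^sup>2 - 4 * f3 * a1 - 8 * a2 + 16 * a1\<^sup>2"

text \<open>
  The energy \<open>K\<close> with \<open>n\<^sub>1 = C s'\<close> as a variable in place of the third derivative of \<open>C\<close>. Then the third derivative of \<open>F\<close>
  occurs only in the term \<open>- 2 F' F'''\<close>, which is left out here.
\<close>

definition jK_rest :: "real \<Rightarrow> real \<Rightarrow> real \<Rightarrow> real \<Rightarrow> real \<Rightarrow> real \<Rightarrow> real \<Rightarrow> real" where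
  "jK_rest t f0 f1 f2 a1 a2 n1 = f2\<^sup>2 + 5 * f1\<^sup>2 - 4 * (f0 - 1)\<^sup>2 + 3 * t * ((3 * f0 * a1 + f1) / 2 * n1
     + sc0 f0 f1 f2 a1 a2 * (f0 / 8 - 3 / 4 * f0 * a2 + 9 / 8 * f0 * a1\<^sup>2 - f1 * a1 / 4 - f2 / 4 - 1 / 2))"

text \<open>
  The value of the fourth derivative of \<open>F\<close> prescribed by \<open>e\<^sub>1 + N = 0\<close>.
\<close>

definition f4_of :: "real \<Rightarrow> real \<Rightarrow> real \<Rightarrow> real \<Rightarrow> real \<Rightarrow> real \<Rightarrow> real \<Rightarrow> real" where
  "f4_of t f0 f1 f2 a1 a2 n1 = 5 * f2 - 4 * f0 + 4
     - 3 * t / 8 * (2 * (2 * a1 + f1 / f0) * n1 - sc0 f0 f1 f2 a1 a2 * (1 + 2 * a2 - 3 * a1\<^sup>2))"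

text \<open>
  The value of \<open>C'''' / C\<close> prescribed by the harmonicity of the scalar curvature.
\<close>

definition a4_of :: "real \<Rightarrow> real \<Rightarrow> real \<Rightarrow> real \<Rightarrow> real \<Rightarrow> real \<Rightarrow> real \<Rightarrow> real \<Rightarrow> real" where
  "a4_of t f0 f1 f2 f3 a1 a2 a3 = (let n1 = sc1 f0 f1 f2 f3 a1 a2 a3 in
     (sc2 f0 f1 f2 f3 a1 a2 a3 - 4 * f4_of t f0 f1 f2 a1 a2 n1 + (a1 + f1 / f0) * n1) / (12 * f0))"

abbreviation jF0 :: "jets \<Rightarrow> real" where "jF0 x \<equiv> fst (fst x)"
abbreviation jF1 :: "jets \<Rightarrow> real" where "jF1 x \<equiv> fst (snd (fst x))"
abbreviation jF2 :: "jets \<Rightarrow> real" where "jF2 x \<equiv> fst (snd (snd (fst x)))"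
abbreviation jF3 :: "jets \<Rightarrow> real" where "jF3 x \<equiv> snd (snd (snd (fst x)))"
abbreviation jC0 :: "jets \<Rightarrow> real" where "jC0 x \<equiv> fst (snd x)"
abbreviation jC1 :: "jets \<Rightarrow> real" where "jC1 x \<equiv> fst (snd (snd x))"
abbreviation jC2 :: "jets \<Rightarrow> real" where "jC2 x \<equiv> fst (snd (snd (snd x)))"
abbreviation jC3 :: "jets \<Rightarrow> real" where "jC3 x \<equiv> snd (snd (snd (snd x)))"

definition jn1 :: "jets \<Rightarrow> real" where
  "jn1 x = sc1 (jF0 x) (jF1 x) (jF2 x) (jF3 x) (jC1 x / jC0 x) (jC2 x / jC0 x) (jC3 x / jC0 x)"

definition jK :: "real \<Rightarrow> jets \<Rightarrow> real" where
  "jK t x = jK_rest t (jF0 x) (jF1 x) (jF2 x) (jC1 x / jC0 x) (jC2 x / jC0 x) (jn1 x) - 2 * jF1 x * jF3 x"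

definition jf4 :: "real \<Rightarrow> jets \<Rightarrow> real" where
  "jf4 t x = f4_of t (jF0 x) (jF1 x) (jF2 x) (jC1 x / jC0 x) (jC2 x / jC0 x) (jn1 x)"

definition jc4 :: "real \<Rightarrow> jets \<Rightarrow> real" where
  "jc4 t x = jC0 x * a4_of t (jF0 x) (jF1 x) (jF2 x) (jF3 x) (jC1 x / jC0 x) (jC2 x / jC0 x) (jC3 x / jC0 x)"

text \<open>
  The vector field on jets whose integral curves are the jets of solutions, apart from the constraint \<open>K = 0\<close>.
\<close>

definition jX :: "real \<Rightarrow> jets \<Rightarrow> jets" where
  "jX t x = ((jF1 x, jF2 x, jF3 x, jf4 t x), (jC1 x, jC2 x, jC3 x, jc4 t x))"

definition jU :: "jets set" where "jU = {x. jF0 x > 0 \<and> jC0 x > 0}"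

lemma open_jU: "open jU"
  unfolding jU_def by (intro open_Collect_conj open_Collect_less continuous_intros)

lemmas j_defs = jX_def jf4_def jc4_def jn1_def jK_def f4_of_def a4_of_def sc0_def sc1_def sc2_def jK_rest_def Let_def

lemma C1_jX: "C1 jU (jX t)"
  unfolding j_defs
  by (intro C1_intros open_jU) (auto simp: jU_def)

lemma data_unfold: "data F C z = ((F z, deriv F z, deriv (deriv F) z, deriv (deriv (deriv F)) z),
    (C z, deriv C z, deriv (deriv C) z, deriv (deriv (deriv C)) z))"
  by (simp add: data_def jet3_def eval_nat_numeral)

context u2 begin

lemma data_in_jU: "z \<in> I \<Longrightarrow> data F C z \<in> jU"
  using pos by (simp add: data_unfold jU_def)

lemma data_has_derivative:
  assumes z: "z \<in> I"
  shows "(data F C has_vector_derivative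
    ((deriv F z, deriv (deriv F) z, deriv (deriv (deriv F)) z, deriv (deriv (deriv (deriv F))) z),
     (deriv C z, deriv (deriv C) z, deriv (deriv (deriv C)) z, deriv (deriv (deriv (deriv C))) z))) (at z)"
  unfolding data_unfold
  by (intro has_vector_derivative_Pair deriv_FC[THEN has_real_derivative_iff_has_vector_derivative[THEN iffD1]] z)

lemma scal_jets:
  assumes z: "z \<in> I"
  defines "a1 \<equiv> deriv C z / C z" and "a2 \<equiv> deriv (deriv C) z / C z" and "a3 \<equiv> deriv (deriv (deriv C)) z / C z"
    and "a4 \<equiv> deriv (deriv (deriv (deriv C))) z / C z"
  shows "u2_scal F C z = sc0 (F z) (deriv F z) (deriv (deriv F) z) a1 a2 / C z"
    and "deriv (u2_scal F C) z = sc1 (F z) (deriv F z) (deriv (deriv F) z) (deriv (deriv (deriv F)) z) a1 a2 a3 / C z"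
    and "deriv (deriv (u2_scal F C)) z =
      (sc2 (F z) (deriv F z) (deriv (deriv F) z) (deriv (deriv (deriv F)) z) a1 a2 a3
       - 12 * F z * a4 - 4 * deriv (deriv (deriv (deriv F))) z) / C z"
proof -
  define A1 A2 A3 A4 where A: "A1 = (\<lambda>z. deriv C z / C z)" "A2 = (\<lambda>z. deriv (deriv C) z / C z)"
    "A3 = (\<lambda>z. deriv (deriv (deriv C)) z / C z)" "A4 = (\<lambda>z. deriv (deriv (deriv (deriv C))) z / C z)"
  have dA: "(A1 has_real_derivative A2 w - (A1 w)\<^sup>2) (at w)"
     "(A2 has_real_derivative A3 w - A1 w * A2 w) (at w)"
     "(A3 has_real_derivative A4 w - A1 w * A3 w) (at w)" if w: "w \<in> I" for w
    unfolding A using nonzero[OF w]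
    by (auto intro!: derivative_eq_intros deriv_FC w simp: field_simps power2_eq_square)
  define n where "n = (\<lambda>z. sc0 (F z) (deriv F z) (deriv (deriv F) z) (A1 z) (A2 z))"
  define n1 where "n1 = (\<lambda>z. sc1 (F z) (deriv F z) (deriv (deriv F) z) (deriv (deriv (deriv F)) z) (A1 z) (A2 z) (A3 z))"
  define n2 where "n2 = (\<lambda>z. sc2 (F z) (deriv F z) (deriv (deriv F) z) (deriv (deriv (deriv F)) z) (A1 z) (A2 z) (A3 z)
       - 12 * F z * A4 z - 4 * deriv (deriv (deriv (deriv F))) z)"
  have s: "u2_scal F C w = n w / C w" if w: "w \<in> I" for w
    unfolding u2_scal_def n_def sc0_def A Let_def using nonzero[OF w]
    by (simp add: field_simps power2_eq_square)
  have quot: "((\<lambda>w. m w / C w) has_real_derivative (m' - m w * A1 w) / C w) (at w)"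
    if w: "w \<in> I" and m: "(m has_real_derivative m') (at w)" for w m m'
    using DERIV_divide[OF m deriv_FC(2)[OF w]] nonzero[OF w]
    by (simp add: A diff_divide_distrib)
  have dn: "(n has_real_derivative n1 w + n w * A1 w) (at w)" if w: "w \<in> I" for w
    unfolding n_def n1_def sc0_def sc1_def
    by (auto intro!: derivative_eq_intros deriv_FC dA w simp: algebra_simps power2_eq_square power3_eq_cube)
  have dn1: "(n1 has_real_derivative n2 w + n1 w * A1 w) (at w)" if w: "w \<in> I" for w
    unfolding n1_def n2_def sc1_def sc2_def
    by (auto intro!: derivative_eq_intros deriv_FC dA w simp: algebra_simps eval_nat_numeral)
  have s1: "(u2_scal F C has_real_derivative n1 w / C w) (at w)" if w: "w \<in> I" for w
    using has_real_derivative_cong_open[OF quot[OF w dn[OF w]] open_I w s[symmetric]] by simp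
  have s2: "(deriv (u2_scal F C) has_real_derivative n2 w / C w) (at w)" if w: "w \<in> I" for w
    using has_real_derivative_cong_open[OF quot[OF w dn1[OF w]] open_I w DERIV_imp_deriv[OF s1, symmetric]] by simp
  show "u2_scal F C z = sc0 (F z) (deriv F z) (deriv (deriv F) z) a1 a2 / C z"
    using s[OF z] by (simp add: n_def A a1_def a2_def)
  show "deriv (u2_scal F C) z = sc1 (F z) (deriv F z) (deriv (deriv F) z) (deriv (deriv (deriv F)) z) a1 a2 a3 / C z"
    using DERIV_imp_deriv[OF s1[OF z]] by (simp add: n1_def A a1_def a2_def a3_def)
  show "deriv (deriv (u2_scal F C)) z =
      (sc2 (F z) (deriv F z) (deriv (deriv F) z) (deriv (deriv (deriv F)) z) a1 a2 a3
       - 12 * F z * a4 - 4 * deriv (deriv (deriv (deriv F))) z) / C z"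
    using DERIV_imp_deriv[OF s2[OF z]] by (simp add: n2_def A a1_def a2_def a3_def a4_def)
qed

lemma deriv_scal_data:
  assumes z: "z \<in> I"
  shows "deriv (u2_scal F C) z = jn1 (data F C z) / C z"
  using scal_jets(2)[OF z] by (simp add: jn1_def data_unfold)

lemma u2_K_data:
  assumes z: "z \<in> I"
  shows "u2_K t F C z = jK t (data F C z)"
  unfolding u2_K_def deriv_scal_data[OF z] jK_def jK_rest_def scal_jets(1)[OF z] u2_rho_def u2_e0_def
  using nonzero[OF z] by (simp add: data_unfold) (simp add: field_simps power2_eq_square)

text \<open>
  The equation \<open>e\<^sub>1 + N = 0\<close> gives the fourth derivative of \<open>F\<close>. Once this is substituted into \<open>w = 0\<close>, the latter gives the
  fourth derivative of \<open>C\<close>, whose coefficient \<open>- 12 F\<close> does not vanish.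
\<close>

lemma equations_data:
  assumes z: "z \<in> I"
  shows "u2_w F C z = 0 \<and> u2_e1 F z + u2_N t F C z = 0 \<longleftrightarrow>
     deriv (deriv (deriv (deriv F))) z = jf4 t (data F C z) \<and>
     deriv (deriv (deriv (deriv C))) z = jc4 t (data F C z)"
proof -
  define f0 f1 f2 f3 f4 a1 a2 a3 a4 n n1 where v: "f0 = F z" "f1 = deriv F z" "f2 = deriv (deriv F) z"
    "f3 = deriv (deriv (deriv F)) z" "f4 = deriv (deriv (deriv (deriv F))) z"
    "a1 = deriv C z / C z" "a2 = deriv (deriv C) z / C z"
    "a3 = deriv (deriv (deriv C)) z / C z" "a4 = deriv (deriv (deriv (deriv C))) z / C z"
    "n = sc0 f0 f1 f2 a1 a2" "n1 = sc1 f0 f1 f2 f3 a1 a2 a3"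
  note nz = nonzero[OF z]
  note sj = scal_jets[OF z, folded v(1-9), folded v(10,11)]
  have N: "u2_N t F C z = 3 * t / 8 * (2 * (2 * a1 + f1 / f0) * n1 - n * (1 + 2 * a2 - 3 * a1\<^sup>2))"
    unfolding u2_N_def sj v(1-9) using nz by (simp add: field_simps power2_eq_square)
  have f4: "jf4 t (data F C z) = f4_of t f0 f1 f2 a1 a2 n1" and n1: "jn1 (data F C z) = n1"
    by (simp_all add: jf4_def jn1_def data_unfold v)
  have e1: "u2_e1 F z + u2_N t F C z = f4 - jf4 t (data F C z)"
    unfolding N f4 u2_e1_def f4_of_def v(10)[symmetric] v(1-5)[symmetric] by simp
  have w: "u2_w F C z = (sc2 f0 f1 f2 f3 a1 a2 a3 - 12 * f0 * a4 - 4 * f4 + (a1 + f1 / f0) * n1) / C z"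
    unfolding u2_w_def sj v(6)[symmetric] v(1,2)[symmetric] by (simp add: add_divide_distrib)
  have c4: "jc4 t (data F C z) = C z * ((sc2 f0 f1 f2 f3 a1 a2 a3 - 4 * jf4 t (data F C z) + (a1 + f1 / f0) * n1) / (12 * f0))"
    unfolding jc4_def f4 by (simp add: a4_of_def Let_def data_unfold v)
  have "f0 \<noteq> 0" using nz v by simp
  have m1: "a4 = X / (12 * f0) \<longleftrightarrow> X - 12 * f0 * a4 = 0" for X
    using \<open>f0 \<noteq> 0\<close> by (auto simp: field_simps)
  have m2: "deriv (deriv (deriv (deriv C))) z = C z * Y \<longleftrightarrow> a4 = Y" for Y
    unfolding v using nz by (auto simp: field_simps)
  have "deriv (deriv (deriv (deriv C))) z = jc4 t (data F C z) \<longleftrightarrow>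
    (sc2 f0 f1 f2 f3 a1 a2 a3 - 4 * jf4 t (data F C z) + (a1 + f1 / f0) * n1) - 12 * f0 * a4 = 0"
    unfolding c4 m2 m1 ..
  then show ?thesis
    unfolding e1 w v(5)[symmetric] using nz by (auto simp: algebra_simps)
qed

lemma Bt_flat_iff_jets:
  assumes t: "t \<noteq> 0"
  shows "Bt_flat t I g \<longleftrightarrow> (\<forall>z\<in>I. (data F C has_vector_derivative jX t (data F C z)) (at z) \<and> jK t (data F C z) = 0)"
proof -
  have "(data F C has_vector_derivative jX t (data F C z)) (at z) \<longleftrightarrow>
     deriv (deriv (deriv (deriv F))) z = jf4 t (data F C z) \<and>
     deriv (deriv (deriv (deriv C))) z = jc4 t (data F C z)" (is "?L \<longleftrightarrow> ?R") if z: "z \<in> I" for z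
  proof
    assume ?L
    from vector_derivative_unique_at[OF this data_has_derivative[OF z]] show ?R
      by (simp add: jX_def data_unfold)
  next
    assume ?R
    then show ?L
      using data_has_derivative[OF z] by (simp add: jX_def) (simp add: data_unfold)
  qed
  then show ?thesis
    unfolding Bt_flat_iff[OF t] using equations_data u2_K_data by metis
qed

end

lemma u2_of_solution: "Bt_flat_solution t I F C \<Longrightarrow> u2 I F C"
  by (simp add: Bt_flat_solution_def u2_def open_interval_def)

lemma solution_jets:
  assumes "t \<noteq> 0" "Bt_flat_solution t I F C" "z \<in> I"
  shows "(data F C has_vector_derivative jX t (data F C z)) (at z)" "jK t (data F C z) = 0"
    "data F C z \<in> jU"
proof -
  interpret u2 I F C by (rule u2_of_solution[OF assms(2)])
  have "Bt_flat t I g" using assms(2) by (simp add: Bt_flat_solution_def)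
  then show "(data F C has_vector_derivative jX t (data F C z)) (at z)" "jK t (data F C z) = 0"
    using Bt_flat_iff_jets[OF assms(1)] assms(3) by blast+
  show "data F C z \<in> jU" by (rule data_in_jU[OF assms(3)])
qed

lemma solution_unique:
  assumes t: "t \<noteq> 0" and S: "Bt_flat_solution t I F C" "Bt_flat_solution t I' F' C'"
    and z0: "z0 \<in> I \<inter> I'" "data F C z0 = data F' C' z0" and z: "z \<in> I \<inter> I'"
  shows "data F C z = data F' C' z"
proof (rule ode_unique[where x = "data F C" and y = "data F' C'", OF C1_locally_lipschitz[OF C1_jX[of t]] _ _ z0(1) _ _ z0(2) z])
  have "is_interval (I \<inter> I')" "open (I \<inter> I')"
    using S by (auto simp: Bt_flat_solution_def open_interval_def is_interval_Int)
  then show "open (I \<inter> I')" "connected (I \<inter> I')" by (auto simp: is_interval_connected)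
qed (use solution_jets[OF t S(1)] solution_jets[OF t S(2)] in auto)

lemma csc_imp_solution: "csc_Bt_flat_solution t I F C \<Longrightarrow> Bt_flat_solution t I F C"
  by (simp add: csc_Bt_flat_solution_def)

lemma csc_jets:
  assumes "t \<noteq> 0" "csc_Bt_flat_solution t I F C" "z \<in> I"
  shows "jn1 (data F C z) = 0"
proof -
  interpret u2 I F C by (rule u2_of_solution[OF csc_imp_solution[OF assms(2)]])
  obtain s0 where s0: "\<And>p. p \<in> cyl I \<Longrightarrow> scal g p = s0"
    using assms(2) by (auto simp: csc_Bt_flat_solution_def csc_def)
  have s: "u2_scal F C w = s0" if "w \<in> I" for w
    using s0[OF point_over[OF that]] scal_entry[OF point_over[OF that]] by simp
  have "((\<lambda>_. s0) has_real_derivative 0) (at z)" by simp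
  from has_real_derivative_cong_open[OF this open_I assms(3) s[symmetric]]
  have "deriv (u2_scal F C) z = 0" by (rule DERIV_imp_deriv)
  then show ?thesis using deriv_scal_data[OF assms(3)] nonzero[OF assms(3)] by simp
qed

lemma has_derivs_minus: "has_derivs n I f \<Longrightarrow> has_derivs n I (\<lambda>z. - f z)"
  using has_derivs_mult[OF has_derivs_const[of n I "- 1"]] by simp

lemma has_derivs_diff: "has_derivs n I f \<Longrightarrow> has_derivs n I g \<Longrightarrow> has_derivs n I (\<lambda>z. f z - g z)"
  using has_derivs_add[OF _ has_derivs_minus] by fastforce

lemma has_derivs_divide: "has_derivs n I f \<Longrightarrow> has_derivs n I g \<Longrightarrow> (\<And>z. z \<in> I \<Longrightarrow> g z \<noteq> 0) \<Longrightarrow> has_derivs n I (\<lambda>z. f z / g z)"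
  unfolding divide_inverse by (intro has_derivs_mult has_derivs_inverse)

lemma has_derivs_power: "has_derivs n I f \<Longrightarrow> has_derivs n I (\<lambda>z. f z ^ m)"
  by (induction m) (auto intro: has_derivs_mult has_derivs_const)

lemmas has_derivs_intros = has_derivs_const has_derivs_add has_derivs_minus has_derivs_diff has_derivs_mult has_derivs_divide has_derivs_power

lemma zero_derivative_constant:
  fixes f :: "real \<Rightarrow> real"
  assumes "open I" "connected I" "\<And>z. z \<in> I \<Longrightarrow> (f has_real_derivative 0) (at z)" "x \<in> I" "y \<in> I"
  shows "f x = f y"
proof (rule has_derivative_zero_unique_connected[OF assms(1,2) _ assms(4,5)])
  fix z assume "z \<in> I"
  from assms(3)[OF this] show "(f has_derivative (\<lambda>h. 0)) (at z)"
    by (simp only: has_field_derivative_def lambda_zero)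
qed

text \<open>
  An integral curve of \<open>jX\<close> through the given jet is the jet of its components \<open>F\<close> and \<open>C\<close>. It solves
  the two equations of fourth order, hence \<open>K\<close> is constant and remains zero.
\<close>

theorem solution_exists:
  assumes t: "t \<noteq> 0" and x0: "x0 \<in> jU" "jK t x0 = 0"
  obtains I F C where "Bt_flat_solution t I F C" "z0 \<in> I" "data F C z0 = x0"
proof -
  obtain T y where T: "T > 0" and y0: "y z0 = x0"
    and y: "\<And>z. z \<in> {z0 - T<..<z0 + T} \<Longrightarrow> y z \<in> jU \<and> (y has_vector_derivative jX t (y z)) (at z)"
    using picard_lindeloef[OF C1_locally_lipschitz[OF C1_jX[of t]] x0(1)] by blast
  define I where "I = {z0 - T<..<z0 + T}"
  define F C where FC: "F = (\<lambda>z. jF0 (y z))" "C = (\<lambda>z. jC0 (y z))"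
  have I: "open I" "is_interval I" "z0 \<in> I" using T by (auto simp: I_def is_interval_oo)
  have yU: "y z \<in> jU" if "z \<in> I" for z using y that by (simp add: I_def)
  have nz: "jF0 (y z) \<noteq> 0" "jC0 (y z) \<noteq> 0" if "z \<in> I" for z
    using yU[OF that] by (auto simp: jU_def)
  have dy: "(y has_vector_derivative jX t (y z)) (at z)" if "z \<in> I" for z
    using y that by (simp add: I_def)
  have lin: "((\<lambda>z. l (y z)) has_real_derivative l (jX t (y z))) (at z)" if "z \<in> I" "bounded_linear l" for z l
    using bounded_linear.has_vector_derivative[OF that(2) dy[OF that(1)]]
    by (simp add: has_real_derivative_iff_has_vector_derivative)
  have bl: "bounded_linear jF0" "bounded_linear jF1" "bounded_linear jF2" "bounded_linear jF3"
     "bounded_linear jC0" "bounded_linear jC1" "bounded_linear jC2" "bounded_linear jC3"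
    by (intro bounded_linear_fst_comp bounded_linear_snd_comp bounded_linear_fst bounded_linear_snd)+
  have d: "((\<lambda>z. jF0 (y z)) has_real_derivative jF1 (y z)) (at z)"
    "((\<lambda>z. jF1 (y z)) has_real_derivative jF2 (y z)) (at z)"
    "((\<lambda>z. jF2 (y z)) has_real_derivative jF3 (y z)) (at z)"
    "((\<lambda>z. jF3 (y z)) has_real_derivative jf4 t (y z)) (at z)"
    "((\<lambda>z. jC0 (y z)) has_real_derivative jC1 (y z)) (at z)"
    "((\<lambda>z. jC1 (y z)) has_real_derivative jC2 (y z)) (at z)"
    "((\<lambda>z. jC2 (y z)) has_real_derivative jC3 (y z)) (at z)"
    "((\<lambda>z. jC3 (y z)) has_real_derivative jc4 t (y z)) (at z)" if "z \<in> I" for z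
    using bl[THEN lin[OF that]] by (simp_all add: jX_def)
  have has_derivs: "has_derivs n I (\<lambda>z. jF0 (y z)) \<and> has_derivs n I (\<lambda>z. jF1 (y z)) \<and> has_derivs n I (\<lambda>z. jF2 (y z)) \<and> has_derivs n I (\<lambda>z. jF3 (y z)) \<and>
     has_derivs n I (\<lambda>z. jC0 (y z)) \<and> has_derivs n I (\<lambda>z. jC1 (y z)) \<and> has_derivs n I (\<lambda>z. jC2 (y z)) \<and> has_derivs n I (\<lambda>z. jC3 (y z))" for n
  proof (induction n)
    case (Suc n)
    then have "has_derivs n I (\<lambda>z. jf4 t (y z))" "has_derivs n I (\<lambda>z. jc4 t (y z))"
      unfolding j_defs by (intro has_derivs_intros; simp add: nz)+
    with Suc show ?case
      by (intro conjI has_derivs_Suc_I[OF d(1)] has_derivs_Suc_I[OF d(2)] has_derivs_Suc_I[OF d(3)] has_derivs_Suc_I[OF d(4)]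
          has_derivs_Suc_I[OF d(5)] has_derivs_Suc_I[OF d(6)] has_derivs_Suc_I[OF d(7)] has_derivs_Suc_I[OF d(8)]) auto
  qed simp
  have smooth: "smooth_on I F" "smooth_on I C"
    unfolding smooth_on_iff_has_derivs[OF I(1)] FC using has_derivs by blast+
  interpret u2 I F C
    by unfold_locales (use I smooth yU in \<open>auto simp: FC jU_def\<close>)
  have next_d: "deriv g1 z = g2 z" if "\<And>w. w \<in> I \<Longrightarrow> g1 w = h w"
      "\<And>w. w \<in> I \<Longrightarrow> (h has_real_derivative g2 w) (at w)" "z \<in> I" for g1 g2 h :: "real \<Rightarrow> real" and z
    by (rule DERIV_imp_deriv, rule has_real_derivative_cong_open[OF that(2)[OF that(3)] I(1) that(3)])
       (simp add: that(1))
  have F1: "deriv F z = jF1 (y z)" if "z \<in> I" for z by (rule next_d[OF _ d(1) that]) (simp add: FC)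
  have F2: "deriv (deriv F) z = jF2 (y z)" if "z \<in> I" for z by (rule next_d[OF _ d(2) that]) (simp add: F1)
  have F3: "deriv (deriv (deriv F)) z = jF3 (y z)" if "z \<in> I" for z by (rule next_d[OF _ d(3) that]) (simp add: F2)
  have C1: "deriv C z = jC1 (y z)" if "z \<in> I" for z by (rule next_d[OF _ d(5) that]) (simp add: FC)
  have C2: "deriv (deriv C) z = jC2 (y z)" if "z \<in> I" for z by (rule next_d[OF _ d(6) that]) (simp add: C1)
  have C3: "deriv (deriv (deriv C)) z = jC3 (y z)" if "z \<in> I" for z by (rule next_d[OF _ d(7) that]) (simp add: C2)
  have FCz: "F z = jF0 (y z)" "C z = jC0 (y z)" for z by (simp_all add: FC)
  have data: "data F C z = y z" if "z \<in> I" for z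
    using that by (simp add: data_unfold F1 F2 F3 C1 C2 C3 FCz prod_eq_iff)
  have D: "(data F C has_vector_derivative jX t (data F C z)) (at z)" if z: "z \<in> I" for z
    by (rule has_vector_derivative_transform_within_open[OF _ I(1) z])
      (use dy[OF z] data z in auto)
  have K0: "jK t (data F C z) = 0" if z: "z \<in> I" for z
  proof -
    have eqs: "u2_w F C w = 0 \<and> u2_e1 F w + u2_N t F C w = 0" if w: "w \<in> I" for w
    proof -
      have "deriv (deriv (deriv (deriv F))) w = jf4 t (data F C w) \<and> deriv (deriv (deriv (deriv C))) w = jc4 t (data F C w)"
        using vector_derivative_unique_at[OF D[OF w] data_has_derivative[OF w]] by (simp add: jX_def)
      then show ?thesis using equations_data[OF w] by blast
    qed
    have "(u2_K t F C has_real_derivative 0) (at w)" if w: "w \<in> I" for w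
      using K_derivative[OF w, of t] eqs[OF w] by simp
    then have "u2_K t F C z = u2_K t F C z0"
      by (rule zero_derivative_constant[OF I(1) is_interval_connected[OF I(2)] _ z I(3)])
    then show ?thesis
      using u2_K_data[OF z] u2_K_data[OF I(3)] data[OF I(3)] y0 x0 by simp
  qed
  have "Bt_flat t I g" using Bt_flat_iff_jets[OF t] D K0 by blast
  then have "Bt_flat_solution t I F C"
    using I smooth pos by (auto simp: Bt_flat_solution_def open_interval_def)
  then show thesis using that I(3) data[OF I(3)] y0 by metis
qed

text \<open>
  Harmonicity of the scalar curvature \<open>s\<close> means that \<open>C F s'\<close> is constant, so \<open>s' = 0\<close> propagates from
  a single point.
\<close>

theorem csc_solution:
  assumes t: "t \<noteq> 0" and S: "Bt_flat_solution t I F C" "z0 \<in> I" "jn1 (data F C z0) = 0"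
  shows "csc_Bt_flat_solution t I F C"
proof -
  interpret u2 I F C by (rule u2_of_solution[OF S(1)])
  have I: "is_interval I" using S(1) by (simp add: Bt_flat_solution_def open_interval_def)
  have flat: "Bt_flat t I g" using S(1) by (simp add: Bt_flat_solution_def)
  let ?s1 = "deriv (u2_scal F C)"
  have "((\<lambda>z. C z * F z * ?s1 z) has_real_derivative 0) (at z)" if z: "z \<in> I" for z
  proof -
    have "u2_w F C z = 0" using Bt_flat_iff[OF t] flat z by blast
    then have s2: "deriv ?s1 z = - (deriv C z / C z + deriv F z / F z) * ?s1 z"
      unfolding u2_w_def by (simp only: mult_minus_left eq_neg_iff_add_eq_0)
    have ds: "(?s1 has_real_derivative deriv ?s1 z) (at z)"
      by (rule smooth_on_has_derivative[OF open_I smooth_on_deriv[OF smooth_scal] z])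
    have "((\<lambda>z. C z * F z * ?s1 z) has_real_derivative
      (deriv C z * F z + deriv F z * C z) * ?s1 z + deriv ?s1 z * (C z * F z)) (at z)"
      by (intro DERIV_mult deriv_FC z ds)
    moreover have "(deriv C z * F z + deriv F z * C z) * ?s1 z + deriv ?s1 z * (C z * F z) = 0"
      unfolding s2 using nonzero[OF z] by (simp add: field_simps)
    ultimately show ?thesis by simp
  qed
  then have "C z * F z * ?s1 z = C z0 * F z0 * ?s1 z0" if "z \<in> I" for z
    by (rule zero_derivative_constant[OF open_I is_interval_connected[OF I] _ that S(2)])
  then have s1: "?s1 z = 0" if "z \<in> I" for z
    using that deriv_scal_data[OF S(2)] S(3) nonzero[OF that] by auto
  have "(u2_scal F C has_real_derivative 0) (at z)" if "z \<in> I" for z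
    using smooth_on_has_derivative[OF open_I smooth_scal that] s1[OF that] by simp
  then have "u2_scal F C z = u2_scal F C z0" if "z \<in> I" for z
    by (rule zero_derivative_constant[OF open_I is_interval_connected[OF I] _ that S(2)])
  then have "csc I g"
    unfolding csc_def using scal_entry fst_in_I by metis
  with S(1) show ?thesis by (simp add: csc_Bt_flat_solution_def)
qed

section \<open>Charts and criteria for counting parameters\<close>

lemma exhaust_5: "x = 1 \<or> x = 2 \<or> x = 3 \<or> x = 4 \<or> x = (5::5)"
proof (induct x)
  case (of_int z)
  then have "z = 0 \<or> z = 1 \<or> z = 2 \<or> z = 3 \<or> z = 4" by fastforce
  then show ?case by auto
qed

lemma exhaust_7: "x = 1 \<or> x = 2 \<or> x = 3 \<or> x = 4 \<or> x = 5 \<or> x = 6 \<or> x = (7::7)"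
proof (induct x)
  case (of_int z)
  then have "z = 0 \<or> z = 1 \<or> z = 2 \<or> z = 3 \<or> z = 4 \<or> z = 5 \<or> z = 6" by fastforce
  then show ?case by auto
qed

text \<open>
  The value of the third derivative of \<open>F\<close> prescribed by \<open>K = 0\<close> where \<open>F' \<noteq> 0\<close>.
\<close>

definition f3_of :: "real \<Rightarrow> real \<Rightarrow> real \<Rightarrow> real \<Rightarrow> real \<Rightarrow> real \<Rightarrow> real \<Rightarrow> real" where
  "f3_of t f0 f1 f2 a1 a2 n1 = jK_rest t f0 f1 f2 a1 a2 n1 / (2 * f1)"

text \<open>
  Where \<open>F' \<noteq> 0\<close> the hypersurface \<open>K = 0\<close> is a graph over the seven variables \<open>F, F', F'', C, C', C''\<close> and
  \<open>n\<^sub>1 = C s'\<close>: the third derivative of \<open>F\<close> follows from \<open>K = 0\<close>, that of \<open>C\<close> from \<open>n\<^sub>1\<close>.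
\<close>

definition chart :: "real \<Rightarrow> real \<Rightarrow> real \<Rightarrow> real \<Rightarrow> real \<Rightarrow> real \<Rightarrow> real \<Rightarrow> real \<Rightarrow> jets" where
  "chart t f0 f1 f2 c0 c1 c2 n1 =
     (let f3 = f3_of t f0 f1 f2 (c1 / c0) (c2 / c0) n1 in
      ((f0, f1, f2, f3),
       (c0, c1, c2, c0 * ((sc1 f0 f1 f2 f3 (c1 / c0) (c2 / c0) 0 - n1) / (12 * f0)))))"

lemma sc1_linear: "sc1 f0 f1 f2 f3 a1 a2 a3 = sc1 f0 f1 f2 f3 a1 a2 0 - 12 * f0 * a3"
  by (simp add: sc1_def)

lemma jn1_chart: "f0 \<noteq> 0 \<Longrightarrow> c0 \<noteq> 0 \<Longrightarrow> jn1 (chart t f0 f1 f2 c0 c1 c2 n1) = n1"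
  by (simp add: chart_def jn1_def Let_def sc1_linear[of _ _ _ _ _ _ "_ / _"])

lemma jK_chart: "f0 \<noteq> 0 \<Longrightarrow> c0 \<noteq> 0 \<Longrightarrow> f1 \<noteq> 0 \<Longrightarrow> jK t (chart t f0 f1 f2 c0 c1 c2 n1) = 0"
  unfolding jK_def jn1_chart by (simp add: chart_def Let_def f3_of_def)

lemma eq_chart:
  assumes "jF0 x \<noteq> 0" "jC0 x \<noteq> 0" "jF1 x \<noteq> 0" "jK t x = 0"
  shows "x = chart t (jF0 x) (jF1 x) (jF2 x) (jC0 x) (jC1 x) (jC2 x) (jn1 x)"
proof -
  have f3: "jF3 x = f3_of t (jF0 x) (jF1 x) (jF2 x) (jC1 x / jC0 x) (jC2 x / jC0 x) (jn1 x)"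
    using assms by (simp add: f3_of_def jK_def field_simps)
  have "jn1 x = sc1 (jF0 x) (jF1 x) (jF2 x) (jF3 x) (jC1 x / jC0 x) (jC2 x / jC0 x) 0 - 12 * jF0 x * (jC3 x / jC0 x)"
    unfolding jn1_def by (rule sc1_linear)
  then have c3: "jC3 x = jC0 x * ((sc1 (jF0 x) (jF1 x) (jF2 x) (jF3 x) (jC1 x / jC0 x) (jC2 x / jC0 x) 0 - jn1 x) / (12 * jF0 x))"
    using assms by (simp add: field_simps)
  show ?thesis
    unfolding chart_def Let_def f3[symmetric] c3[symmetric] by simp
qed

lemma C1_chart:
  assumes "C1 U f0" "C1 U f1" "C1 U f2" "C1 U c0" "C1 U c1" "C1 U c2" "C1 U n1"
    "\<And>y. y \<in> U \<Longrightarrow> f0 y \<noteq> 0 \<and> f1 y \<noteq> 0 \<and> c0 y \<noteq> 0"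
  shows "C1 U (\<lambda>y. chart t (f0 y) (f1 y) (f2 y) (c0 y) (c1 y) (c2 y) (n1 y))"
  unfolding chart_def Let_def f3_of_def jK_rest_def sc0_def sc1_def
  by (intro C1_intros C1_open[OF assms(1)] assms(1-7)) (use assms(8) in auto)

lemma C1_jn1: "C1 jU jn1"
  unfolding jn1_def[abs_def] sc1_def
  by (intro C1_intros open_jU) (auto simp: jU_def)

text \<open>
  For the lower bound it suffices that every parameter is a continuously differentiable function of the
  value of the parametrisation, since then the parametrisation has a differentiable left inverse.
\<close>

lemma has_parametersI:
  fixes A :: "'a::euclidean_space set" and \<phi> :: "real^'n \<Rightarrow> 'a"
    and V :: "nat \<Rightarrow> (real^'n) set" and \<psi> :: "nat \<Rightarrow> real^'n \<Rightarrow> 'a"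
  assumes U: "C1 U \<phi>" "U \<noteq> {}" "\<phi> ` U \<subseteq> A"
    and inv: "\<And>i. \<exists>V l. C1 V l \<and> \<phi> ` U \<subseteq> V \<and> (\<forall>y\<in>U. l (\<phi> y) = y $ i)"
    and count: "inj_on \<phi> U \<Longrightarrow> (\<And>x. x \<in> U \<Longrightarrow> countable {y \<in> U. E (\<phi> x) (\<phi> y)})"
    and upper: "\<And>n::nat. C1 (V n) (\<psi> n)" "\<And>x. x \<in> A \<Longrightarrow> \<exists>n. \<exists>y\<in>V n. E x (\<psi> n y)"
  shows "has_parameters TYPE(real^'n) A E"
proof -
  obtain \<phi>' where \<phi>': "C1_map_on U \<phi> \<phi>'" using U(1) by (auto simp: C1_def)
  have inj: "inj_on \<phi> U"
  proof (rule inj_onI)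
    fix x y assume xy: "x \<in> U" "y \<in> U" "\<phi> x = \<phi> y"
    have "x $ i = y $ i" for i using inv[of i] xy by metis
    then show "x = y" by (simp add: vec_eq_iff)
  qed
  have inj': "inj (blinfun_apply (\<phi>' x))" if x: "x \<in> U" for x
  proof (rule injI)
    fix h k assume hk: "\<phi>' x h = \<phi>' x k"
    have "h $ i = k $ i" for i
    proof -
      obtain W l where l: "C1 W l" "\<phi> ` U \<subseteq> W" "\<And>y. y \<in> U \<Longrightarrow> l (\<phi> y) = y $ i"
        using inv[of i] by blast
      then obtain l' where l': "C1_map_on W l l'" by (auto simp: C1_def)
      have "(l has_derivative l' (\<phi> x)) (at (\<phi> x))" using l' l(2) x by (auto simp: C1_map_on_def)
      moreover have "(\<phi> has_derivative \<phi>' x) (at x)" and oU: "open U"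
        using \<phi>' x by (auto simp: C1_map_on_def)
      ultimately have "((\<lambda>y. l (\<phi> y)) has_derivative (\<lambda>h. l' (\<phi> x) (\<phi>' x h))) (at x)"
        using has_derivative_compose by blast
      then have "((\<lambda>y. y $ i) has_derivative (\<lambda>h. l' (\<phi> x) (\<phi>' x h))) (at x)"
        by (rule has_derivative_transform_within_open[OF _ oU x]) (use l(3) in auto)
      moreover have "((\<lambda>y. y $ i) has_derivative (\<lambda>h. h $ i)) (at x)"
        by (intro bounded_linear_imp_has_derivative bounded_linear_vec_nth)
      ultimately have "(\<lambda>h. h $ i) = (\<lambda>h. l' (\<phi> x) (\<phi>' x h))"
        by (rule has_derivative_unique[symmetric])
      then show ?thesis using hk by metis
    qed
    then show "h = k" by (simp add: vec_eq_iff)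
  qed
  obtain \<psi>' where "\<And>n. C1_map_on (V n) (\<psi> n) (\<psi>' n)"
    using upper(1) unfolding C1_def by metis
  then have up: "(\<forall>n. C1_map_on (V n) (\<psi> n) (\<psi>' n)) \<and> (\<forall>x\<in>A. \<exists>n. \<exists>y\<in>V n. E x (\<psi> n y))"
    using upper(2) by blast
  have low: "C1_map_on U \<phi> \<phi>' \<and> U \<noteq> {} \<and> inj_on \<phi> U \<and> (\<forall>x\<in>U. inj (blinfun_apply (\<phi>' x))) \<and>
      \<phi> ` U \<subseteq> A \<and> (\<forall>x\<in>U. countable {y \<in> U. E (\<phi> x) (\<phi> y)})"
    using \<phi>' U(2,3) inj inj' count[OF inj] by simp
  show ?thesis
    unfolding has_parameters_def
    by (rule conjI, rule exI[of _ U], rule exI[of _ \<phi>], rule exI[of _ \<phi>'], rule low,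
        rule exI[of _ V], rule exI[of _ \<psi>], rule exI[of _ \<psi>'], rule up)
qed

text \<open>
  Near a point where its derivative is not zero the values of a function fill an interval. So the countably many
  slices on which \<open>F\<close> has a given rational value meet all solutions with non-constant \<open>F\<close>.
\<close>

lemma exists_rational_value:
  fixes F :: "real \<Rightarrow> real"
  assumes "open S" "a \<in> S" "\<And>z. z \<in> S \<Longrightarrow> (F has_real_derivative F' z) (at z)" "continuous_on S F'" "F' a \<noteq> 0"
  shows "\<exists>b\<in>S. F b \<in> \<rat> \<and> F' b \<noteq> 0"
proof -
  have "isCont F' a" using assms continuous_on_eq_continuous_at by blast
  then obtain d where d: "d > 0" "\<And>z. dist a z < d \<Longrightarrow> F' z \<noteq> 0"
    using continuous_at_avoid[of a F' 0] assms(5) by blast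
  obtain e where e: "e > 0" "ball a e \<subseteq> S" using assms(1,2) open_contains_ball by blast
  define B where "B = ball a (min d e)"
  have B: "open B" "connected B" "a \<in> B" "B \<subseteq> S" "\<And>z. z \<in> B \<Longrightarrow> F' z \<noteq> 0"
    using d e by (auto simp: B_def)
  \<comment> \<open>Only non-constancy is needed: the image of the interval is connected and contains a rational number.\<close>
  have "\<exists>b\<in>B. F b \<noteq> F a"
  proof (rule ccontr)
    assume "\<not> ?thesis"
    then have const: "F a = F b" if "b \<in> B" for b using that by auto
    have "((\<lambda>_. F a) has_real_derivative 0) (at a)" by simp
    then have "(F has_real_derivative 0) (at a)"
      by (rule has_real_derivative_cong_open[OF _ B(1,3)]) (rule const)
    with assms(3)[OF assms(2)] assms(5) show False using DERIV_unique by blast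
  qed
  then obtain b where b: "b \<in> B" "F b \<noteq> F a" by blast
  have cont: "continuous_on B F"
    using assms(3) B(4) by (intro continuous_at_imp_continuous_on) (auto intro: DERIV_isCont)
  then have conn: "connected (F ` B)" using B(2) connected_continuous_image by blast
  obtain q where q: "q \<in> \<rat>" "min (F a) (F b) < q" "q < max (F a) (F b)"
  proof -
    have "min (F a) (F b) < max (F a) (F b)" using b(2) by (auto simp: min_def max_def)
    then show thesis using Rats_dense_in_real that by blast
  qed
  have "q \<in> F ` B"
    using connectedD_interval[OF conn, of "min (F a) (F b)" "max (F a) (F b)" q] q B(3) b(1)
    by (auto simp: min_def max_def split: if_splits)
  then show ?thesis using q(1) B by auto
qed

text \<open>
  Rational intervals separate the points of a discrete set.
\<close>

lemma countable_isolated_points: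
  fixes T :: "real set"
  assumes "\<And>a. a \<in> T \<Longrightarrow> \<exists>d>0. \<forall>b\<in>T. \<bar>b - a\<bar> < d \<longrightarrow> b = a"
  shows "countable T"
proof -
  have "\<forall>a\<in>T. \<exists>p\<in>\<rat>\<times>\<rat>. fst p < a \<and> a < snd p \<and> (\<forall>b\<in>T. fst p < b \<and> b < snd p \<longrightarrow> b = a)"
  proof
    fix a assume "a \<in> T"
    then obtain d where d: "d > 0" "\<And>b. b \<in> T \<Longrightarrow> \<bar>b - a\<bar> < d \<Longrightarrow> b = a" using assms by blast
    obtain p where p: "p \<in> \<rat>" "a - d < p" "p < a" using Rats_dense_in_real[of "a - d" a] d(1) by auto
    obtain q where q: "q \<in> \<rat>" "a < q" "q < a + d" using Rats_dense_in_real[of a "a + d"] d(1) by auto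
    show "\<exists>p\<in>\<rat>\<times>\<rat>. fst p < a \<and> a < snd p \<and> (\<forall>b\<in>T. fst p < b \<and> b < snd p \<longrightarrow> b = a)"
      using p q d(2) by (intro bexI[of _ "(p, q)"]) (auto simp: abs_less_iff)
  qed
  then obtain r where r: "\<And>a. a \<in> T \<Longrightarrow> r a \<in> \<rat> \<times> \<rat> \<and> fst (r a) < a \<and> a < snd (r a) \<and>
      (\<forall>b\<in>T. fst (r a) < b \<and> b < snd (r a) \<longrightarrow> b = a)"
    by metis
  have "inj_on r T" by (rule inj_onI) (metis r)
  moreover have "countable (r ` T)"
    by (rule countable_subset[OF _ countable_SIGMA[OF countable_rat countable_rat]]) (use r in blast)
  ultimately show ?thesis using countable_image_inj_on by blast
qed

section \<open>Dimension of the spaces of solutions\<close>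

lemma initial_data_eq:
  assumes t: "t \<noteq> 0"
  shows "initial_data (Bt_flat_solution t) z0 = {x \<in> jU. jK t x = 0}"
proof (intro set_eqI iffI)
  fix x assume "x \<in> initial_data (Bt_flat_solution t) z0"
  then show "x \<in> {x \<in> jU. jK t x = 0}" using solution_jets[OF t] by (auto simp: initial_data_def)
next
  fix x assume "x \<in> {x \<in> jU. jK t x = 0}"
  then obtain I F C where "Bt_flat_solution t I F C" "z0 \<in> I" "data F C z0 = x"
    using solution_exists[OF t, of x] by blast
  then show "x \<in> initial_data (Bt_flat_solution t) z0" unfolding initial_data_def by blast
qed

lemma csc_initial_data_eq:
  assumes t: "t \<noteq> 0"
  shows "initial_data (csc_Bt_flat_solution t) z0 = {x \<in> jU. jK t x = 0 \<and> jn1 x = 0}"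
proof (intro set_eqI iffI)
  fix x assume "x \<in> initial_data (csc_Bt_flat_solution t) z0"
  then obtain I F C where S: "csc_Bt_flat_solution t I F C" "z0 \<in> I" "x = data F C z0"
    by (auto simp: initial_data_def)
  then show "x \<in> {x \<in> jU. jK t x = 0 \<and> jn1 x = 0}"
    using solution_jets[OF t csc_imp_solution[OF S(1)] S(2)] csc_jets[OF t S(1,2)] by simp
next
  fix x assume "x \<in> {x \<in> jU. jK t x = 0 \<and> jn1 x = 0}"
  then obtain I F C where *: "Bt_flat_solution t I F C" "z0 \<in> I" "data F C z0 = x" "jn1 x = 0"
    using solution_exists[OF t, of x] by blast
  then have "csc_Bt_flat_solution t I F C" using csc_solution[OF t *(1,2)] by simp
  with * show "x \<in> initial_data (csc_Bt_flat_solution t) z0" unfolding initial_data_def by blast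
qed

lemma solutions_determined_by_data:
  assumes "t \<noteq> 0"
  shows "determined_by_data (Bt_flat_solution t) z0"
  unfolding determined_by_data_def
proof (intro allI impI ballI)
  fix I F C I' F' C' z
  assume *: "Bt_flat_solution t I F C \<and> Bt_flat_solution t I' F' C' \<and> z0 \<in> I \<inter> I' \<and> data F C z0 = data F' C' z0"
    and z: "z \<in> I \<inter> I'"
  then have "data F C z = data F' C' z" using solution_unique[OF assms] by blast
  then show "F z = F' z \<and> C z = C' z" by (simp add: data_unfold)
qed

definition scale_jets :: "real \<Rightarrow> jets \<Rightarrow> jets" where "scale_jets c x = (fst x, c *\<^sub>R snd x)"

lemma scale_jets_simps: "c \<noteq> 0 \<Longrightarrow> jn1 (scale_jets c x) = jn1 x" "c \<noteq> 0 \<Longrightarrow> jK t (scale_jets c x) = jK t x"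
  by (simp_all add: jn1_def jK_def scale_jets_def)

context u2 begin

lemma data_shift_scale:
  assumes z: "z + a \<in> I"
  shows "data (\<lambda>z. F (z + a)) (\<lambda>z. c * C (z + a)) z = scale_jets c (data F C (z + a))"
proof -
  have shift: "deriv (\<lambda>z. f (z + a)) = (\<lambda>z. deriv f (z + a))" for f :: "real \<Rightarrow> real"
  proof
    fix w
    have "deriv (\<lambda>h. f (w + a + h)) 0 = deriv f (w + a)" 
      by (subst (2) deriv_shift_0) (simp add: comp_def)
    moreover have "deriv (\<lambda>h. f (w + h + a)) 0 = deriv (\<lambda>z. f (z + a)) w"
      by (subst (2) deriv_shift_0) (simp add: comp_def)
    ultimately show "deriv (\<lambda>z. f (z + a)) w = deriv f (w + a)"
      by (simp add: ac_simps)
  qed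
  define J where "J = (\<lambda>w. w + a) -` I"
  have J: "open J" "z \<in> J" using z open_I unfolding J_def
    by (auto intro!: open_vimage continuous_intros)
  have step: "deriv (\<lambda>z. c * f (z + a)) w = c * deriv f (w + a)" if "smooth_on I f" "w \<in> J" for f w
  proof (rule DERIV_imp_deriv)
    have "(f has_real_derivative deriv f (w + a)) (at (w + a))"
      using smooth_on_has_derivative[OF open_I that(1)] that(2) by (simp add: J_def)
    then have "((\<lambda>z. f (z + a)) has_real_derivative deriv f (w + a)) (at w)"
      by (simp add: DERIV_shift)
    then show "((\<lambda>z. c * f (z + a)) has_real_derivative c * deriv f (w + a)) (at w)"
      by (rule DERIV_cmult)
  qed
  have cong: "deriv f w = deriv h w" if "\<And>w. w \<in> J \<Longrightarrow> f w = h w" "w \<in> J" for f h :: "real \<Rightarrow> real" and w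
    by (rule deriv_cong_ev) (use that J in \<open>auto simp: eventually_nhds intro!: exI[of _ J]\<close>)
  note C = smooth(2) smooth_derivs(4,5)
  have 1: "deriv (\<lambda>z. c * C (z + a)) w = c * deriv C (w + a)" if "w \<in> J" for w
    by (rule step[OF C(1) that])
  have 2: "deriv (deriv (\<lambda>z. c * C (z + a))) w = c * deriv (deriv C) (w + a)" if "w \<in> J" for w
    using cong[OF 1 that] step[OF C(2) that] by simp
  have 3: "deriv (deriv (deriv (\<lambda>z. c * C (z + a)))) w = c * deriv (deriv (deriv C)) (w + a)" if "w \<in> J" for w
    using cong[OF 2 that] step[OF C(3) that] by simp
  show ?thesis
    unfolding data_unfold scale_jets_def shift 1[OF J(2)] 2[OF J(2)] 3[OF J(2)] by simp
qed

end

lemma homothetic_iff: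
  assumes "t \<noteq> 0" and S: "\<forall>I F C. S I F C \<longrightarrow> Bt_flat_solution t I F C"
  shows "homothetic_data S z0 x y \<longleftrightarrow> (\<exists>I F C a c. S I F C \<and> z0 \<in> I \<and> z0 + a \<in> I \<and> c > 0 \<and>
        x = data F C z0 \<and> y = scale_jets c (data F C (z0 + a)))"
proof -
  have "data (\<lambda>z. F (z + a)) (\<lambda>z. c * C (z + a)) z0 = scale_jets c (data F C (z0 + a))"
    if "S I F C" "z0 + a \<in> I" for I F C a c
    by (rule u2.data_shift_scale[OF u2_of_solution[OF S[rule_format, OF that(1)]] that(2)])
  then show ?thesis unfolding homothetic_data_def by metis
qed

text \<open>
  The jets in the slice \<open>F = q\<close>, \<open>C = 1\<close> that are homothetic to a given jet \<open>x\<close> lie on the solution through \<open>x\<close>, at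
  translates \<open>a\<close> where \<open>F(z\<^sub>0 + a) = q\<close>. Since \<open>F' \<noteq> 0\<close> there, these \<open>a\<close> are isolated, and \<open>a\<close>
  determines the jet because the scaling constant follows from \<open>C = 1\<close>.
\<close>

lemma countable_homothetic:
  assumes t: "t \<noteq> 0" and S: "\<forall>I F C. S I F C \<longrightarrow> Bt_flat_solution t I F C"
    and inj: "inj_on \<phi> U"
    and slice: "\<And>y. y \<in> U \<Longrightarrow> jF0 (\<phi> y) = q \<and> jC0 (\<phi> y) = 1 \<and> jF1 (\<phi> y) \<noteq> 0"
  shows "countable {y \<in> U. homothetic_data S z0 x (\<phi> y)}"
proof -
  let ?Y = "{y \<in> U. homothetic_data S z0 x (\<phi> y)}"
  \<comment> \<open>A homothety is chosen for every element; the quintuples are only for the axiom of choice.\<close>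
  define R where "R y a I F C c \<longleftrightarrow> Bt_flat_solution t I F C \<and> z0 \<in> I \<and> z0 + a \<in> I \<and> c > 0 \<and>
        x = data F C z0 \<and> \<phi> y = scale_jets c (data F C (z0 + a))" for y a I F C c
  define Q where "Q y p = R y (fst p) (fst (snd p)) (fst (snd (snd p))) (fst (snd (snd (snd p))))
      (snd (snd (snd (snd p))))" for y p
  have "\<forall>y\<in>?Y. \<exists>p. Q y p"
  proof
    fix y assume "y \<in> ?Y"
    obtain I F C a c where "S I F C" "z0 \<in> I" "z0 + a \<in> I" "c > 0" "x = data F C z0"
        "\<phi> y = scale_jets c (data F C (z0 + a))"
      using \<open>y \<in> ?Y\<close> unfolding homothetic_iff[OF t S] by blast
    then show "\<exists>p. Q y p"
      using S by (intro exI[of _ "(a, I, F, C, c)"]) (simp add: R_def Q_def)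
  qed
  from bchoice[OF this] obtain p where p: "\<forall>y\<in>?Y. Q y (p y)" ..
  define a I F C c where "a = (\<lambda>y. fst (p y))" "I = (\<lambda>y. fst (snd (p y)))" "F = (\<lambda>y. fst (snd (snd (p y))))"
    "C = (\<lambda>y. fst (snd (snd (snd (p y)))))" "c = (\<lambda>y. snd (snd (snd (snd (p y)))))"
  then have R: "R y (a y) (I y) (F y) (C y) (c y)" if "y \<in> ?Y" for y
    using bspec[OF p that] by (simp add: Q_def)
  have val: "F y (z0 + a y) = q" "deriv (F y) (z0 + a y) \<noteq> 0" "c y * C y (z0 + a y) = 1" if y: "y \<in> ?Y" for y
  proof -
    have "\<phi> y = scale_jets (c y) (data (F y) (C y) (z0 + a y))" using R[OF y] by (simp add: R_def)
    then show "F y (z0 + a y) = q" "deriv (F y) (z0 + a y) \<noteq> 0" "c y * C y (z0 + a y) = 1"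
      using slice[of y] y by (auto simp: scale_jets_def data_unfold)
  qed
  have R': "Bt_flat_solution t (I y) (F y) (C y)" "z0 \<in> I y" "z0 + a y \<in> I y" "x = data (F y) (C y) z0"
    "\<phi> y = scale_jets (c y) (data (F y) (C y) (z0 + a y))" if "y \<in> ?Y" for y
    using R[OF that, unfolded R_def] by simp_all
  have agree: "data (F y) (C y) w = data (F y') (C y') w" if "y \<in> ?Y" "y' \<in> ?Y" "w \<in> I y" "w \<in> I y'" for y y' w
  proof (rule solution_unique[OF t R'(1)[OF that(1)] R'(1)[OF that(2)]])
    show "z0 \<in> I y \<inter> I y'" "w \<in> I y \<inter> I y'" using R'(2) that by simp_all
    show "data (F y) (C y) z0 = data (F y') (C y') z0" using R'(4)[OF that(1)] R'(4)[OF that(2)] by simp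
  qed
  have "inj_on a ?Y"
  proof (rule inj_onI)
    fix y y' assume y: "y \<in> ?Y" "y' \<in> ?Y" "a y = a y'"
    have "z0 + a y \<in> I y" "z0 + a y \<in> I y'" using R'(3)[OF y(1)] R'(3)[OF y(2)] y(3) by simp_all
    from agree[OF y(1,2) this] have d: "data (F y) (C y) (z0 + a y) = data (F y') (C y') (z0 + a y')"
      using y(3) by simp
    then have "C y (z0 + a y) = C y' (z0 + a y')" by (simp add: data_unfold)
    then have "(c y - c y') * C y (z0 + a y) = 0" "C y (z0 + a y) \<noteq> 0"
      using val(3)[OF y(1)] val(3)[OF y(2)] by (auto simp: algebra_simps)
    then have "c y = c y'" by simp
    then have "\<phi> y = \<phi> y'" using R'(5)[OF y(1)] R'(5)[OF y(2)] d by simp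
    then show "y = y'" using inj y by (auto dest: inj_onD)
  qed
  moreover have "countable (a ` ?Y)"
  proof (rule countable_isolated_points)
    fix b assume "b \<in> a ` ?Y"
    then obtain y where y: "y \<in> ?Y" "b = a y" by blast
    interpret u2 "I y" "F y" "C y"
      using R[OF y(1)] u2_of_solution by (auto simp: R_def)
    have bI: "z0 + b \<in> I y" using R[OF y(1)] y(2) by (simp add: R_def)
    have "((\<lambda>w. (F y w - F y (z0 + b)) / (w - (z0 + b))) \<longlongrightarrow> deriv (F y) (z0 + b)) (at (z0 + b))"
      using deriv_FC(1)[OF bI] by (simp add: has_field_derivative_iff)
    then have "\<forall>\<^sub>F w in at (z0 + b). (F y w - F y (z0 + b)) / (w - (z0 + b)) \<noteq> 0"
      using val(2)[OF y(1)] y(2) tendsto_imp_eventually_ne by blast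
    moreover have "\<forall>\<^sub>F w in at (z0 + b). w \<in> I y"
      using open_I bI eventually_at_in_open' by blast
    ultimately have "\<forall>\<^sub>F w in at (z0 + b). F y w \<noteq> q \<and> w \<in> I y"
      by eventually_elim (use val(1)[OF y(1)] y(2) in auto)
    then obtain d where d: "d > 0" "\<And>w. w \<noteq> z0 + b \<Longrightarrow> dist w (z0 + b) < d \<Longrightarrow> F y w \<noteq> q \<and> w \<in> I y"
      unfolding eventually_at by auto
    show "\<exists>d>0. \<forall>b'\<in>a ` ?Y. \<bar>b' - b\<bar> < d \<longrightarrow> b' = b"
    proof (intro exI[of _ d] conjI d(1) ballI impI, rule ccontr)
      fix b' assume b': "b' \<in> a ` ?Y" "\<bar>b' - b\<bar> < d" "b' \<noteq> b"
      then obtain y' where y': "y' \<in> ?Y" "b' = a y'" by blast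
      have w: "F y (z0 + b') \<noteq> q" "z0 + b' \<in> I y" using d(2)[of "z0 + b'"] b' by (auto simp: dist_real_def)
      have "z0 + b' \<in> I y'" using R[OF y'(1)] y'(2) by (simp add: R_def)
      from agree[OF y(1) y'(1) w(2) this] have "F y (z0 + b') = F y' (z0 + b')" by (simp add: data_unfold)
      then show False using w(1) val(1)[OF y'(1)] y'(2) by simp
    qed
  qed
  ultimately show ?thesis using countable_image_inj_on by blast
qed

text \<open>
  If \<open>F\<close> is not constant, a translation leads to a point where \<open>F\<close> is rational and \<open>F' \<noteq> 0\<close>; scaling then
  makes \<open>C = 1\<close> there.
\<close>

lemma homothetic_slice:
  assumes t: "t \<noteq> 0" and S: "\<forall>I F C. S I F C \<longrightarrow> Bt_flat_solution t I F C"
    and x: "x \<in> initial_data S z0"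
  obtains (slice) I F C w k where "S I F C" "w \<in> I" "k > 0" "homothetic_data S z0 x (scale_jets k (data F C w))"
    "k * C w = 1" "deriv F w \<noteq> 0 \<and> F w \<in> \<rat> \<or> deriv F w = 0 \<and> deriv (deriv F) w = 0 \<and> deriv (deriv (deriv F)) w = 0"
proof -
  obtain I F C where sol: "S I F C" "z0 \<in> I" "x = data F C z0"
    using x by (auto simp: initial_data_def)
  interpret u2 I F C by (rule u2_of_solution[OF S[rule_format, OF sol(1)]])
  have hom: "homothetic_data S z0 x (scale_jets (1 / C w) (data F C w))" if "w \<in> I" for w
    unfolding homothetic_iff[OF t S]
    using sol that pos(2)[OF that] by (intro exI[of _ I] exI[of _ F] exI[of _ C] exI[of _ "w - z0"] exI[of _ "1 / C w"]) auto
  have thesis_at: thesis if "w \<in> I" "deriv F w \<noteq> 0 \<and> F w \<in> \<rat> \<or> deriv F w = 0 \<and> deriv (deriv F) w = 0 \<and> deriv (deriv (deriv F)) w = 0" for w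
    by (rule slice[OF sol(1) that(1) _ hom[OF that(1)] _ that(2)]) (use pos(2)[OF that(1)] in auto)
  show thesis
  proof (cases "\<exists>w\<in>I. deriv F w \<noteq> 0")
    case True
    then obtain w where w: "w \<in> I" "deriv F w \<noteq> 0" by blast
    have "continuous_on I (deriv F)"
      using deriv_FC(3) by (auto intro!: continuous_at_imp_continuous_on DERIV_isCont)
    from exists_rational_value[OF open_I w(1) deriv_FC(1) this w(2)] show thesis
      using thesis_at by blast
  next
    case False
    have zero: "deriv h w = 0" if "\<And>v. v \<in> I \<Longrightarrow> h v = 0" "w \<in> I" for h :: "real \<Rightarrow> real" and w
    proof (rule DERIV_imp_deriv)
      have "((\<lambda>_. 0) has_real_derivative 0) (at w)" by simp
      then show "(h has_real_derivative 0) (at w)"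
        by (rule has_real_derivative_cong_open[OF _ open_I that(2)]) (simp add: that(1))
    qed
    have 1: "deriv F w = 0" if "w \<in> I" for w using False that by blast
    have 2: "deriv (deriv F) w = 0" if "w \<in> I" for w by (rule zero[OF 1 that])
    have 3: "deriv (deriv (deriv F)) w = 0" if "w \<in> I" for w by (rule zero[OF 2 that])
    show thesis using thesis_at[OF sol(2)] 1 2 3 sol(2) by blast
  qed
qed

lemma chart_simps:
  "jF0 (chart t f0 f1 f2 c0 c1 c2 n1) = f0" "jF1 (chart t f0 f1 f2 c0 c1 c2 n1) = f1"
  "jF2 (chart t f0 f1 f2 c0 c1 c2 n1) = f2" "jC0 (chart t f0 f1 f2 c0 c1 c2 n1) = c0"
  "jC1 (chart t f0 f1 f2 c0 c1 c2 n1) = c1" "jC2 (chart t f0 f1 f2 c0 c1 c2 n1) = c2"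
  by (simp_all add: chart_def Let_def)

lemma C1_coordinates: "C1 jU jF0" "C1 jU jF1" "C1 jU jF2" "C1 jU jC0" "C1 jU jC1" "C1 jU jC2"
  by (intro C1_intros open_jU)+

definition rat_at :: "nat \<Rightarrow> real" where "rat_at = from_nat_into \<rat>"

lemma rat_at: "q \<in> \<rat> \<Longrightarrow> \<exists>m. rat_at m = q"
  unfolding rat_at_def using from_nat_into_surj[OF countable_rat] by blast

lemma open_nth_conditions:
  "open {y :: real^'n. y $ i \<noteq> 0}" "open {y :: real^'n. y $ i > 0}"
  by (intro open_Collect_neq open_Collect_less continuous_intros)+

text \<open>
  The jets with \<open>F' = 0\<close> are not in the chart; they depend on the seven remaining components of the jet.
\<close>

theorem seven_parameters:
  assumes t: "t \<noteq> 0"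
  shows "has_parameters TYPE(real^7) (initial_data (Bt_flat_solution t) z0) (=)"
proof -
  define U where "U = {y :: real^7. y $ 1 > 0 \<and> y $ 2 \<noteq> 0 \<and> y $ 4 > 0}"
  define \<phi> where "\<phi> = (\<lambda>y :: real^7. chart t (y $ 1) (y $ 2) (y $ 3) (y $ 4) (y $ 5) (y $ 6) (y $ 7))"
  define \<psi> where "\<psi> = (\<lambda>n::nat. if n = 0 then \<phi> else
    (\<lambda>y :: real^7. ((y $ 1, 0, y $ 2, y $ 3), (y $ 4, y $ 5, y $ 6, y $ 7))))"
  define V where "V = (\<lambda>n::nat. if n = 0 then U else UNIV)"
  have oU: "open U" unfolding U_def by (intro open_Collect_conj open_nth_conditions)
  have C1\<phi>: "C1 U \<phi>"
    unfolding \<phi>_def by (intro C1_chart C1_vec_nth oU) (auto simp: U_def)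
  have \<phi>U: "\<phi> y \<in> jU" "jK t (\<phi> y) = 0" "jn1 (\<phi> y) = y $ 7" if "y \<in> U" for y
    using that by (auto simp: \<phi>_def U_def jU_def chart_simps jK_chart jn1_chart)
  show ?thesis
    unfolding initial_data_eq[OF t]
  proof (rule has_parametersI[OF C1\<phi>])
    have "(\<chi> i. 1) \<in> U" by (simp add: U_def)
    then show "U \<noteq> {}" by blast
    show "\<phi> ` U \<subseteq> {x \<in> jU. jK t x = 0}" using \<phi>U by auto
    show "\<exists>V l. C1 V l \<and> \<phi> ` U \<subseteq> V \<and> (\<forall>y\<in>U. l (\<phi> y) = y $ i)" for i
    proof -
      have i1: "\<exists>l. C1 jU l \<and> (\<forall>y\<in>U. l (\<phi> y) = y $ 1)"
        by (rule exI[of _ jF0]) (simp add: C1_coordinates C1_jn1 \<phi>_def chart_simps jn1_chart U_def)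
      have i2: "\<exists>l. C1 jU l \<and> (\<forall>y\<in>U. l (\<phi> y) = y $ 2)"
        by (rule exI[of _ jF1]) (simp add: C1_coordinates C1_jn1 \<phi>_def chart_simps jn1_chart U_def)
      have i3: "\<exists>l. C1 jU l \<and> (\<forall>y\<in>U. l (\<phi> y) = y $ 3)"
        by (rule exI[of _ jF2]) (simp add: C1_coordinates C1_jn1 \<phi>_def chart_simps jn1_chart U_def)
      have i4: "\<exists>l. C1 jU l \<and> (\<forall>y\<in>U. l (\<phi> y) = y $ 4)"
        by (rule exI[of _ jC0]) (simp add: C1_coordinates C1_jn1 \<phi>_def chart_simps jn1_chart U_def)
      have i5: "\<exists>l. C1 jU l \<and> (\<forall>y\<in>U. l (\<phi> y) = y $ 5)"
        by (rule exI[of _ jC1]) (simp add: C1_coordinates C1_jn1 \<phi>_def chart_simps jn1_chart U_def)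
      have i6: "\<exists>l. C1 jU l \<and> (\<forall>y\<in>U. l (\<phi> y) = y $ 6)"
        by (rule exI[of _ jC2]) (simp add: C1_coordinates C1_jn1 \<phi>_def chart_simps jn1_chart U_def)
      have i7: "\<exists>l. C1 jU l \<and> (\<forall>y\<in>U. l (\<phi> y) = y $ 7)"
        by (rule exI[of _ jn1]) (simp add: C1_coordinates C1_jn1 \<phi>_def chart_simps jn1_chart U_def)
      from exhaust_7[of i] have "\<exists>l. C1 jU l \<and> (\<forall>y\<in>U. l (\<phi> y) = y $ i)"
        by (elim disjE) (hypsubst, rule i1 i2 i3 i4 i5 i6 i7)+
      then show ?thesis using \<phi>U(1) by blast
    qed
    show "countable {y \<in> U. \<phi> x = \<phi> y}" if "inj_on \<phi> U" "x \<in> U" for x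
    proof -
      have "{y \<in> U. \<phi> x = \<phi> y} \<subseteq> {x}" using that by (auto dest: inj_onD)
      then show ?thesis by (rule countable_subset) simp
    qed
    show "C1 (V n) (\<psi> n)" for n
      by (cases "n = 0") (simp_all add: V_def \<psi>_def C1\<phi>, intro C1_intros open_UNIV)
    fix x assume x: "x \<in> {x \<in> jU. jK t x = 0}"
    show "\<exists>n. \<exists>y\<in>V n. x = \<psi> n y"
    proof (cases "jF1 x = 0")
      case True
      let ?y = "vector [jF0 x, jF2 x, jF3 x, jC0 x, jC1 x, jC2 x, jC3 x] :: real^7"
      have "x = \<psi> 1 ?y"
        using True by (simp add: \<psi>_def vector_def prod_eq_iff)
      then show ?thesis by (auto simp: V_def)
    next
      case False
      let ?y = "vector [jF0 x, jF1 x, jF2 x, jC0 x, jC1 x, jC2 x, jn1 x] :: real^7"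
      have "?y \<in> V 0" using x False by (simp add: V_def U_def jU_def vector_def)
      moreover have "x = \<psi> 0 ?y"
        using eq_chart[of x t] x False by (simp add: \<psi>_def \<phi>_def jU_def vector_def)
      ultimately show ?thesis by blast
    qed
  qed
qed

text \<open>
  On the slices \<open>C = 1\<close>, \<open>F = q\<close> the chart has five free variables. The family with index 0 covers the solutions with
  constant \<open>F\<close>, whose jets depend on four variables.
\<close>

theorem five_parameters:
  assumes t: "t \<noteq> 0"
  shows "has_parameters TYPE(real^5) (initial_data (Bt_flat_solution t) z0) (homothetic_data (Bt_flat_solution t) z0)"
proof -
  let ?S = "Bt_flat_solution t"
  define U where "U = (\<lambda>q::real. {y :: real^5. q > 0 \<and> y $ 1 \<noteq> 0})"
  define \<phi> where "\<phi> = (\<lambda>q (y :: real^5). chart t q (y $ 1) (y $ 2) 1 (y $ 3) (y $ 4) (y $ 5))"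
  define \<psi> where "\<psi> = (\<lambda>n. case n of 0 \<Rightarrow>
    (\<lambda>y :: real^5. ((y $ 1, 0, 0, 0), (1, y $ 2, y $ 3, y $ 4))) | Suc m \<Rightarrow> \<phi> (rat_at m))"
  define V where "V = (\<lambda>n. case n of 0 \<Rightarrow> UNIV | Suc m \<Rightarrow> U (rat_at m))"
  have oU: "open (U q)" for q unfolding U_def by (intro open_Collect_conj open_nth_conditions open_Collect_const)
  have C1\<phi>: "C1 (U q) (\<phi> q)" for q
    unfolding \<phi>_def by (intro C1_chart C1_vec_nth C1_const oU) (auto simp: U_def)
  have \<phi>U: "\<phi> 1 y \<in> jU" "jK t (\<phi> 1 y) = 0" "jn1 (\<phi> 1 y) = y $ 5" if "y \<in> U 1" for y
    using that by (auto simp: \<phi>_def U_def jU_def chart_simps jK_chart jn1_chart)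
  show ?thesis
  proof (rule has_parametersI[OF C1\<phi>])
    have "(\<chi> i. 1) \<in> U 1" by (simp add: U_def)
    then show "U 1 \<noteq> {}" by blast
    show "\<phi> 1 ` U 1 \<subseteq> initial_data ?S z0" unfolding initial_data_eq[OF t] using \<phi>U by auto
    show "\<exists>V l. C1 V l \<and> \<phi> 1 ` U 1 \<subseteq> V \<and> (\<forall>y\<in>U 1. l (\<phi> 1 y) = y $ i)" for i
    proof -
      have i1: "\<exists>l. C1 jU l \<and> (\<forall>y\<in>U 1. l (\<phi> 1 y) = y $ 1)"
        by (rule exI[of _ jF1]) (simp add: C1_coordinates C1_jn1 \<phi>_def chart_simps jn1_chart U_def)
      have i2: "\<exists>l. C1 jU l \<and> (\<forall>y\<in>U 1. l (\<phi> 1 y) = y $ 2)"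
        by (rule exI[of _ jF2]) (simp add: C1_coordinates C1_jn1 \<phi>_def chart_simps jn1_chart U_def)
      have i3: "\<exists>l. C1 jU l \<and> (\<forall>y\<in>U 1. l (\<phi> 1 y) = y $ 3)"
        by (rule exI[of _ jC1]) (simp add: C1_coordinates C1_jn1 \<phi>_def chart_simps jn1_chart U_def)
      have i4: "\<exists>l. C1 jU l \<and> (\<forall>y\<in>U 1. l (\<phi> 1 y) = y $ 4)"
        by (rule exI[of _ jC2]) (simp add: C1_coordinates C1_jn1 \<phi>_def chart_simps jn1_chart U_def)
      have i5: "\<exists>l. C1 jU l \<and> (\<forall>y\<in>U 1. l (\<phi> 1 y) = y $ 5)"
        by (rule exI[of _ jn1]) (simp add: C1_coordinates C1_jn1 \<phi>_def chart_simps jn1_chart U_def)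
      from exhaust_5[of i] have "\<exists>l. C1 jU l \<and> (\<forall>y\<in>U 1. l (\<phi> 1 y) = y $ i)"
        by (elim disjE) (hypsubst, rule i1 i2 i3 i4 i5)+
      then show ?thesis using \<phi>U(1) by blast
    qed
    show "countable {y \<in> U 1. homothetic_data ?S z0 (\<phi> 1 x) (\<phi> 1 y)}" if "inj_on (\<phi> 1) (U 1)" for x
      by (rule countable_homothetic[OF t _ that, where q = 1]) (auto simp: \<phi>_def U_def chart_simps csc_imp_solution)
    show "C1 (V n) (\<psi> n)" for n
      by (cases n) (simp_all add: V_def \<psi>_def C1\<phi>, intro C1_intros open_UNIV)
    fix x assume "x \<in> initial_data ?S z0"
    obtain I F C w k where sol: "?S I F C" "w \<in> I" "k > 0"
      and hom: "homothetic_data ?S z0 x (scale_jets k (data F C w))" and C: "k * C w = 1"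
      and F: "deriv F w \<noteq> 0 \<and> F w \<in> \<rat> \<or> deriv F w = 0 \<and> deriv (deriv F) w = 0 \<and> deriv (deriv (deriv F)) w = 0"
      by (rule homothetic_slice[OF t _ \<open>x \<in> initial_data ?S z0\<close>]) auto
    define j where "j = scale_jets k (data F C w)"
    have j: "jF0 j > 0" "jC0 j = 1" "jK t j = 0"
      using solution_jets[OF t sol(1,2)] C sol(3) by (auto simp: j_def scale_jets_simps)
        (auto simp: scale_jets_def data_unfold jU_def)
    have "\<exists>n. \<exists>y\<in>V n. j = \<psi> n y"
      using F
    proof
      assume "deriv F w \<noteq> 0 \<and> F w \<in> \<rat>"
      then have F: "jF1 j \<noteq> 0" "jF0 j \<in> \<rat>" by (auto simp: j_def scale_jets_def data_unfold)
      then obtain m where m: "rat_at m = jF0 j" using rat_at by blast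
      let ?y = "vector [jF1 j, jF2 j, jC1 j, jC2 j, jn1 j] :: real^5"
      have "?y \<in> V (Suc m)" using F j m by (simp add: V_def U_def vector_def)
      moreover have "j = \<psi> (Suc m) ?y"
        using eq_chart[of j t] F j m by (simp add: \<psi>_def \<phi>_def vector_def)
      ultimately show ?thesis by blast
    next
      assume "deriv F w = 0 \<and> deriv (deriv F) w = 0 \<and> deriv (deriv (deriv F)) w = 0"
      then have "jF1 j = 0" "jF2 j = 0" "jF3 j = 0" by (auto simp: j_def scale_jets_def data_unfold)
      then have "j = \<psi> 0 (vector [jF0 j, jC1 j, jC2 j, jC3 j, 0])"
        using j by (simp add: \<psi>_def vector_def prod_eq_iff)
      then show ?thesis by (intro exI[of _ 0]) (auto simp: V_def)
    qed
    then show "\<exists>n. \<exists>y\<in>V n. homothetic_data ?S z0 x (\<psi> n y)"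
      using hom unfolding j_def by metis
  qed
qed

text \<open>
  As for all solutions, with \<open>n\<^sub>1 = C s'\<close> set to zero.
\<close>

theorem csc_four_parameters:
  assumes t: "t \<noteq> 0"
  shows "has_parameters TYPE(real^4) (initial_data (csc_Bt_flat_solution t) z0) (homothetic_data (csc_Bt_flat_solution t) z0)"
proof -
  let ?S = "csc_Bt_flat_solution t"
  define U where "U = (\<lambda>q::real. {y :: real^4. q > 0 \<and> y $ 1 \<noteq> 0})"
  define \<phi> where "\<phi> = (\<lambda>q (y :: real^4). chart t q (y $ 1) (y $ 2) 1 (y $ 3) (y $ 4) 0)"
  define \<psi> where "\<psi> = (\<lambda>n. case n of 0 \<Rightarrow>
    (\<lambda>y :: real^4. ((y $ 1, 0, 0, 0), (1, y $ 2, y $ 3, y $ 4))) | Suc m \<Rightarrow> \<phi> (rat_at m))"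
  define V where "V = (\<lambda>n. case n of 0 \<Rightarrow> UNIV | Suc m \<Rightarrow> U (rat_at m))"
  have oU: "open (U q)" for q unfolding U_def by (intro open_Collect_conj open_nth_conditions open_Collect_const)
  have C1\<phi>: "C1 (U q) (\<phi> q)" for q
    unfolding \<phi>_def by (intro C1_chart C1_vec_nth C1_const oU) (auto simp: U_def)
  have \<phi>U: "\<phi> 1 y \<in> jU" "jK t (\<phi> 1 y) = 0" "jn1 (\<phi> 1 y) = 0" if "y \<in> U 1" for y
    using that by (auto simp: \<phi>_def U_def jU_def chart_simps jK_chart jn1_chart)
  show ?thesis
  proof (rule has_parametersI[OF C1\<phi>])
    have "(\<chi> i. 1) \<in> U 1" by (simp add: U_def)
    then show "U 1 \<noteq> {}" by blast
    show "\<phi> 1 ` U 1 \<subseteq> initial_data ?S z0" unfolding csc_initial_data_eq[OF t] using \<phi>U by auto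
    show "\<exists>V l. C1 V l \<and> \<phi> 1 ` U 1 \<subseteq> V \<and> (\<forall>y\<in>U 1. l (\<phi> 1 y) = y $ i)" for i
    proof -
      have i1: "\<exists>l. C1 jU l \<and> (\<forall>y\<in>U 1. l (\<phi> 1 y) = y $ 1)"
        by (rule exI[of _ jF1]) (simp add: C1_coordinates C1_jn1 \<phi>_def chart_simps jn1_chart U_def)
      have i2: "\<exists>l. C1 jU l \<and> (\<forall>y\<in>U 1. l (\<phi> 1 y) = y $ 2)"
        by (rule exI[of _ jF2]) (simp add: C1_coordinates C1_jn1 \<phi>_def chart_simps jn1_chart U_def)
      have i3: "\<exists>l. C1 jU l \<and> (\<forall>y\<in>U 1. l (\<phi> 1 y) = y $ 3)"
        by (rule exI[of _ jC1]) (simp add: C1_coordinates C1_jn1 \<phi>_def chart_simps jn1_chart U_def)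
      have i4: "\<exists>l. C1 jU l \<and> (\<forall>y\<in>U 1. l (\<phi> 1 y) = y $ 4)"
        by (rule exI[of _ jC2]) (simp add: C1_coordinates C1_jn1 \<phi>_def chart_simps jn1_chart U_def)
      from exhaust_4[of i] have "\<exists>l. C1 jU l \<and> (\<forall>y\<in>U 1. l (\<phi> 1 y) = y $ i)"
        by (elim disjE) (hypsubst, rule i1 i2 i3 i4)+
      then show ?thesis using \<phi>U(1) by blast
    qed
    show "countable {y \<in> U 1. homothetic_data ?S z0 (\<phi> 1 x) (\<phi> 1 y)}" if "inj_on (\<phi> 1) (U 1)" for x
      by (rule countable_homothetic[OF t _ that, where q = 1]) (auto simp: \<phi>_def U_def chart_simps csc_imp_solution)
    show "C1 (V n) (\<psi> n)" for n
      by (cases n) (simp_all add: V_def \<psi>_def C1\<phi>, intro C1_intros open_UNIV)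
    fix x assume "x \<in> initial_data ?S z0"
    obtain I F C w k where sol: "?S I F C" "w \<in> I" "k > 0"
      and hom: "homothetic_data ?S z0 x (scale_jets k (data F C w))" and C: "k * C w = 1"
      and F: "deriv F w \<noteq> 0 \<and> F w \<in> \<rat> \<or> deriv F w = 0 \<and> deriv (deriv F) w = 0 \<and> deriv (deriv (deriv F)) w = 0"
      by (rule homothetic_slice[OF t _ \<open>x \<in> initial_data ?S z0\<close>]) (auto simp: csc_imp_solution)
    define j where "j = scale_jets k (data F C w)"
    have j: "jF0 j > 0" "jC0 j = 1" "jK t j = 0" "jn1 j = 0"
      using solution_jets[OF t csc_imp_solution[OF sol(1)] sol(2)] csc_jets[OF t sol(1,2)] C sol(3)
      by (auto simp: j_def scale_jets_simps) (auto simp: scale_jets_def data_unfold jU_def)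
    have "\<exists>n. \<exists>y\<in>V n. j = \<psi> n y"
      using F
    proof
      assume "deriv F w \<noteq> 0 \<and> F w \<in> \<rat>"
      then have F: "jF1 j \<noteq> 0" "jF0 j \<in> \<rat>" by (auto simp: j_def scale_jets_def data_unfold)
      then obtain m where m: "rat_at m = jF0 j" using rat_at by blast
      let ?y = "vector [jF1 j, jF2 j, jC1 j, jC2 j] :: real^4"
      have "?y \<in> V (Suc m)" using F j m by (simp add: V_def U_def vector_def)
      moreover have "j = \<psi> (Suc m) ?y"
        using eq_chart[of j t] F j m by (simp add: \<psi>_def \<phi>_def vector_def)
      ultimately show ?thesis by blast
    next
      assume "deriv F w = 0 \<and> deriv (deriv F) w = 0 \<and> deriv (deriv (deriv F)) w = 0"
      then have "jF1 j = 0" "jF2 j = 0" "jF3 j = 0" by (auto simp: j_def scale_jets_def data_unfold)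
      then have "j = \<psi> 0 (vector [jF0 j, jC1 j, jC2 j, jC3 j])"
        using j by (simp add: \<psi>_def vector_def prod_eq_iff)
      then show ?thesis by (intro exI[of _ 0]) (auto simp: V_def)
    qed
    then show "\<exists>n. \<exists>y\<in>V n. homothetic_data ?S z0 x (\<psi> n y)"
      using hom unfolding j_def by metis
  qed
qed

section \<open>Commutators of the frame\<close>

lemma rmul_linear: "rmul i (x + y) = rmul i x + rmul i y" "rmul i (c *\<^sub>R x) = c *\<^sub>R rmul i x" "rmul i (- x) = - rmul i x"
  by (cases x, cases y, auto simp: rmul_def algebra_simps)+

definition cyc :: "4 \<Rightarrow> 4 \<Rightarrow> 4 \<Rightarrow> bool" where
  "cyc i j k \<longleftrightarrow> (i, j, k) \<in> {(1, 2, 3), (2, 3, 1), (3, 1, 2)}"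

lemma cyc_nonzero: "cyc i j k \<Longrightarrow> i \<noteq> 0 \<and> j \<noteq> 0 \<and> k \<noteq> 0"
  by (auto simp: cyc_def)

lemma rmul_rmul: "rmul i (rmul i x) = - x" if "i \<noteq> 0"
  using exhaust_4[of i] that by (cases x) (auto simp: rmul_def)

lemma rmul_cyc:
  assumes "cyc i j k"
  shows "rmul j (rmul i x) = rmul k x" "rmul i (rmul j x) = - rmul k x" "rmul k (rmul j x) = rmul i x"
    "rmul j (rmul k x) = - rmul i x" "rmul i (rmul k x) = rmul j x" "rmul k (rmul i x) = - rmul j x"
  using assms by (cases x; auto simp: cyc_def rmul_def)+

lemma flow_nonzero: "i \<noteq> 0 \<Longrightarrow> flow i h (z, q) = (z, cos h *\<^sub>R q + sin h *\<^sub>R rmul i q)"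
  by (simp add: flow_def)

lemma flow_add: "flow i (s + t) p = flow i s (flow i t p)"
proof (cases "i = 0")
  case True
  then show ?thesis by (cases p) (simp add: flow_def ac_simps)
next
  case False
  obtain z q where "p = (z, q)" by (cases p)
  with False show ?thesis
    by (simp add: flow_nonzero rmul_linear rmul_rmul cos_add sin_add algebra_simps)
qed

text \<open>
  The flows multiply from the right by \<open>exp (h e)\<close>. Interchanging two of them conjugates the first exponential
  by the second, and the result \<open>cos h + sin h (cos 2h e\<^sub>i + sin 2h e\<^sub>k)\<close> is written as a product
  \<open>exp (\<alpha> e\<^sub>k) exp (\<beta> e\<^sub>i) exp (\<alpha> e\<^sub>k)\<close>. The symmetric form leads to solvable equations for the angles.
\<close>

lemma flow_conjugate:
  assumes c: "cyc i j k"
    and X: "cos \<beta> * cos (2 * \<alpha>) = cos h" and Y: "cos \<beta> * sin (2 * \<alpha>) = sin h * sin (2 * h)"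
    and Z: "sin \<beta> = sin h * cos (2 * h)"
  shows "flow j h (flow i h p) = flow k \<alpha> (flow i \<beta> (flow k \<alpha> (flow j h p)))"
proof -
  obtain z q where p: "p = (z, q)" by (cases p)
  note nz = cyc_nonzero[OF c]
  have triple: "flow k \<alpha> (flow i \<beta> (flow k \<alpha> (z, r))) =
      (z, cos h *\<^sub>R r + (sin h * sin (2 * h)) *\<^sub>R rmul k r + (sin h * cos (2 * h)) *\<^sub>R rmul i r)" for r
  proof -
    have aux: "ca *\<^sub>R (cb *\<^sub>R (ca *\<^sub>R r + sa *\<^sub>R rmul k r) + sb *\<^sub>R rmul i (ca *\<^sub>R r + sa *\<^sub>R rmul k r))
        + sa *\<^sub>R rmul k (cb *\<^sub>R (ca *\<^sub>R r + sa *\<^sub>R rmul k r) + sb *\<^sub>R rmul i (ca *\<^sub>R r + sa *\<^sub>R rmul k r))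
      = (cb * (ca * ca - sa * sa)) *\<^sub>R r + (cb * (sa * ca + sa * ca)) *\<^sub>R rmul k r
        + (sb * (ca * ca + sa * sa)) *\<^sub>R rmul i r" for ca sa cb sb
      using nz by (simp add: rmul_linear rmul_rmul rmul_cyc[OF c] algebra_simps)
        (simp flip: scaleR_left_distrib)
    have "flow k \<alpha> (flow i \<beta> (flow k \<alpha> (z, r))) =
      (z, (cos \<beta> * (cos \<alpha> * cos \<alpha> - sin \<alpha> * sin \<alpha>)) *\<^sub>R r + (cos \<beta> * (sin \<alpha> * cos \<alpha> + sin \<alpha> * cos \<alpha>)) *\<^sub>R rmul k r
        + (sin \<beta> * (cos \<alpha> * cos \<alpha> + sin \<alpha> * sin \<alpha>)) *\<^sub>R rmul i r)"
      using nz aux by (simp add: flow_nonzero)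
    also have "cos \<alpha> * cos \<alpha> - sin \<alpha> * sin \<alpha> = cos (2 * \<alpha>)" by (simp add: cos_double power2_eq_square)
    also have "sin \<alpha> * cos \<alpha> + sin \<alpha> * cos \<alpha> = sin (2 * \<alpha>)" by (simp add: sin_double)
    also have "cos \<alpha> * cos \<alpha> + sin \<alpha> * sin \<alpha> = 1"
      using sin_cos_squared_add[of \<alpha>] by (simp add: power2_eq_square)
    finally show ?thesis using X Y Z by simp
  qed
  have e1: "cos h * (sin h * sin (2 * h)) - sin h * (sin h * cos (2 * h)) = sin h * sin h"
  proof -
    have "cos h * (sin h * sin (2 * h)) - sin h * (sin h * cos (2 * h)) = sin h * sin (2 * h - h)"
      unfolding sin_diff by (simp add: algebra_simps)
    then show ?thesis by simp
  qed
  have e2: "cos h * (sin h * cos (2 * h)) + sin h * (sin h * sin (2 * h)) = sin h * cos h"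
  proof -
    have "cos h * (sin h * cos (2 * h)) + sin h * (sin h * sin (2 * h)) = sin h * cos (2 * h - h)"
      unfolding cos_diff by (simp add: algebra_simps)
    then show ?thesis by simp
  qed
  have "flow k \<alpha> (flow i \<beta> (flow k \<alpha> (flow j h p))) = (z, (cos h * cos h) *\<^sub>R q + (cos h * sin h) *\<^sub>R rmul j q
      + (cos h * (sin h * sin (2 * h)) - sin h * (sin h * cos (2 * h))) *\<^sub>R rmul k q
      + (cos h * (sin h * cos (2 * h)) + sin h * (sin h * sin (2 * h))) *\<^sub>R rmul i q)"
    using nz unfolding p flow_nonzero[of j, OF conjunct1[OF conjunct2[OF nz]]] triple
    by (simp add: rmul_linear rmul_cyc[OF c] algebra_simps)
  also have "\<dots> = flow j h (flow i h p)"
    unfolding e1 e2 p using nz by (simp add: flow_nonzero rmul_linear rmul_cyc[OF c] algebra_simps)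
  finally show ?thesis by simp
qed

text \<open>
  For small positive \<open>h\<close> the three equations between angles are solved by dividing the first two. Here \<open>\<alpha>\<close> is of second order in \<open>h\<close>; its coefficient 1, counted twice, is the structure constant 2.
\<close>

lemma conjugation_angles:
  defines "\<alpha> \<equiv> \<lambda>h::real. arctan (tan h * sin (2 * h)) / 2"
    and "\<beta> \<equiv> \<lambda>h::real. arctan (sin h * cos (2 * h) / sqrt (1 - (sin h * cos (2 * h))\<^sup>2))"
  shows "\<forall>\<^sub>F h in at_right 0. cos (\<beta> h) * cos (2 * \<alpha> h) = cos h \<and> cos (\<beta> h) * sin (2 * \<alpha> h) = sin h * sin (2 * h)
      \<and> sin (\<beta> h) = sin h * cos (2 * h) \<and> \<alpha> h \<ge> 0 \<and> \<beta> h \<ge> 0"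
    and "((\<lambda>h. \<alpha> h / h\<^sup>2) \<longlongrightarrow> 1) (at_right 0)" "((\<lambda>h. \<beta> h / h) \<longlongrightarrow> 1) (at_right 0)"
    "((\<lambda>h. (\<beta> h - h) / h\<^sup>2) \<longlongrightarrow> 0) (at_right 0)"
proof -
  show "((\<lambda>h. \<alpha> h / h\<^sup>2) \<longlongrightarrow> 1) (at_right 0)" unfolding \<alpha>_def by real_asymp
  show "((\<lambda>h. \<beta> h / h) \<longlongrightarrow> 1) (at_right 0)" unfolding \<beta>_def by real_asymp
  show "((\<lambda>h. (\<beta> h - h) / h\<^sup>2) \<longlongrightarrow> 0) (at_right 0)" unfolding \<beta>_def by real_asymp
  have ev: "\<forall>\<^sub>F h::real in at_right 0. 0 < h \<and> h < pi / 4"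
    using eventually_at_right_real[of 0 "pi / 4"] by (simp add: eventually_conj_iff)
  show "\<forall>\<^sub>F h in at_right 0. cos (\<beta> h) * cos (2 * \<alpha> h) = cos h \<and> cos (\<beta> h) * sin (2 * \<alpha> h) = sin h * sin (2 * h)
      \<and> sin (\<beta> h) = sin h * cos (2 * h) \<and> \<alpha> h \<ge> 0 \<and> \<beta> h \<ge> 0"
    using ev
  proof eventually_elim
    case (elim h)
    have c: "cos h > 0" "sin h > 0" "cos (2 * h) > 0" "sin (2 * h) > 0"
      using elim by (auto intro!: cos_gt_zero_pi sin_gt_zero)
    define w where "w = sin h * cos (2 * h)"
    define u where "u = tan h * sin (2 * h)"
    have w2: "1 - w\<^sup>2 = (cos h)\<^sup>2 * (1 + u\<^sup>2)"
    proof -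
      have "(cos h)\<^sup>2 * (1 + u\<^sup>2) = (cos h)\<^sup>2 + (sin h)\<^sup>2 * (sin (2 * h))\<^sup>2"
        using c by (simp add: u_def tan_def field_simps power_mult_distrib)
      also have "\<dots> = 1 - (sin h)\<^sup>2 * (1 - (sin (2 * h))\<^sup>2)"
        using sin_cos_squared_add[of h] by (simp add: algebra_simps)
      also have "1 - (sin (2 * h))\<^sup>2 = (cos (2 * h))\<^sup>2"
        by (simp add: cos_squared_eq)
      finally show ?thesis by (simp add: w_def power_mult_distrib)
    qed
    have pos: "1 + u\<^sup>2 > 0" by (simp add: add_pos_nonneg)
    have w2p: "1 - w\<^sup>2 > 0" unfolding w2 using c pos by simp
    have sq: "sqrt (1 - w\<^sup>2) = cos h * sqrt (1 + u\<^sup>2)"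
      unfolding w2 using c by (simp add: real_sqrt_mult)
    have s1: "sqrt (1 + (w / sqrt (1 - w\<^sup>2))\<^sup>2) = 1 / sqrt (1 - w\<^sup>2)"
    proof -
      have "1 + (w / sqrt (1 - w\<^sup>2))\<^sup>2 = 1 / (1 - w\<^sup>2)"
        using w2p by (simp add: power_divide field_simps)
      then show ?thesis by (simp add: real_sqrt_divide)
    qed
    have cb: "cos (\<beta> h) = sqrt (1 - w\<^sup>2)" "sin (\<beta> h) = w"
      unfolding \<beta>_def w_def[symmetric] cos_arctan sin_arctan s1 using w2p by simp_all
    have ca: "cos (2 * \<alpha> h) = 1 / sqrt (1 + u\<^sup>2)" "sin (2 * \<alpha> h) = u / sqrt (1 + u\<^sup>2)"
      unfolding \<alpha>_def u_def[symmetric] by (simp_all add: cos_arctan sin_arctan)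
    have "cos (\<beta> h) * cos (2 * \<alpha> h) = cos h"
      unfolding cb ca sq using pos by simp
    moreover have "cos (\<beta> h) * sin (2 * \<alpha> h) = sin h * sin (2 * h)"
      unfolding cb ca sq using pos c by (simp add: u_def tan_def)
    moreover have "\<alpha> h \<ge> 0" "\<beta> h \<ge> 0"
      using c w2p unfolding \<alpha>_def \<beta>_def w_def by (auto simp: tan_def zero_le_divide_iff)
    ultimately show ?case using cb by (simp add: w_def)
  qed
qed

text \<open>
  Smoothness is expressed by the frame: functions are continuous, with derivatives along the flows that have the same property.
  The calculus below needs one such step, and two steps (\<open>C2\<close>) for commutators.
\<close>

definition along :: "real set \<Rightarrow> (point \<Rightarrow> real) \<Rightarrow> bool" where
  "along I f \<longleftrightarrow> continuous_on (cyl I) f \<and> (\<forall>i. \<forall>p\<in>cyl I. (\<lambda>h. f (flow i h p)) differentiable (at 0))"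

lemma along_deriv:
  assumes "along I f" "flow i t p \<in> cyl I"
  shows "((\<lambda>h. f (flow i h p)) has_real_derivative frame_D i f (flow i t p)) (at t)"
proof -
  have "((\<lambda>h. f (flow i h (flow i t p))) has_real_derivative frame_D i f (flow i t p)) (at 0)"
    using assms unfolding along_def frame_D_def by (simp add: DERIV_deriv_iff_real_differentiable)
  then have "((\<lambda>h. f (flow i (h + t) p)) has_real_derivative frame_D i f (flow i t p)) (at 0)"
    by (simp add: flow_add)
  then show ?thesis using DERIV_shift[of "\<lambda>h. f (flow i h p)" _ 0 t] by simp
qed

definition C2 :: "real set \<Rightarrow> (point \<Rightarrow> real) \<Rightarrow> bool" where
  "C2 I f \<longleftrightarrow> along I f \<and> (\<forall>i. along I (frame_D i f)) \<and> (\<forall>i j. continuous_on (cyl I) (frame_D i (frame_D j f)))"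

lemma tendsto_flow:
  assumes "(\<sigma> \<longlongrightarrow> 0) A" "(P \<longlongrightarrow> p) A"
  shows "((\<lambda>h. flow i (\<sigma> h) (P h)) \<longlongrightarrow> p) A"
proof -
  obtain z q where p: "p = (z, q)" by (cases p)
  have 1: "((\<lambda>h. fst (P h)) \<longlongrightarrow> z) A" "((\<lambda>h. snd (P h)) \<longlongrightarrow> q) A"
    using tendsto_fst[OF assms(2)] tendsto_snd[OF assms(2)] by (simp_all add: p)
  have bl: "bounded_linear (rmul i)"
    by (rule linear_conv_bounded_linear[THEN iffD1]) (intro linearI rmul_linear)
  have 2: "((\<lambda>h. rmul i (snd (P h))) \<longlongrightarrow> rmul i q) A"
    by (rule bounded_linear.tendsto[OF bl 1(2)])
  have f: "flow i t x = (if i = 0 then (fst x + t, snd x) else (fst x, cos t *\<^sub>R snd x + sin t *\<^sub>R rmul i (snd x)))" for t x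
    by (cases x) (simp add: flow_def)
  show ?thesis
  proof (cases "i = 0")
    case True
    have "((\<lambda>h. (fst (P h) + \<sigma> h, snd (P h))) \<longlongrightarrow> (z + 0, q)) A"
      by (intro tendsto_intros 1 assms)
    then show ?thesis unfolding f by (simp add: True p)
  next
    case False
    have "((\<lambda>h. (fst (P h), cos (\<sigma> h) *\<^sub>R snd (P h) + sin (\<sigma> h) *\<^sub>R rmul i (snd (P h))))
        \<longlongrightarrow> (z, cos 0 *\<^sub>R q + sin 0 *\<^sub>R rmul i q)) A"
      by (intro tendsto_Pair tendsto_add tendsto_scaleR 1 2 isCont_tendsto_compose[OF isCont_cos assms(1)]
          isCont_tendsto_compose[OF isCont_sin assms(1)])
    then show ?thesis unfolding f by (simp add: False p)
  qed
qed

text \<open>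
  Taylor's formula along a flow whose starting point \<open>P h\<close> tends to \<open>p\<close> at the same time. The error is compared with the
  derivative at the fixed point \<open>p\<close>, by continuity of the frame derivative.
\<close>

lemma first_order:
  assumes f: "along I f" "continuous_on (cyl I) (frame_D i f)" and p: "p \<in> cyl I"
    and P: "(P \<longlongrightarrow> p) A" and \<sigma>: "(\<sigma> \<longlongrightarrow> (0::real)) A" "\<forall>\<^sub>F h in A. \<sigma> h \<ge> 0"
    and cyl: "\<forall>\<^sub>F h in A. \<forall>\<xi>. \<bar>\<xi>\<bar> \<le> \<sigma> h \<longrightarrow> flow i \<xi> (P h) \<in> cyl I"
  obtains \<epsilon> where "(\<epsilon> \<longlongrightarrow> 0) A"
    "\<forall>\<^sub>F h in A. f (flow i (\<sigma> h) (P h)) = f (P h) + \<sigma> h * (frame_D i f p + \<epsilon> h)"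
proof -
  have "\<exists>\<xi>. \<sigma> h \<ge> 0 \<longrightarrow> (\<forall>\<xi>. \<bar>\<xi>\<bar> \<le> \<sigma> h \<longrightarrow> flow i \<xi> (P h) \<in> cyl I) \<longrightarrow> \<bar>\<xi>\<bar> \<le> \<sigma> h \<and>
      f (flow i (\<sigma> h) (P h)) = f (P h) + \<sigma> h * frame_D i f (flow i \<xi> (P h))" for h
  proof (cases "\<sigma> h > 0 \<and> (\<forall>\<xi>. \<bar>\<xi>\<bar> \<le> \<sigma> h \<longrightarrow> flow i \<xi> (P h) \<in> cyl I)")
    case True
    have "\<exists>\<xi>>0. \<xi> < \<sigma> h \<and> f (flow i (\<sigma> h) (P h)) - f (flow i 0 (P h)) = (\<sigma> h - 0) * frame_D i f (flow i \<xi> (P h))"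
      using True by (intro MVT2 along_deriv[OF f(1)]) auto
    then obtain \<xi> where "0 < \<xi>" "\<xi> < \<sigma> h" "f (flow i (\<sigma> h) (P h)) - f (flow i 0 (P h)) = (\<sigma> h - 0) * frame_D i f (flow i \<xi> (P h))"
      by blast
    then show ?thesis by (intro exI[of _ \<xi>]) (auto simp: flow_0)
  next
    case False
    then show ?thesis by (intro exI[of _ 0]) (auto simp: flow_0)
  qed
  then obtain \<xi> where \<xi>: "\<And>h. \<sigma> h \<ge> 0 \<Longrightarrow> (\<forall>\<xi>. \<bar>\<xi>\<bar> \<le> \<sigma> h \<longrightarrow> flow i \<xi> (P h) \<in> cyl I) \<Longrightarrow> \<bar>\<xi> h\<bar> \<le> \<sigma> h \<and>
      f (flow i (\<sigma> h) (P h)) = f (P h) + \<sigma> h * frame_D i f (flow i (\<xi> h) (P h))"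
    by metis
  have ev: "\<forall>\<^sub>F h in A. \<bar>\<xi> h\<bar> \<le> \<sigma> h \<and> flow i (\<xi> h) (P h) \<in> cyl I \<and>
      f (flow i (\<sigma> h) (P h)) = f (P h) + \<sigma> h * frame_D i f (flow i (\<xi> h) (P h))"
    using \<sigma>(2) cyl by eventually_elim (use \<xi> in blast)
  have "(\<xi> \<longlongrightarrow> 0) A"
    by (rule Lim_null_comparison[OF _ \<sigma>(1)]) (use ev in \<open>auto elim!: eventually_mono\<close>)
  from tendsto_flow[OF this P]
  have "((\<lambda>h. flow i (\<xi> h) (P h)) \<longlongrightarrow> p) A" .
  then have "((\<lambda>h. frame_D i f (flow i (\<xi> h) (P h))) \<longlongrightarrow> frame_D i f p) A"
    by (rule continuous_on_tendsto_compose[OF f(2) _ p]) (use ev in \<open>auto elim!: eventually_mono\<close>)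
  then have "((\<lambda>h. frame_D i f (flow i (\<xi> h) (P h)) - frame_D i f p) \<longlongrightarrow> 0) A"
    by (simp add: LIM_zero_iff)
  moreover have "\<forall>\<^sub>F h in A. f (flow i (\<sigma> h) (P h)) = f (P h) + \<sigma> h * (frame_D i f p + (frame_D i f (flow i (\<xi> h) (P h)) - frame_D i f p))"
    using ev by eventually_elim simp
  ultimately show thesis by (rule that)
qed

lemma second_order:
  assumes f: "C2 I f" and p: "p \<in> cyl I"
    and P: "(P \<longlongrightarrow> p) A" and \<sigma>: "(\<sigma> \<longlongrightarrow> (0::real)) A" "\<forall>\<^sub>F h in A. \<sigma> h \<ge> 0"
    and cyl: "\<forall>\<^sub>F h in A. \<forall>\<xi>. \<bar>\<xi>\<bar> \<le> \<sigma> h \<longrightarrow> flow i \<xi> (P h) \<in> cyl I"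
  obtains \<epsilon> where "(\<epsilon> \<longlongrightarrow> 0) A"
    "\<forall>\<^sub>F h in A. f (flow i (\<sigma> h) (P h)) = f (P h) + \<sigma> h * frame_D i f (P h) + (\<sigma> h)\<^sup>2 / 2 * (frame_D i (frame_D i f) p + \<epsilon> h)"
proof -
  let ?f1 = "frame_D i f" and ?f2 = "frame_D i (frame_D i f)"
  have f1: "along I f" "along I ?f1" "continuous_on (cyl I) ?f2" using f by (auto simp: C2_def)
  have "\<exists>\<xi>. \<sigma> h \<ge> 0 \<longrightarrow> (\<forall>\<xi>. \<bar>\<xi>\<bar> \<le> \<sigma> h \<longrightarrow> flow i \<xi> (P h) \<in> cyl I) \<longrightarrow> \<bar>\<xi>\<bar> \<le> \<sigma> h \<and>
      f (flow i (\<sigma> h) (P h)) = f (P h) + \<sigma> h * ?f1 (P h) + (\<sigma> h)\<^sup>2 / 2 * ?f2 (flow i \<xi> (P h))" for h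
  proof (cases "\<sigma> h > 0 \<and> (\<forall>\<xi>. \<bar>\<xi>\<bar> \<le> \<sigma> h \<longrightarrow> flow i \<xi> (P h) \<in> cyl I)")
    case True
    define D where "D = (\<lambda>m::nat. if m = 0 then (\<lambda>t. f (flow i t (P h))) else if m = 1 then (\<lambda>t. ?f1 (flow i t (P h)))
       else (\<lambda>t. ?f2 (flow i t (P h))))"
    have "\<exists>t>0. t < \<sigma> h \<and> f (flow i (\<sigma> h) (P h)) = (\<Sum>m<2. D m 0 / fact m * \<sigma> h ^ m) + D 2 t / fact 2 * \<sigma> h ^ 2"
    proof (rule Maclaurin)
      show "\<forall>m t. m < 2 \<and> 0 \<le> t \<and> t \<le> \<sigma> h \<longrightarrow> (D m has_real_derivative D (Suc m) t) (at t)"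
      proof (intro allI impI)
        fix m :: nat and t assume m: "m < 2 \<and> 0 \<le> t \<and> t \<le> \<sigma> h"
        then have "flow i t (P h) \<in> cyl I" using True by auto
        moreover have "m = 0 \<or> m = 1" using m by auto
        ultimately show "(D m has_real_derivative D (Suc m) t) (at t)"
          using along_deriv[OF f1(1)] along_deriv[OF f1(2)] by (auto simp: D_def)
      qed
    qed (use True in \<open>auto simp: D_def\<close>)
    then obtain \<xi> where "0 < \<xi>" "\<xi> < \<sigma> h"
      "f (flow i (\<sigma> h) (P h)) = (\<Sum>m<2. D m 0 / fact m * \<sigma> h ^ m) + D 2 \<xi> / fact 2 * \<sigma> h ^ 2"
      by blast
    then show ?thesis by (intro exI[of _ \<xi>]) (auto simp: flow_0 D_def eval_nat_numeral)
  next
    case False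
    then show ?thesis by (intro exI[of _ 0]) (auto simp: flow_0)
  qed
  then obtain \<xi> where \<xi>: "\<And>h. \<sigma> h \<ge> 0 \<Longrightarrow> (\<forall>\<xi>. \<bar>\<xi>\<bar> \<le> \<sigma> h \<longrightarrow> flow i \<xi> (P h) \<in> cyl I) \<Longrightarrow> \<bar>\<xi> h\<bar> \<le> \<sigma> h \<and>
      f (flow i (\<sigma> h) (P h)) = f (P h) + \<sigma> h * ?f1 (P h) + (\<sigma> h)\<^sup>2 / 2 * ?f2 (flow i (\<xi> h) (P h))"
    by metis
  have ev: "\<forall>\<^sub>F h in A. \<bar>\<xi> h\<bar> \<le> \<sigma> h \<and> flow i (\<xi> h) (P h) \<in> cyl I \<and>
      f (flow i (\<sigma> h) (P h)) = f (P h) + \<sigma> h * ?f1 (P h) + (\<sigma> h)\<^sup>2 / 2 * ?f2 (flow i (\<xi> h) (P h))"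
    using \<sigma>(2) cyl by eventually_elim (use \<xi> in blast)
  have "(\<xi> \<longlongrightarrow> 0) A"
    by (rule Lim_null_comparison[OF _ \<sigma>(1)]) (use ev in \<open>auto elim!: eventually_mono\<close>)
  from tendsto_flow[OF this P]
  have "((\<lambda>h. flow i (\<xi> h) (P h)) \<longlongrightarrow> p) A" .
  then have "((\<lambda>h. ?f2 (flow i (\<xi> h) (P h))) \<longlongrightarrow> ?f2 p) A"
    by (rule continuous_on_tendsto_compose[OF f1(3) _ p]) (use ev in \<open>auto elim!: eventually_mono\<close>)
  then have "((\<lambda>h. ?f2 (flow i (\<xi> h) (P h)) - ?f2 p) \<longlongrightarrow> 0) A"
    by (simp add: LIM_zero_iff)
  moreover have "\<forall>\<^sub>F h in A. f (flow i (\<sigma> h) (P h)) = f (P h) + \<sigma> h * ?f1 (P h) + (\<sigma> h)\<^sup>2 / 2 * (?f2 p + (?f2 (flow i (\<xi> h) (P h)) - ?f2 p))"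
    using ev by eventually_elim simp
  ultimately show thesis by (rule that)
qed

lemma two_flows:
  assumes f: "C2 I f" and p: "p \<in> cyl I"
    and ci: "\<forall>\<^sub>F h in at_right 0. \<forall>\<xi>. \<bar>\<xi>\<bar> \<le> h \<longrightarrow> flow i \<xi> p \<in> cyl I"
    and cj: "\<forall>\<^sub>F h in at_right 0. \<forall>\<xi>. \<bar>\<xi>\<bar> \<le> h \<longrightarrow> flow j \<xi> (flow i h p) \<in> cyl I"
  obtains \<epsilon> where "(\<epsilon> \<longlongrightarrow> 0) (at_right 0)"
    "\<forall>\<^sub>F h in at_right 0. f (flow j h (flow i h p)) = f p + h * (frame_D i f p + frame_D j f p) +
       h\<^sup>2 * (frame_D i (frame_D i f) p / 2 + frame_D j (frame_D j f) p / 2 + frame_D i (frame_D j f) p + \<epsilon> h)"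
proof -
  let ?A = "at_right (0::real)"
  have id: "((\<lambda>h. h) \<longlongrightarrow> 0) ?A" by (rule tendsto_ident_at)
  have ge: "\<forall>\<^sub>F h::real in ?A. h \<ge> 0" using eventually_at_right_less[of 0] by eventually_elim simp
  have P: "((\<lambda>h. flow i h p) \<longlongrightarrow> p) ?A" by (rule tendsto_flow[OF id tendsto_const])
  obtain e1 where e1: "(e1 \<longlongrightarrow> 0) ?A"
    "\<forall>\<^sub>F h in ?A. f (flow j h (flow i h p)) = f (flow i h p) + h * frame_D j f (flow i h p)
       + h\<^sup>2 / 2 * (frame_D j (frame_D j f) p + e1 h)"
    by (rule second_order[OF f p P id ge cj])
  obtain e2 where e2: "(e2 \<longlongrightarrow> 0) ?A"
    "\<forall>\<^sub>F h in ?A. f (flow i h p) = f p + h * frame_D i f p + h\<^sup>2 / 2 * (frame_D i (frame_D i f) p + e2 h)"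
    by (rule second_order[OF f p tendsto_const id ge ci])
  have fj: "along I (frame_D j f)" "continuous_on (cyl I) (frame_D i (frame_D j f))"
    using f by (auto simp: C2_def)
  obtain e3 where e3: "(e3 \<longlongrightarrow> 0) ?A"
    "\<forall>\<^sub>F h in ?A. frame_D j f (flow i h p) = frame_D j f p + h * (frame_D i (frame_D j f) p + e3 h)"
    by (rule first_order[OF fj p tendsto_const id ge ci])
  have "((\<lambda>h. e1 h / 2 + e2 h / 2 + e3 h) \<longlongrightarrow> 0 / 2 + 0 / 2 + 0) ?A"
    by (intro tendsto_intros e1 e2 e3) auto
  moreover have "\<forall>\<^sub>F h in ?A. f (flow j h (flow i h p)) = f p + h * (frame_D i f p + frame_D j f p) +
       h\<^sup>2 * (frame_D i (frame_D i f) p / 2 + frame_D j (frame_D j f) p / 2 + frame_D i (frame_D j f) p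
         + (e1 h / 2 + e2 h / 2 + e3 h))"
    using e1(2) e2(2) e3(2) by eventually_elim (simp add: algebra_simps power2_eq_square)
  ultimately show thesis by (intro that) simp_all
qed

lemma limits_agree:
  assumes "\<forall>\<^sub>F h in at_right (0::real). L h = R h" "(L \<longlongrightarrow> (a::real)) (at_right 0)" "(R \<longlongrightarrow> b) (at_right 0)"
  shows "a = b"
proof -
  have "(R \<longlongrightarrow> a) (at_right 0)" using tendsto_cong[OF assms(1)] assms(2) by blast
  then show ?thesis using tendsto_unique[OF trivial_limit_at_right_real] assms(3) by blast
qed

text \<open>
  Both orders of the flows give the same point. Comparing the second order terms of the two expansions gives
  the symmetry of the second derivatives.
\<close>

lemma commutator_0:
  assumes I: "open I" and f: "C2 I f" and p: "p \<in> cyl I"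
  shows "frame_D 0 (frame_D i f) p = frame_D i (frame_D 0 f) p"
proof (cases "i = 0")
  case False
  let ?A = "at_right (0::real)"
  obtain z q where pz: "p = (z, q)" by (cases p)
  have z: "z \<in> I" "q \<in> sphere 0 1" using p pz by (auto simp: cyl_def)
  obtain d where d: "d > 0" "ball z d \<subseteq> I" using I z open_contains_ball by blast
  have ev: "\<forall>\<^sub>F h::real in ?A. h < d" using eventually_at_right_less[of 0] d(1)
    by (auto simp: eventually_at_right intro!: exI[of _ d])
  have c0: "\<forall>\<^sub>F h in ?A. \<forall>\<xi>. \<bar>\<xi>\<bar> \<le> h \<longrightarrow> flow 0 \<xi> (z, q') \<in> cyl I" if "q' \<in> sphere 0 1" for q'
    using ev by eventually_elim (use d that in \<open>auto simp: flow_def cyl_def subset_iff dist_real_def\<close>)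
  have ci: "\<forall>\<^sub>F h in ?A. \<forall>\<xi>. \<bar>\<xi>\<bar> \<le> h \<longrightarrow> flow i \<xi> p \<in> cyl I"
    using flow_in_cyl[OF False p] by simp
  have c0i: "\<forall>\<^sub>F h in ?A. \<forall>\<xi>. \<bar>\<xi>\<bar> \<le> h \<longrightarrow> flow i \<xi> (flow 0 h p) \<in> cyl I"
    using c0[OF z(2)] eventually_at_right_less[of 0]
  proof eventually_elim
    case (elim h)
    then have "flow 0 h p \<in> cyl I" by (simp add: pz)
    then show ?case using flow_in_cyl[OF False] by blast
  qed
  have comm: "flow i s (flow 0 r p) = flow 0 r (flow i s p)" for s r
    using False by (simp add: pz flow_def)
  have ci0: "\<forall>\<^sub>F h in ?A. \<forall>\<xi>. \<bar>\<xi>\<bar> \<le> h \<longrightarrow> flow 0 \<xi> (flow i h p) \<in> cyl I"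
    using c0[OF z(2)] eventually_at_right_less[of 0]
  proof eventually_elim
    case (elim h)
    show ?case
    proof (intro allI impI)
      fix \<xi> assume "\<bar>\<xi>\<bar> \<le> h"
      then have "flow 0 \<xi> p \<in> cyl I" using elim by (simp add: pz)
      from flow_in_cyl[OF False this] show "flow 0 \<xi> (flow i h p) \<in> cyl I" by (simp add: comm[symmetric])
    qed
  qed
  obtain e1 where e1: "(e1 \<longlongrightarrow> 0) ?A"
    "\<forall>\<^sub>F h in ?A. f (flow i h (flow 0 h p)) = f p + h * (frame_D 0 f p + frame_D i f p) +
       h\<^sup>2 * (frame_D 0 (frame_D 0 f) p / 2 + frame_D i (frame_D i f) p / 2 + frame_D 0 (frame_D i f) p + e1 h)"
    by (rule two_flows[OF f p _ c0i]) (use c0[OF z(2)] in \<open>simp add: pz\<close>)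
  obtain e2 where e2: "(e2 \<longlongrightarrow> 0) ?A"
    "\<forall>\<^sub>F h in ?A. f (flow 0 h (flow i h p)) = f p + h * (frame_D i f p + frame_D 0 f p) +
       h\<^sup>2 * (frame_D i (frame_D i f) p / 2 + frame_D 0 (frame_D 0 f) p / 2 + frame_D i (frame_D 0 f) p + e2 h)"
    by (rule two_flows[OF f p ci ci0])
  have "\<forall>\<^sub>F h in ?A. frame_D 0 (frame_D i f) p + e1 h = frame_D i (frame_D 0 f) p + e2 h"
    using e1(2) e2(2) eventually_at_right_less[of 0]
  proof eventually_elim
    case (elim h)
    then have "h\<^sup>2 * (frame_D 0 (frame_D i f) p + e1 h) = h\<^sup>2 * (frame_D i (frame_D 0 f) p + e2 h)"
      unfolding comm by (simp add: algebra_simps)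
    then show ?case using elim by simp
  qed
  moreover have "((\<lambda>h. frame_D 0 (frame_D i f) p + e1 h) \<longlongrightarrow> frame_D 0 (frame_D i f) p + 0) ?A"
    "((\<lambda>h. frame_D i (frame_D 0 f) p + e2 h) \<longlongrightarrow> frame_D i (frame_D 0 f) p + 0) ?A"
    by (intro tendsto_intros e1 e2)+
  ultimately have "frame_D 0 (frame_D i f) p + 0 = frame_D i (frame_D 0 f) p + 0"
    by (rule limits_agree)
  then show ?thesis by simp
qed simp

text \<open>
  The field \<open>[E\<^sub>i, E\<^sub>j] = 2 E\<^sub>k\<close> acts on functions as the commutator of the derivatives. Both sides of
  the relation \<open>flow_conjugate\<close> between the flows are expanded up to second order in \<open>h\<close>, one flow at a time.
\<close>

lemma commutator_cyc:
  assumes c: "cyc i j k" and f: "C2 I f" and p: "p \<in> cyl I"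
  shows "frame_D i (frame_D j f) p - frame_D j (frame_D i f) p = 2 * frame_D k f p"
proof -
  let ?A = "at_right (0::real)"
  note nz = cyc_nonzero[OF c]
  have cyl: "flow l s q \<in> cyl I" if "l \<in> {i, j, k}" "q \<in> cyl I" for l s q
    using flow_in_cyl that nz by blast
  define \<alpha> where "\<alpha> = (\<lambda>h::real. arctan (tan h * sin (2 * h)) / 2)"
  define \<beta> where "\<beta> = (\<lambda>h::real. arctan (sin h * cos (2 * h) / sqrt (1 - (sin h * cos (2 * h))\<^sup>2)))"
  have ang: "\<forall>\<^sub>F h in ?A. cos (\<beta> h) * cos (2 * \<alpha> h) = cos h \<and> cos (\<beta> h) * sin (2 * \<alpha> h) = sin h * sin (2 * h)
      \<and> sin (\<beta> h) = sin h * cos (2 * h) \<and> \<alpha> h \<ge> 0 \<and> \<beta> h \<ge> 0"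
    "((\<lambda>h. \<alpha> h / h\<^sup>2) \<longlongrightarrow> 1) ?A" "((\<lambda>h. \<beta> h / h) \<longlongrightarrow> 1) ?A" "((\<lambda>h. (\<beta> h - h) / h\<^sup>2) \<longlongrightarrow> 0) ?A"
    unfolding \<alpha>_def \<beta>_def by (rule conjugation_angles)+
  have id: "((\<lambda>h. h) \<longlongrightarrow> 0) ?A" by (rule tendsto_ident_at)
  have pos: "\<forall>\<^sub>F h::real in ?A. h > 0" by (rule eventually_at_right_less)
  have ge: "\<forall>\<^sub>F h::real in ?A. h \<ge> 0" using pos by eventually_elim simp
  have age: "\<forall>\<^sub>F h in ?A. \<alpha> h \<ge> 0" and bge: "\<forall>\<^sub>F h in ?A. \<beta> h \<ge> 0"
    using ang(1) by (auto elim!: eventually_mono)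
  have a0: "(\<alpha> \<longlongrightarrow> 0) ?A" unfolding \<alpha>_def by real_asymp
  have b0: "(\<beta> \<longlongrightarrow> 0) ?A" unfolding \<beta>_def by real_asymp
  define P1 P2 P3 where P: "P1 = (\<lambda>h. flow j h p)" "P2 = (\<lambda>h. flow k (\<alpha> h) (P1 h))" "P3 = (\<lambda>h. flow i (\<beta> h) (P2 h))"
  have P1: "(P1 \<longlongrightarrow> p) ?A" unfolding P by (rule tendsto_flow[OF id tendsto_const])
  have P2: "(P2 \<longlongrightarrow> p) ?A" unfolding P(2) by (rule tendsto_flow[OF a0 P1])
  have P3: "(P3 \<longlongrightarrow> p) ?A" unfolding P(3) by (rule tendsto_flow[OF b0 P2])
  have cP: "P1 h \<in> cyl I" "P2 h \<in> cyl I" "P3 h \<in> cyl I" for h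
    unfolding P by (intro cyl p; simp)+
  have in_cyl: "\<forall>\<^sub>F h in ?A. \<forall>\<xi>. \<bar>\<xi>\<bar> \<le> \<sigma> h \<longrightarrow> flow l \<xi> (Q h) \<in> cyl I"
    if "l \<in> {i, j, k}" "\<And>h. Q h \<in> cyl I" for l and Q :: "real \<Rightarrow> point" and \<sigma> :: "real \<Rightarrow> real"
    using cyl that by simp
  have f1: "along I f" "continuous_on (cyl I) (frame_D k f)" "along I (frame_D i f)"
    "continuous_on (cyl I) (frame_D k (frame_D i f))" "continuous_on (cyl I) (frame_D j (frame_D i f))"
    using f by (auto simp: C2_def along_def)
  let ?fi = "frame_D i f p" and ?fj = "frame_D j f p" and ?fk = "frame_D k f p"
  let ?fii = "frame_D i (frame_D i f) p" and ?fjj = "frame_D j (frame_D j f) p"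
  let ?fij = "frame_D i (frame_D j f) p" and ?fji = "frame_D j (frame_D i f) p" and ?fki = "frame_D k (frame_D i f) p"
  obtain e1 where e1: "(e1 \<longlongrightarrow> 0) ?A"
    "\<forall>\<^sub>F h in ?A. f (flow j h (flow i h p)) = f p + h * (?fi + ?fj) + h\<^sup>2 * (?fii / 2 + ?fjj / 2 + ?fij + e1 h)"
    by (rule two_flows[where i = i and j = j, OF f p in_cyl in_cyl]) (auto intro: cyl p)
  obtain e4 where e4: "(e4 \<longlongrightarrow> 0) ?A" "\<forall>\<^sub>F h in ?A. f (flow k (\<alpha> h) (P3 h)) = f (P3 h) + \<alpha> h * (?fk + e4 h)"
    by (rule first_order[where i = k, OF f1(1,2) p P3 a0 age in_cyl]) (auto intro: cP)
  obtain e5 where e5: "(e5 \<longlongrightarrow> 0) ?A"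
    "\<forall>\<^sub>F h in ?A. f (flow i (\<beta> h) (P2 h)) = f (P2 h) + \<beta> h * frame_D i f (P2 h) + (\<beta> h)\<^sup>2 / 2 * (?fii + e5 h)"
    by (rule second_order[where i = i, OF f p P2 b0 bge in_cyl]) (auto intro: cP)
  obtain e6 where e6: "(e6 \<longlongrightarrow> 0) ?A"
    "\<forall>\<^sub>F h in ?A. frame_D i f (flow k (\<alpha> h) (P1 h)) = frame_D i f (P1 h) + \<alpha> h * (?fki + e6 h)"
    by (rule first_order[where i = k, OF f1(3,4) p P1 a0 age in_cyl]) (auto intro: cP)
  obtain e7 where e7: "(e7 \<longlongrightarrow> 0) ?A" "\<forall>\<^sub>F h in ?A. f (flow k (\<alpha> h) (P1 h)) = f (P1 h) + \<alpha> h * (?fk + e7 h)"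
    by (rule first_order[where i = k, OF f1(1,2) p P1 a0 age in_cyl]) (auto intro: cP)
  obtain e8 where e8: "(e8 \<longlongrightarrow> 0) ?A"
    "\<forall>\<^sub>F h in ?A. f (flow j h p) = f p + h * ?fj + h\<^sup>2 / 2 * (?fjj + e8 h)"
    by (rule second_order[where i = j, OF f p tendsto_const id ge in_cyl]) (auto intro: p)
  obtain e9 where e9: "(e9 \<longlongrightarrow> 0) ?A"
    "\<forall>\<^sub>F h in ?A. frame_D i f (flow j h p) = ?fi + h * (?fji + e9 h)"
    by (rule first_order[where i = j, OF f1(3,5) p tendsto_const id ge in_cyl]) (auto intro: p)
  define L where "L = (\<lambda>h. ?fii / 2 + ?fjj / 2 + ?fij + e1 h)"
  define R where "R = (\<lambda>h. (\<alpha> h / h\<^sup>2) * ((?fk + e4 h) + (?fk + e7 h)) + ((\<beta> h - h) / h\<^sup>2) * ?fi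
     + (\<beta> h / h) * (?fji + e9 h) + \<beta> h * (\<alpha> h / h\<^sup>2) * (?fki + e6 h) + (\<beta> h / h)\<^sup>2 / 2 * (?fii + e5 h) + (?fjj + e8 h) / 2)"
  have "\<forall>\<^sub>F h in ?A. L h = R h"
    using e1(2) e4(2) e5(2) e6(2) e7(2) e8(2) e9(2) ang(1) pos
  proof eventually_elim
    case (elim h)
    have "flow j h (flow i h p) = flow k (\<alpha> h) (P3 h)"
      unfolding P using elim(8) by (intro flow_conjugate[OF c]) auto
    then have "f p + h * (?fi + ?fj) + h\<^sup>2 * L h = f (P3 h) + \<alpha> h * (?fk + e4 h)"
      using elim(1,2) by (simp add: L_def)
    also have "f (P3 h) = f (P2 h) + \<beta> h * frame_D i f (P2 h) + (\<beta> h)\<^sup>2 / 2 * (?fii + e5 h)"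
      using elim(3) by (simp add: P(3))
    also have "frame_D i f (P2 h) = (?fi + h * (?fji + e9 h)) + \<alpha> h * (?fki + e6 h)"
      using elim(4,7) by (simp add: P(1,2))
    also have "f (P2 h) = (f p + h * ?fj + h\<^sup>2 / 2 * (?fjj + e8 h)) + \<alpha> h * (?fk + e7 h)"
      using elim(5,6) by (simp add: P(1,2))
    finally have "h\<^sup>2 * L h = \<alpha> h * ((?fk + e4 h) + (?fk + e7 h)) + (\<beta> h - h) * ?fi + \<beta> h * h * (?fji + e9 h)
       + \<beta> h * \<alpha> h * (?fki + e6 h) + (\<beta> h)\<^sup>2 / 2 * (?fii + e5 h) + h\<^sup>2 / 2 * (?fjj + e8 h)"
      by (simp add: algebra_simps)
    also have "\<dots> = h\<^sup>2 * R h"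
      using elim(9) by (simp add: R_def field_simps power2_eq_square)
    finally show ?case using elim(9) by simp
  qed
  moreover have "(L \<longlongrightarrow> ?fii / 2 + ?fjj / 2 + ?fij + 0) ?A"
    unfolding L_def by (intro tendsto_intros e1)
  moreover have "(R \<longlongrightarrow> 1 * ((?fk + 0) + (?fk + 0)) + 0 * ?fi + 1 * (?fji + 0) + 0 * 1 * (?fki + 0)
      + 1\<^sup>2 / 2 * (?fii + 0) + (?fjj + 0) / 2) ?A"
    unfolding R_def by (intro tendsto_intros e4 e5 e6 e7 e8 e9 ang b0) auto
  ultimately have "?fii / 2 + ?fjj / 2 + ?fij + 0 = 1 * ((?fk + 0) + (?fk + 0)) + 0 * ?fi + 1 * (?fji + 0) + 0 * 1 * (?fki + 0)
      + 1\<^sup>2 / 2 * (?fii + 0) + (?fjj + 0) / 2"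
    by (rule limits_agree)
  then show ?thesis by simp
qed

section \<open>Calculus of frame derivatives\<close>

lemma along_D:
  assumes "along I f" "p \<in> cyl I"
  shows "((\<lambda>h. f (flow i h p)) has_real_derivative frame_D i f p) (at 0)"
  using along_deriv[OF assms(1), of i 0 p] assms(2) by (simp add: flow_0)

lemma frame_D_eqI: "((\<lambda>h. f (flow i h p)) has_real_derivative d) (at 0) \<Longrightarrow> frame_D i f p = d"
  unfolding frame_D_def by (rule DERIV_imp_deriv)

lemma fst_D:
  assumes "open I" "smooth_on I \<phi>" "p \<in> cyl I"
  shows "((\<lambda>h. \<phi> (fst (flow i h p))) has_real_derivative (if i = 0 then deriv \<phi> (fst p) else 0)) (at 0)"
proof (cases "i = 0")
  case True
  have "(\<phi> has_real_derivative deriv \<phi> (fst p)) (at (fst p))"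
    by (rule smooth_on_has_derivative[OF assms(1,2) fst_in_I[OF assms(3)]])
  then have "((\<lambda>h. \<phi> (h + fst p)) has_real_derivative deriv \<phi> (fst p)) (at 0)"
    using DERIV_shift[of \<phi> _ 0 "fst p"] by simp
  then show ?thesis by (simp add: True fst_flow add.commute)
qed (simp add: fst_flow)

lemma along_fst:
  assumes "open I" "smooth_on I \<phi>"
  shows "along I (\<lambda>p. \<phi> (fst p))"
proof -
  have "continuous_on I \<phi>"
    using smooth_on_has_derivative[OF assms] by (auto intro!: continuous_at_imp_continuous_on DERIV_isCont)
  then have "continuous_on (cyl I) (\<lambda>p. \<phi> (fst p))"
    by (rule continuous_on_compose2) (auto simp: cyl_def intro!: continuous_intros)
  moreover have "(\<lambda>h. \<phi> (fst (flow i h p))) differentiable at 0" if "p \<in> cyl I" for i p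
    using fst_D[OF assms that] real_differentiable_def by blast
  ultimately show ?thesis by (auto simp: along_def)
qed

lemma along_const: "along I (\<lambda>p. c)"
  by (simp add: along_def)

lemma along_add: "along I f \<Longrightarrow> along I g \<Longrightarrow> along I (\<lambda>p. f p + g p)"
  by (auto simp: along_def intro!: continuous_intros)

lemma along_mult: "along I f \<Longrightarrow> along I g \<Longrightarrow> along I (\<lambda>p. f p * g p)"
  by (auto simp: along_def intro!: continuous_intros)

lemma along_divide:
  "along I f \<Longrightarrow> along I g \<Longrightarrow> (\<And>p. p \<in> cyl I \<Longrightarrow> g p \<noteq> 0) \<Longrightarrow> along I (\<lambda>p. f p / g p)"
  by (auto simp: along_def flow_0 intro!: continuous_intros differentiable_divide)

lemma along_cong:
  assumes I: "open I" and f: "along I f" and eq: "\<And>p. p \<in> cyl I \<Longrightarrow> f p = g p"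
  shows "along I g"
  unfolding along_def
proof (intro conjI allI ballI)
  show "continuous_on (cyl I) g"
    using f eq by (auto simp: along_def cong: continuous_on_cong)
  fix i p assume p: "p \<in> cyl I"
  have "\<forall>\<^sub>F h in nhds 0. f (flow i h p) = g (flow i h p)"
    using eventually_flow_in_cyl[OF I p] by eventually_elim (rule eq)
  then have "((\<lambda>h. g (flow i h p)) has_real_derivative frame_D i f p) (at 0)"
    using along_D[OF f p, of i] by (simp add: DERIV_cong_ev)
  then show "(\<lambda>h. g (flow i h p)) differentiable at 0"
    using real_differentiable_def by blast
qed

lemma frame_D_add:
  "along I f \<Longrightarrow> along I g \<Longrightarrow> p \<in> cyl I \<Longrightarrow> frame_D i (\<lambda>p. f p + g p) p = frame_D i f p + frame_D i g p"
  by (intro frame_D_eqI DERIV_add along_D)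

lemma frame_D_mult:
  "along I f \<Longrightarrow> along I g \<Longrightarrow> p \<in> cyl I \<Longrightarrow>
     frame_D i (\<lambda>p. f p * g p) p = frame_D i f p * g p + f p * frame_D i g p"
  using DERIV_mult[OF along_D[of I f p i] along_D[of I g p i]]
  by (intro frame_D_eqI) (simp add: flow_0 mult.commute)

lemma C2_along: "C2 I f \<Longrightarrow> along I f" "C2 I f \<Longrightarrow> along I (frame_D i f)"
  by (auto simp: C2_def)

lemma C2_smooth_fun:
  assumes "smooth_fun I f"
  shows "C2 I f"
proof -
  have a: "along I (frame_Ds is f)" for "is"
    using assms by (auto simp: smooth_fun_def along_def)
  from a[of "[]"] a[of "[i]" for i] a[of "[i, j]" for i j] show ?thesis
    by (auto simp: C2_def along_def)
qed

lemma C2I: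
  assumes I: "open I" and f: "along I f" and d: "\<And>i p. p \<in> cyl I \<Longrightarrow> frame_D i f p = f' i p"
    and f': "\<And>i. along I (f' i)" and c: "\<And>i j. continuous_on (cyl I) (frame_D i (f' j))"
  shows "C2 I f"
  unfolding C2_def
proof (intro conjI allI f)
  fix i j
  show "along I (frame_D i f)" by (rule along_cong[OF I f' d[symmetric]])
  have "frame_D i (frame_D j f) p = frame_D i (f' j) p" if "p \<in> cyl I" for p
    by (rule frame_D_cong[OF I that d])
  then show "continuous_on (cyl I) (frame_D i (frame_D j f))"
    using c[of i j] by (simp cong: continuous_on_cong)
qed

lemma C2_fst:
  assumes I: "open I" and s: "smooth_on I \<phi>"
  shows "C2 I (\<lambda>p. \<phi> (fst p))"
proof (rule C2I[OF I along_fst[OF I s], of "\<lambda>i p. if i = 0 then deriv \<phi> (fst p) else 0"])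
  show "frame_D i (\<lambda>p. \<phi> (fst p)) p = (if i = 0 then deriv \<phi> (fst p) else 0)" for i p
    by (rule frame_D_fst)
  show "along I (\<lambda>p. if i = 0 then deriv \<phi> (fst p) else 0)" for i :: 4
    using along_fst[OF I smooth_on_deriv[OF s]] along_const by (cases "i = 0") simp_all
  have cont: "continuous_on (cyl I) (\<lambda>p. deriv (deriv \<phi>) (fst p))"
    using along_fst[OF I smooth_on_deriv[OF smooth_on_deriv[OF s]]] by (simp add: along_def)
  show "continuous_on (cyl I) (frame_D i (\<lambda>p. if j = 0 then deriv \<phi> (fst p) else 0))" for i j :: 4
  proof -
    have "frame_D i (\<lambda>p. if j = 0 then deriv \<phi> (fst p) else 0) =
        (\<lambda>p. if i = 0 \<and> j = 0 then deriv (deriv \<phi>) (fst p) else 0)"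
      by (rule ext) (simp add: frame_D_fst[of _ "\<lambda>z. if j = 0 then deriv \<phi> z else 0"])
    moreover have "continuous_on (cyl I) (\<lambda>p. if i = 0 \<and> j = 0 then deriv (deriv \<phi>) (fst p) else 0)"
      using cont by (cases "i = 0"; cases "j = 0") simp_all
    ultimately show ?thesis by simp
  qed
qed

lemma C2_add:
  assumes I: "open I" and f: "C2 I f" and g: "C2 I g"
  shows "C2 I (\<lambda>p. f p + g p)"
proof (rule C2I[OF I along_add[OF C2_along(1)[OF f] C2_along(1)[OF g]]])
  show "frame_D i (\<lambda>p. f p + g p) p = frame_D i f p + frame_D i g p" if "p \<in> cyl I" for i p
    by (rule frame_D_add[OF C2_along(1)[OF f] C2_along(1)[OF g] that])
  show "along I (\<lambda>p. frame_D i f p + frame_D i g p)" for i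
    by (intro along_add C2_along f g)
  show "continuous_on (cyl I) (frame_D i (\<lambda>p. frame_D j f p + frame_D j g p))" for i j
  proof -
    have "continuous_on (cyl I) (\<lambda>p. frame_D i (frame_D j f) p + frame_D i (frame_D j g) p)"
      using f g by (intro continuous_intros) (auto simp: C2_def)
    then show ?thesis
      by (simp add: frame_D_add[OF C2_along(2)[OF f] C2_along(2)[OF g]] cong: continuous_on_cong)
  qed
qed

lemma C2_mult:
  assumes I: "open I" and f: "C2 I f" and g: "C2 I g"
  shows "C2 I (\<lambda>p. f p * g p)"
proof (rule C2I[OF I along_mult[OF C2_along(1)[OF f] C2_along(1)[OF g]]])
  show "frame_D i (\<lambda>p. f p * g p) p = frame_D i f p * g p + f p * frame_D i g p" if "p \<in> cyl I" for i p
    by (rule frame_D_mult[OF C2_along(1)[OF f] C2_along(1)[OF g] that])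
  show "along I (\<lambda>p. frame_D i f p * g p + f p * frame_D i g p)" for i
    by (intro along_add along_mult C2_along f g)
  show "continuous_on (cyl I) (frame_D i (\<lambda>p. frame_D j f p * g p + f p * frame_D j g p))" for i j
  proof -
    have cont: "continuous_on (cyl I) f" "continuous_on (cyl I) g" "continuous_on (cyl I) (frame_D i f)" 
      "continuous_on (cyl I) (frame_D i g)" "continuous_on (cyl I) (frame_D i (frame_D j f))"
      "continuous_on (cyl I) (frame_D i (frame_D j g))" for i j
      using f g by (auto simp: C2_def along_def)
    have "continuous_on (cyl I) (\<lambda>p. (frame_D i (frame_D j f) p * g p + frame_D j f p * frame_D i g p)
        + (frame_D i f p * frame_D j g p + f p * frame_D i (frame_D j g) p))"
      by (intro continuous_intros cont)
    moreover have "frame_D i (\<lambda>p. frame_D j f p * g p + f p * frame_D j g p) p =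
        (frame_D i (frame_D j f) p * g p + frame_D j f p * frame_D i g p)
        + (frame_D i f p * frame_D j g p + f p * frame_D i (frame_D j g) p)" if "p \<in> cyl I" for p
      by (subst frame_D_add[of I]) (simp_all add: frame_D_mult[of I] along_mult C2_along f g that)
    ultimately show ?thesis by (simp cong: continuous_on_cong)
  qed
qed

section \<open>Parallel complex structures of conformal metrics\<close>

lemma zero_derivative_const_1:
  "deriv (\<lambda>z. 1 :: real) = (\<lambda>z. 0)" by (rule ext) simp

text \<open>
  All the metrics in the conformal class are \<open>v h\<close>, where \<open>h\<close> is the metric with \<open>C = 1\<close>.
\<close>

locale conformally_kaehler =
  fixes I :: "real set" and F :: "real \<Rightarrow> real" and v :: "point \<Rightarrow> real" and J :: "point \<Rightarrow> real^4^4"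
  assumes open_I: "open I" and smooth_F: "smooth_on I F" and F_pos: "\<And>z. z \<in> I \<Longrightarrow> F z > 0"
    and v: "C2 I v" and v_pos: "\<And>p. p \<in> cyl I \<Longrightarrow> v p > 0"
    and kaehler: "kaehler I (\<lambda>p. v p *\<^sub>R u2_metric F (\<lambda>_. 1) p) J"
begin

sublocale h: u2 I F "\<lambda>_. 1"
  using open_I smooth_F F_pos smooth_on_const[OF open_I] by unfold_locales auto

abbreviation "G \<equiv> \<lambda>p. v p *\<^sub>R u2_metric F (\<lambda>_. 1) p"
abbreviation "H \<equiv> u2_g F (\<lambda>_. 1)"

definition \<theta> :: "4 \<Rightarrow> point \<Rightarrow> real" where "\<theta> a p = frame_D a v p / v p"

lemma H_pos: "z \<in> I \<Longrightarrow> H i z > 0"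
  using F_pos by (simp add: u2_g_def)

lemma H_nz: "z \<in> I \<Longrightarrow> H i z \<noteq> 0"
  using H_pos[of z i] by simp

lemma G_entry: "G p $ i $ j = (if i = j then v p * H i (fst p) else 0)"
  by (simp add: h.g_entry)

lemma smooth_H: "smooth_on I (H i)"
  unfolding u2_g_def[abs_def] using F_pos
  by (intro smooth_on_if smooth_on_intros open_I smooth_F) force+

lemma ginv_G:
  assumes p: "p \<in> cyl I"
  shows "ginv G i j p = (if i = j then 1 / (v p * H i (fst p)) else 0)"
proof -
  have "G p = (\<chi> i j. if i = j then v p * H i (fst p) else 0)"
    by (simp only: vec_eq_iff G_entry vec_lambda_beta) simp
  then show ?thesis
    unfolding ginv_def using v_pos[OF p] H_nz[OF fst_in_I[OF p]]
    by (subst \<open>G p = _\<close>, subst matrix_inv_diagonal) auto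
qed

text \<open>
  The connection of \<open>v h\<close> differs from that of \<open>h\<close> by terms in the logarithmic derivative \<open>\<theta>\<close> of \<open>v\<close>.
\<close>

lemma christoffel_G:
  assumes p: "p \<in> cyl I"
  shows "christoffel G i j k p = u2_chr F (\<lambda>_. 1) i j k (fst p) + ((if k = i then \<theta> j p else 0)
     + (if k = j then \<theta> i p else 0) - (if i = j then H i (fst p) / H k (fst p) * \<theta> k p else 0)) / 2"
proof -
  have vp: "v p \<noteq> 0" using v_pos[OF p] by simp
  note Hn = H_nz[OF fst_in_I[OF p]]
  have D: "frame_D a (\<lambda>p. G p $ i $ j) p = v p * frame_D a (\<lambda>p. u2_metric F (\<lambda>_. 1) p $ i $ j) p
     + (if i = j then frame_D a v p * H i (fst p) else 0)" for a i j
  proof -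
    have "frame_D a (\<lambda>p. v p * H i (fst p)) p = frame_D a v p * H i (fst p) + v p * frame_D a (\<lambda>p. H i (fst p)) p"
      by (rule frame_D_mult[OF C2_along(1)[OF v] along_fst[OF open_I smooth_H] p])
    then show ?thesis
      unfolding G_entry h.g_entry by (cases "i = j") (simp_all add: frame_D_fst[of a "\<lambda>z. 0"])
  qed
  have "koszul G i j k p = v p * koszul (u2_metric F (\<lambda>_. 1)) i j k p
     + ((if j = k then frame_D i v p * H j (fst p) else 0) + (if i = k then frame_D j v p * H i (fst p) else 0)
        - (if i = j then frame_D k v p * H i (fst p) else 0)) / 2"
    unfolding koszul_def D
    unfolding sum_4 vector_scaleR_component real_scaleR_def
    by (simp only: add_divide_distrib diff_divide_distrib distrib_left right_diff_distrib) (simp add: algebra_simps)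
  moreover have "koszul (u2_metric F (\<lambda>_. 1)) i j k p = u2_chr F (\<lambda>_. 1) i j k (fst p) * H k (fst p)"
  proof -
    have "u2_chr F (\<lambda>_. 1) i j k (fst p) = koszul (u2_metric F (\<lambda>_. 1)) i j k p * u2_ginv F (\<lambda>_. 1) k (fst p)"
      unfolding h.christoffel_entry[OF p, symmetric] christoffel_def h.ginv_entry[OF p]
      by (simp add: if_distrib[of "\<lambda>x. _ * x"] cong: if_cong)
    moreover have "u2_ginv F (\<lambda>_. 1) k (fst p) * H k (fst p) = 1"
      using F_pos[OF fst_in_I[OF p]] by (simp add: u2_ginv_def u2_g_def)
    ultimately show ?thesis by simp
  qed
  ultimately have K: "koszul G i j k p = v p * (u2_chr F (\<lambda>_. 1) i j k (fst p) * H k (fst p))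
     + ((if j = k then frame_D i v p * H j (fst p) else 0) + (if i = k then frame_D j v p * H i (fst p) else 0)
        - (if i = j then frame_D k v p * H i (fst p) else 0)) / 2"
    by simp
  have "christoffel G i j k p = koszul G i j k p / (v p * H k (fst p))"
    by (simp add: christoffel_def ginv_G[OF p] if_distrib[of "\<lambda>x. _ * x"] cong: if_cong)
  also have "\<dots> = u2_chr F (\<lambda>_. 1) i j k (fst p) + ((if k = i then \<theta> j p else 0)
     + (if k = j then \<theta> i p else 0) - (if i = j then H i (fst p) / H k (fst p) * \<theta> k p else 0)) / 2"
  proof -
    have 1: "v p * (c * h) / (v p * h) = c" if "h \<noteq> 0" for c h :: real
      using vp that by simp
    have 2: "(if j = k then frame_D i v p * H j (fst p) else 0) / (v p * H k (fst p)) = (if k = j then \<theta> i p else 0)"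
      "(if i = k then frame_D j v p * H i (fst p) else 0) / (v p * H k (fst p)) = (if k = i then \<theta> j p else 0)"
      "(if i = j then frame_D k v p * H i (fst p) else 0) / (v p * H k (fst p)) =
         (if i = j then H i (fst p) / H k (fst p) * \<theta> k p else 0)"
      using Hn[of k] by (auto simp: \<theta>_def mult_ac)
    have 3: "(a + (b + c - d) / 2) / x = a / x + (b / x + c / x - d / x) / 2" for a b c d x :: real
      by (simp add: add_divide_distrib diff_divide_distrib)
    show ?thesis
      unfolding K 3 1[OF Hn] 2 by simp
  qed
  finally show ?thesis .
qed

lemma J_square: "p \<in> cyl I \<Longrightarrow> J p ** J p = - mat 1"
  and J_orthogonal: "p \<in> cyl I \<Longrightarrow> J p ** G p ** transpose (J p) = G p"
  and J_parallel: "p \<in> cyl I \<Longrightarrow> cov_endo G J c a b p = 0"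
  using kaehler by (auto simp: kaehler_def)

lemma C2_J: "C2 I (\<lambda>p. J p $ a $ b)"
  using kaehler by (auto simp: kaehler_def intro: C2_smooth_fun)

lemma J_skew:
  assumes p: "p \<in> cyl I"
  shows "J p $ a $ b * H b (fst p) = - (J p $ b $ a * H a (fst p))"
proof -
  have "J p ** (J p ** G p ** transpose (J p)) = (J p ** J p) ** (G p ** transpose (J p))"
    by (simp only: matrix_mul_assoc)
  then have "J p ** G p = - mat 1 ** (G p ** transpose (J p))"
    unfolding J_orthogonal[OF p] J_square[OF p] .
  then have "J p ** G p = - (G p ** transpose (J p))"
    by (simp add: matrix_matrix_mult_def vec_eq_iff mat_def sum_negf if_distrib[of "\<lambda>x. x * _"] cong: if_cong)
  then have "(J p ** G p) $ a $ b = - (G p ** transpose (J p)) $ a $ b" by simp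
  then have "v p * (J p $ a $ b * H b (fst p)) = v p * - (J p $ b $ a * H a (fst p))"
    by (simp add: matrix_matrix_mult_def G_entry transpose_def if_distrib[of "\<lambda>x. x * _"]
        if_distrib[of "\<lambda>x. _ * x"] h.g_entry mult_ac cong: if_cong)
  then show ?thesis using v_pos[OF p] by (simp only: mult_cancel_left) simp
qed

lemma J_entries:
  assumes p: "p \<in> cyl I"
  defines "f \<equiv> F (fst p)"
  shows "J p $ a $ a = 0" "J p $ 1 $ 0 = - 4 * f\<^sup>2 * J p $ 0 $ 1" "J p $ 2 $ 0 = - 4 * f * J p $ 0 $ 2"
    "J p $ 3 $ 0 = - 4 * f * J p $ 0 $ 3" "J p $ 2 $ 1 = - J p $ 1 $ 2 / f" "J p $ 1 $ 3 = - f * J p $ 3 $ 1"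
    "J p $ 3 $ 2 = - J p $ 2 $ 3"
proof -
  have f: "f \<noteq> 0" using F_pos[OF fst_in_I[OF p]] by (simp add: f_def)
  show "J p $ a $ a = 0" using J_skew[OF p, of a a] H_nz[OF fst_in_I[OF p], of a] by simp
  show "J p $ 1 $ 0 = - 4 * f\<^sup>2 * J p $ 0 $ 1" "J p $ 2 $ 0 = - 4 * f * J p $ 0 $ 2"
    "J p $ 3 $ 0 = - 4 * f * J p $ 0 $ 3" "J p $ 2 $ 1 = - J p $ 1 $ 2 / f" "J p $ 1 $ 3 = - f * J p $ 3 $ 1"
    "J p $ 3 $ 2 = - J p $ 2 $ 3"
    using J_skew[OF p, of 1 0] J_skew[OF p, of 2 0] J_skew[OF p, of 3 0] J_skew[OF p, of 2 1] J_skew[OF p, of 1 3]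
      J_skew[OF p, of 3 2] f
    by (simp_all add: u2_g_def f_def[symmetric] field_simps power2_eq_square)
qed

lemma J_derivative:
  assumes p: "p \<in> cyl I"
  shows "frame_D c (\<lambda>p. J p $ a $ b) p =
     (\<Sum>d\<in>UNIV. christoffel G c a d p * J p $ d $ b - christoffel G c d b p * J p $ a $ d)"
  using J_parallel[OF p, of c a b] by (simp add: cov_endo_def sum_subtractf)

lemma along_\<theta>: "along I (\<theta> a)"
  unfolding \<theta>_def[abs_def] using v_pos by (intro along_divide C2_along v) force

lemma \<theta>_commutator:
  assumes p: "p \<in> cyl I"
  shows "frame_D 0 (\<theta> a) p = frame_D a (\<theta> 0) p"
    and "cyc a b c \<Longrightarrow> frame_D a (\<theta> b) p - frame_D b (\<theta> a) p = 2 * \<theta> c p"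
proof -
  have vp: "v p \<noteq> 0" using v_pos[OF p] by simp
  have T: "frame_D e (\<theta> a) p = frame_D e (frame_D a v) p / v p - \<theta> a p * \<theta> e p" for e a
  proof (rule frame_D_eqI)
    have "v (flow e 0 p) \<noteq> 0" using vp by (simp add: flow_0)
    from DERIV_divide[OF along_D[OF C2_along(2)[OF v] p] along_D[OF C2_along(1)[OF v] p] this]
    show "((\<lambda>h. \<theta> a (flow e h p)) has_real_derivative frame_D e (frame_D a v) p / v p - \<theta> a p * \<theta> e p) (at 0)"
      unfolding \<theta>_def using vp by (simp add: flow_0 diff_divide_distrib)
  qed
  show "frame_D 0 (\<theta> a) p = frame_D a (\<theta> 0) p"
    unfolding T commutator_0[OF open_I v p] by simp
  show "frame_D a (\<theta> b) p - frame_D b (\<theta> a) p = 2 * \<theta> c p" if "cyc a b c"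
    using commutator_cyc[OF that v p] vp unfolding T
    by (simp add: \<theta>_def[of c] diff_divide_distrib[symmetric])
qed

end

text \<open>
  In the orthonormal frame \<open>e\<^sub>0 = 2 \<surd>F E\<^sub>0, e\<^sub>1 = E\<^sub>1 / \<surd>F, e\<^sub>2 = E\<^sub>2, e\<^sub>3 = E\<^sub>3\<close> of \<open>h\<close> the components of the form \<open>h(J x, y)\<close>
  on \<open>e\<^sub>0\<^sub>1 + \<epsilon> e\<^sub>2\<^sub>3\<close>, \<open>e\<^sub>0\<^sub>2 + \<epsilon> e\<^sub>3\<^sub>1\<close> and \<open>e\<^sub>0\<^sub>3 + \<epsilon> e\<^sub>1\<^sub>2\<close> are \<open>X\<^sub>1\<close>, \<open>\<surd>F X\<^sub>2\<close> and \<open>\<surd>F X\<^sub>3\<close>. So for each sign \<open>\<epsilon>\<close> the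
  functions \<open>X\<close> describe one of its self-dual and anti-self-dual parts, scaled so that no square roots occur.
\<close>

locale kaehler_form = conformally_kaehler +
  fixes \<epsilon> :: real
  assumes \<epsilon>: "\<epsilon> = 1 \<or> \<epsilon> = - 1"
begin

definition X1 :: "point \<Rightarrow> real" where "X1 p = 2 * F (fst p) * J p $ 0 $ 1 + \<epsilon> * J p $ 2 $ 3"
definition X2 :: "point \<Rightarrow> real" where "X2 p = 2 * J p $ 0 $ 2 + \<epsilon> * J p $ 3 $ 1"
definition X3 :: "point \<Rightarrow> real" where "X3 p = 2 * J p $ 0 $ 3 + \<epsilon> * (J p $ 1 $ 2 * (1 / F (fst p)))"

lemma smooth_inverse_F: "smooth_on I (\<lambda>z. 1 / F z)"
  using F_pos by (intro smooth_on_intros open_I smooth_F) force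

lemma C2_X: "C2 I X1" "C2 I X2" "C2 I X3"
  unfolding X1_def[abs_def] X2_def[abs_def] X3_def[abs_def]
  by (intro C2_add C2_mult open_I C2_J C2_fst[OF open_I smooth_F] C2_fst[OF open_I smooth_inverse_F]
      C2_fst[OF open_I smooth_on_const[OF open_I], of "2"] C2_fst[OF open_I smooth_on_const[OF open_I], of "\<epsilon>"])+

context
  fixes p :: point assumes p: "p \<in> cyl I"
begin

lemma nz: "F (fst p) \<noteq> 0"
  using F_pos[OF fst_in_I[OF p]] by simp

lemma X_expand:
  "frame_D c X1 p = 2 * (if c = 0 then deriv F (fst p) else 0) * J p $ 0 $ 1
     + 2 * F (fst p) * frame_D c (\<lambda>p. J p $ 0 $ 1) p + \<epsilon> * frame_D c (\<lambda>p. J p $ 2 $ 3) p"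
  "frame_D c X2 p = 2 * frame_D c (\<lambda>p. J p $ 0 $ 2) p + \<epsilon> * frame_D c (\<lambda>p. J p $ 3 $ 1) p"
  "frame_D c X3 p = 2 * frame_D c (\<lambda>p. J p $ 0 $ 3) p + \<epsilon> * (frame_D c (\<lambda>p. J p $ 1 $ 2) p / F (fst p)
     - (if c = 0 then deriv F (fst p) else 0) * J p $ 1 $ 2 / (F (fst p))\<^sup>2)"
proof -
  define d where "d = (if c = 0 then deriv F (fst p) else 0)"
  have F': "((\<lambda>h. F (fst (flow c h p))) has_real_derivative d) (at 0)"
    unfolding d_def by (rule fst_D[OF open_I smooth_F p])
  have F0: "F (fst (flow c 0 p)) \<noteq> 0" using nz by (simp add: flow_0)
  note J' = along_D[OF C2_along(1)[OF C2_J] p]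
  show "frame_D c X1 p = 2 * (if c = 0 then deriv F (fst p) else 0) * J p $ 0 $ 1
     + 2 * F (fst p) * frame_D c (\<lambda>p. J p $ 0 $ 1) p + \<epsilon> * frame_D c (\<lambda>p. J p $ 2 $ 3) p"
    unfolding X1_def d_def[symmetric]
    by (rule frame_D_eqI, (rule derivative_eq_intros F' J' refl)+, simp add: flow_0)
  show "frame_D c X2 p = 2 * frame_D c (\<lambda>p. J p $ 0 $ 2) p + \<epsilon> * frame_D c (\<lambda>p. J p $ 3 $ 1) p"
    unfolding X2_def by (rule frame_D_eqI, (rule derivative_eq_intros J' refl)+, simp)
  show "frame_D c X3 p = 2 * frame_D c (\<lambda>p. J p $ 0 $ 3) p + \<epsilon> * (frame_D c (\<lambda>p. J p $ 1 $ 2) p / F (fst p)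
     - (if c = 0 then deriv F (fst p) else 0) * J p $ 1 $ 2 / (F (fst p))\<^sup>2)"
    unfolding X3_def d_def[symmetric]
    by (rule frame_D_eqI, (rule derivative_eq_intros F' F0 J' refl)+,
      use nz in \<open>simp add: flow_0 field_simps power2_eq_square\<close>)
qed

text \<open>
  The Levi-Civita connection preserves the splitting into self-dual and anti-self-dual forms, so the derivatives of \<open>X\<close> are
  expressed by \<open>X\<close>, without the other part of \<open>J\<close>.
\<close>

lemma X_parallel:
  defines "f \<equiv> F (fst p)" and "f1 \<equiv> deriv F (fst p)"
  shows
  "frame_D 0 X1 p = \<epsilon> / 4 * (\<theta> 2 p * X3 p - \<theta> 3 p * X2 p)"
  "frame_D 0 X2 p = - f1 / (2 * f) * X2 p + \<epsilon> / (4 * f) * (\<theta> 3 p * X1 p - \<theta> 1 p * X3 p)"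
  "frame_D 0 X3 p = - f1 / (2 * f) * X3 p + \<epsilon> / (4 * f) * (\<theta> 1 p * X2 p - \<theta> 2 p * X1 p)"
  "frame_D 1 X1 p = - f / 2 * (\<theta> 2 p * X2 p + \<theta> 3 p * X3 p)"
  "frame_D 1 X2 p = (\<epsilon> * (f * \<theta> 0 p + f1) - f + 2) * X3 p + \<theta> 2 p * X1 p / 2"
  "frame_D 1 X3 p = - (\<epsilon> * (f * \<theta> 0 p + f1) - f + 2) * X2 p + \<theta> 3 p * X1 p / 2"
  "frame_D 2 X1 p = - f * (\<epsilon> * \<theta> 0 p + 1) * X3 p + \<theta> 1 p * X2 p / 2"
  "frame_D 2 X2 p = - \<theta> 3 p * X3 p / 2 - \<theta> 1 p * X1 p / (2 * f)"
  "frame_D 2 X3 p = (\<epsilon> * \<theta> 0 p + 1) * X1 p + \<theta> 3 p * X2 p / 2"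
  "frame_D 3 X1 p = f * (\<epsilon> * \<theta> 0 p + 1) * X2 p + \<theta> 1 p * X3 p / 2"
  "frame_D 3 X2 p = - (\<epsilon> * \<theta> 0 p + 1) * X1 p + \<theta> 2 p * X3 p / 2"
  "frame_D 3 X3 p = - \<theta> 2 p * X2 p / 2 - \<theta> 1 p * X1 p / (2 * f)"
proof -
  have fz: "f \<noteq> 0" using nz by (simp add: f_def)
  note e = J_entries[OF p, folded f_def]
  note S = X_expand J_derivative[OF p] christoffel_G[OF p] u2_chr_def u2_log_def u2_warp_def u2_rot_def
    u2_g_def zero_derivative_const_1 f_def[symmetric] f1_def[symmetric] X1_def X2_def X3_def
  note N = sum_4 zero_in_4 struct_def e fz
  note A = field_simps power2_eq_square fz
  show "frame_D 0 X1 p = \<epsilon> / 4 * (\<theta> 2 p * X3 p - \<theta> 3 p * X2 p)"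
    using \<epsilon> unfolding S by (elim disjE) (simp_all add: N, simp_all add: A)
  show "frame_D 0 X2 p = - f1 / (2 * f) * X2 p + \<epsilon> / (4 * f) * (\<theta> 3 p * X1 p - \<theta> 1 p * X3 p)"
    using \<epsilon> unfolding S by (elim disjE) (simp_all add: N, simp_all add: A)
  show "frame_D 0 X3 p = - f1 / (2 * f) * X3 p + \<epsilon> / (4 * f) * (\<theta> 1 p * X2 p - \<theta> 2 p * X1 p)"
    using \<epsilon> unfolding S by (elim disjE) (simp_all add: N, simp_all add: A)
  show "frame_D 1 X1 p = - f / 2 * (\<theta> 2 p * X2 p + \<theta> 3 p * X3 p)"
    using \<epsilon> unfolding S by (elim disjE) (simp_all add: N, simp_all add: A)
  show "frame_D 1 X2 p = (\<epsilon> * (f * \<theta> 0 p + f1) - f + 2) * X3 p + \<theta> 2 p * X1 p / 2"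
    using \<epsilon> unfolding S by (elim disjE) (simp_all add: N, simp_all add: A)
  show "frame_D 1 X3 p = - (\<epsilon> * (f * \<theta> 0 p + f1) - f + 2) * X2 p + \<theta> 3 p * X1 p / 2"
    using \<epsilon> unfolding S by (elim disjE) (simp_all add: N, simp_all add: A)
  show "frame_D 2 X1 p = - f * (\<epsilon> * \<theta> 0 p + 1) * X3 p + \<theta> 1 p * X2 p / 2"
    using \<epsilon> unfolding S by (elim disjE) (simp_all add: N, simp_all add: A)
  show "frame_D 2 X2 p = - \<theta> 3 p * X3 p / 2 - \<theta> 1 p * X1 p / (2 * f)"
    using \<epsilon> unfolding S by (elim disjE) (simp_all add: N, simp_all add: A)
  show "frame_D 2 X3 p = (\<epsilon> * \<theta> 0 p + 1) * X1 p + \<theta> 3 p * X2 p / 2"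
    using \<epsilon> unfolding S by (elim disjE) (simp_all add: N, simp_all add: A)
  show "frame_D 3 X1 p = f * (\<epsilon> * \<theta> 0 p + 1) * X2 p + \<theta> 1 p * X3 p / 2"
    using \<epsilon> unfolding S by (elim disjE) (simp_all add: N, simp_all add: A)
  show "frame_D 3 X2 p = - (\<epsilon> * \<theta> 0 p + 1) * X1 p + \<theta> 2 p * X3 p / 2"
    using \<epsilon> unfolding S by (elim disjE) (simp_all add: N, simp_all add: A)
  show "frame_D 3 X3 p = - \<theta> 2 p * X2 p / 2 - \<theta> 1 p * X1 p / (2 * f)"
    using \<epsilon> unfolding S by (elim disjE) (simp_all add: N, simp_all add: A)
qed

end

end

lemma along_minus: "along I f \<Longrightarrow> along I (\<lambda>p. - f p)"
  by (auto simp: along_def intro!: continuous_intros)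

lemma along_diff: "along I f \<Longrightarrow> along I g \<Longrightarrow> along I (\<lambda>p. f p - g p)"
  by (auto simp: along_def intro!: continuous_intros)

lemma frame_D_const: "frame_D i (\<lambda>p. c) p = 0"
  by (rule frame_D_eqI) simp

lemma frame_D_minus:
  "along I f \<Longrightarrow> p \<in> cyl I \<Longrightarrow> frame_D i (\<lambda>p. - f p) p = - frame_D i f p"
  by (intro frame_D_eqI DERIV_minus along_D)

lemma frame_D_diff:
  "along I f \<Longrightarrow> along I g \<Longrightarrow> p \<in> cyl I \<Longrightarrow> frame_D i (\<lambda>p. f p - g p) p = frame_D i f p - frame_D i g p"
  by (intro frame_D_eqI DERIV_diff along_D)

lemma frame_D_divide:
  assumes "along I f" "along I g" "p \<in> cyl I" "g p \<noteq> 0"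
  shows "frame_D i (\<lambda>p. f p / g p) p = (frame_D i f p * g p - f p * frame_D i g p) / (g p * g p)"
  using DERIV_divide[OF along_D[of I f p i] along_D[of I g p i]] assms
  by (intro frame_D_eqI) (simp add: flow_0)

lemmas along_intros = along_const along_add along_minus along_diff along_mult along_divide

lemmas frame_D_simps = frame_D_add frame_D_minus frame_D_diff frame_D_mult frame_D_divide

context kaehler_form
begin

definition f :: "point \<Rightarrow> real" where "f p = F (fst p)"
definition f1 :: "point \<Rightarrow> real" where "f1 p = deriv F (fst p)"
definition f2 :: "point \<Rightarrow> real" where "f2 p = deriv (deriv F) (fst p)"

lemma f_pos: "p \<in> cyl I \<Longrightarrow> f p > 0"
  unfolding f_def by (rule F_pos[OF fst_in_I])

lemma D_f: "frame_D e f p = (if e = 0 then f1 p else 0)" "frame_D e f1 p = (if e = 0 then f2 p else 0)"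
  unfolding f_def[abs_def] f1_def[abs_def] f2_def by (rule frame_D_fst)+

lemma along_f: "along I f" "along I f1"
  unfolding f_def[abs_def] f1_def[abs_def] by (intro along_fst open_I smooth_on_deriv smooth_F)+

lemmas parallel = X_parallel[folded f_def f1_def]

lemma \<theta>_D_symmetric:
  assumes "p \<in> cyl I"
  shows "frame_D 1 (\<theta> 0) p = frame_D 0 (\<theta> 1) p" "frame_D 2 (\<theta> 0) p = frame_D 0 (\<theta> 2) p"
    "frame_D 3 (\<theta> 0) p = frame_D 0 (\<theta> 3) p" "frame_D 2 (\<theta> 1) p = frame_D 1 (\<theta> 2) p - 2 * \<theta> 3 p"
    "frame_D 3 (\<theta> 2) p = frame_D 2 (\<theta> 3) p - 2 * \<theta> 1 p" "frame_D 3 (\<theta> 1) p = frame_D 1 (\<theta> 3) p + 2 * \<theta> 2 p"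
  using \<theta>_commutator(1)[OF assms] \<theta>_commutator(2)[OF assms, of 1 2 3] \<theta>_commutator(2)[OF assms, of 2 3 1]
    \<theta>_commutator(2)[OF assms, of 3 1 2] by (simp_all add: cyc_def)

text \<open>
  The bivectors \<open>2 E\<^sub>0 \<and> E\<^sub>1 + \<epsilon> E\<^sub>2 \<and> E\<^sub>3\<close> and \<open>2 F E\<^sub>0 \<and> E\<^sub>2 + \<epsilon> E\<^sub>3 \<and> E\<^sub>1\<close> are of type \<open>\<epsilon>\<close>.
  On them the curvature of the bundle of forms of type \<open>\<epsilon>\<close> is the Weyl tensor plus a multiple of the identity; it annihilates \<open>X\<close>.
  The first bivector, acting on \<open>X\<^sub>2\<close>, yields the simple eigenvalue times \<open>X\<^sub>3\<close>; the second one, acting on \<open>X\<^sub>1\<close>, yields minus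
  the double eigenvalue times \<open>X\<^sub>3\<close>. In the sum only the difference of the eigenvalues of the Weyl tensor remains, and
  all derivatives of the conformal factor drop out.
\<close>

lemma curvature_3:
  assumes p: "p \<in> cyl I"
  shows "(f2 p - 3 * \<epsilon> * f1 p + 2 * f p - 2) * X3 p = 0"
proof -
  have nz': "f p \<noteq> 0" if "p \<in> cyl I" for p using f_pos[OF that] by simp
  note nz = nz'[OF p]
  have al: "along I X1" "along I X2" "along I X3" by (intro C2_along C2_X)+
  note S = frame_D_simps[where I = I] frame_D_const along_intros D_f along_f al along_\<theta> parallel[OF p] p nz nz' \<theta>_D_symmetric[OF p]
  have D: "frame_D e (frame_D c X) p = frame_D e R p" if "\<And>p. p \<in> cyl I \<Longrightarrow> frame_D c X p = R p" for e c X R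
    by (rule frame_D_cong[OF open_I p that])
  have "2 * f p * (frame_D 0 (frame_D 1 X2) p - frame_D 1 (frame_D 0 X2) p)
      + \<epsilon> * f p * (frame_D 2 (frame_D 3 X2) p - frame_D 3 (frame_D 2 X2) p - 2 * frame_D 1 X2 p)
      + 2 * f p * (frame_D 0 (frame_D 2 X1) p - frame_D 2 (frame_D 0 X1) p)
      + \<epsilon> * (frame_D 3 (frame_D 1 X1) p - frame_D 1 (frame_D 3 X1) p - 2 * frame_D 2 X1 p)
      = 2 * \<epsilon> * f p * ((f2 p - 3 * \<epsilon> * f1 p + 2 * f p - 2) * X3 p)"
    by (subst D, erule parallel)+
      (simp add: S, rule disjE[OF \<epsilon>], simp_all only:, simp_all add: nz divide_simps, simp_all add: algebra_simps)
  then show ?thesis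
    using commutator_0[OF open_I C2_X(1) p] commutator_0[OF open_I C2_X(2) p] commutator_cyc[OF _ C2_X(1) p, of 3 1 2]
      commutator_cyc[OF _ C2_X(2) p, of 2 3 1] \<epsilon> nz by (auto simp: cyc_def)
qed

text \<open>
  The same argument with the roles of the indices 2 and 3 exchanged.
\<close>

lemma curvature_2:
  assumes p: "p \<in> cyl I"
  shows "(f2 p - 3 * \<epsilon> * f1 p + 2 * f p - 2) * X2 p = 0"
proof -
  have nz': "f p \<noteq> 0" if "p \<in> cyl I" for p using f_pos[OF that] by simp
  note nz = nz'[OF p]
  have al: "along I X1" "along I X2" "along I X3" by (intro C2_along C2_X)+
  note S = frame_D_simps[where I = I] frame_D_const along_intros D_f along_f al along_\<theta> parallel[OF p] p nz nz' \<theta>_D_symmetric[OF p]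
  have D: "frame_D e (frame_D c X) p = frame_D e R p" if "\<And>p. p \<in> cyl I \<Longrightarrow> frame_D c X p = R p" for e c X R
    by (rule frame_D_cong[OF open_I p that])
  have "2 * f p * (frame_D 0 (frame_D 1 X3) p - frame_D 1 (frame_D 0 X3) p)
      + \<epsilon> * f p * (frame_D 2 (frame_D 3 X3) p - frame_D 3 (frame_D 2 X3) p - 2 * frame_D 1 X3 p)
      + 2 * f p * (frame_D 0 (frame_D 3 X1) p - frame_D 3 (frame_D 0 X1) p)
      + \<epsilon> * (frame_D 1 (frame_D 2 X1) p - frame_D 2 (frame_D 1 X1) p - 2 * frame_D 3 X1 p)
      = - 2 * \<epsilon> * f p * ((f2 p - 3 * \<epsilon> * f1 p + 2 * f p - 2) * X2 p)"
    by (subst D, erule parallel)+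
      (simp add: S, rule disjE[OF \<epsilon>], simp_all only:, simp_all add: nz divide_simps, simp_all add: algebra_simps)
  then show ?thesis
    using commutator_0[OF open_I C2_X(1) p] commutator_0[OF open_I C2_X(3) p] commutator_cyc[OF _ C2_X(1) p, of 1 2 3]
      commutator_cyc[OF _ C2_X(3) p, of 2 3 1] \<epsilon> nz by (auto simp: cyc_def)
qed

end

section \<open>Invariance of functions with vanishing frame derivatives\<close>

text \<open>
  The flows of \<open>E\<^sub>1\<close> rotate the two complex coordinates in opposite directions, that of \<open>E\<^sub>2\<close> moves
  \<open>(1, 0)\<close> along a real great circle: these are the Euler angles.
\<close>

lemma flow_transitive:
  assumes q: "norm q = 1"
  obtains \<alpha> \<beta> \<gamma> where "(z, q) = flow 1 \<gamma> (flow 2 \<beta> (flow 1 \<alpha> (z, (1, 0))))"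
proof -
  obtain a b where ab: "q = (a, b)" by (cases q)
  have "(cmod a)\<^sup>2 + (cmod b)\<^sup>2 = 1"
    using q by (simp add: ab norm_Pair)
  then obtain \<beta> where \<beta>: "cmod a = cos \<beta>" "cmod b = sin \<beta>"
    using sincos_total_pi_half[of "cmod a" "cmod b"] by auto
  define \<mu> \<nu> where "\<mu> = Arg a" "\<nu> = Arg b"
  have a: "a = cos \<beta> *\<^sub>R cis \<mu>" and b: "b = sin \<beta> *\<^sub>R cis \<nu>"
    using rcis_cmod_Arg[of a] rcis_cmod_Arg[of b] by (simp_all add: \<mu>_\<nu>_def rcis_def \<beta>[symmetric] scaleR_conv_of_real)
  have 1: "flow 1 t (z, (x, y)) = (z, (cis t * x, cis (- t) * y))" for t x y
    by (simp add: flow_def rmul_def complex_eq_iff algebra_simps)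
  have 2: "flow 2 t (z, (x, 0)) = (z, (cos t *\<^sub>R x, sin t *\<^sub>R x))" for t x
    by (simp add: flow_def rmul_def)
  have "(z, q) = flow 1 ((\<mu> - \<nu>) / 2) (flow 2 \<beta> (flow 1 ((\<mu> + \<nu>) / 2) (z, (1, 0))))"
    unfolding 1 by (simp add: 1 2 ab a b cis_mult mult.commute) (simp add: field_simps)
  then show thesis by (rule that)
qed

text \<open>
  Vanishing derivatives along the flows suffice, since the flows act transitively.
\<close>

lemma frame_D_zero_constant:
  assumes I: "open I" "connected I" and f: "along I f" and 0: "\<And>i p. p \<in> cyl I \<Longrightarrow> frame_D i f p = 0"
    and p: "p \<in> cyl I" "p' \<in> cyl I"
  shows "f p = f p'"
proof -
  have flow: "f (flow i h q) = f q" if "i \<noteq> 0" "q \<in> cyl I" for i h q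
  proof -
    have "((\<lambda>h. f (flow i h q)) has_real_derivative 0) (at t)" for t
      using along_deriv[OF f flow_in_cyl[OF that]] 0[OF flow_in_cyl[OF that]] by simp
    then have "f (flow i h q) = f (flow i 0 q)"
      by (intro DERIV_isconst_all) auto
    then show ?thesis by (simp add: flow_0)
  qed
  have base: "f (z, q) = f (z, (1, 0))" if "(z, q) \<in> cyl I" for z q
  proof -
    have q: "norm q = 1" using that by (simp add: cyl_def)
    have one: "(z, (1, 0)) \<in> cyl I" using that by (simp add: cyl_def)
    obtain \<alpha> \<beta> \<gamma> where "(z, q) = flow 1 \<gamma> (flow 2 \<beta> (flow 1 \<alpha> (z, (1, 0))))"
      by (rule flow_transitive[OF q])
    then show ?thesis using one by (simp add: flow flow_in_cyl)
  qed
  have "f (z, (1, 0)) = f (z', (1, 0))" if "z \<in> I" "z' \<in> I" for z z'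
  proof -
    have "((\<lambda>h. f (h, (1, 0))) has_real_derivative 0) (at w)" if "w \<in> I" for w
      using along_deriv[OF f, of 0 w "(0, (1, 0))"] 0[of "(w, (1, 0))"] that
      by (simp add: flow_def cyl_def)
    then show ?thesis
      by (rule zero_derivative_constant[OF I _ that])
  qed
  then show ?thesis
    using base[of "fst p" "snd p"] base[of "fst p'" "snd p'"] p fst_in_I by auto
qed

lemma connected_cyl:
  assumes "connected I"
  shows "connected (cyl I)"
  unfolding cyl_def using assms
  by (intro connected_Times connected_sphere) simp_all

lemma constant_sign:
  fixes f :: "point \<Rightarrow> real"
  assumes "connected I" "continuous_on (cyl I) f" "\<And>p. p \<in> cyl I \<Longrightarrow> f p = 1 \<or> f p = - 1"
  obtains s where "s = 1 \<or> s = - 1" "\<And>p. p \<in> cyl I \<Longrightarrow> f p = s"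
proof -
  have c: "connected (f ` cyl I)" by (rule connected_continuous_image[OF assms(2) connected_cyl[OF assms(1)]])
  have "\<not> (1 \<in> f ` cyl I \<and> - 1 \<in> f ` cyl I)"
  proof
    assume "1 \<in> f ` cyl I \<and> - 1 \<in> f ` cyl I"
    then have "{- 1..1} \<subseteq> f ` cyl I" using connected_contains_Icc[OF c] by blast
    then have "0 \<in> f ` cyl I" by (auto simp: subset_iff)
    then show False using assms(3) by force
  qed
  then have "(\<forall>p\<in>cyl I. f p = 1) \<or> (\<forall>p\<in>cyl I. f p = - 1)"
    using assms(3) by (metis imageI)
  then show thesis using that[of 1] that[of "- 1"] by blast
qed

section \<open>Geometry of metrics that agree on an open set\<close>

locale equal_metrics =
  fixes I :: "real set" and g g' :: metric
  assumes open_I: "open I" and eq: "\<And>p. p \<in> cyl I \<Longrightarrow> g p = g' p"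
begin

lemma ginv_eq: "p \<in> cyl I \<Longrightarrow> ginv g i j p = ginv g' i j p"
  by (simp add: ginv_def eq)

lemma christoffel_eq:
  assumes p: "p \<in> cyl I"
  shows "christoffel g i j k p = christoffel g' i j k p"
proof -
  have "frame_D a (\<lambda>p. g p $ b $ c) p = frame_D a (\<lambda>p. g' p $ b $ c) p" for a b c
    by (rule frame_D_cong[OF open_I p]) (simp add: eq)
  then show ?thesis by (simp add: christoffel_def koszul_def ginv_eq[OF p] eq[OF p])
qed

lemma scal_eq:
  assumes p: "p \<in> cyl I"
  shows "scal g p = scal g' p"
proof -
  have "frame_D a (christoffel g b c d) p = frame_D a (christoffel g' b c d) p" for a b c d
    by (rule frame_D_cong[OF open_I p christoffel_eq])
  then have "curv g b c d e p = curv g' b c d e p" for b c d e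
    by (simp add: curv_def christoffel_eq[OF p])
  then show ?thesis
    by (simp add: scal_def Ric_def Rm_def ginv_eq[OF p] eq[OF p])
qed

end

lemma killing_component:
  assumes "killing I g X" "p \<in> cyl I"
  shows "frame_D 0 (lower g X [1]) p + frame_D 1 (lower g X [0]) p
    = (\<Sum>c\<in>UNIV. (christoffel g 0 1 c p + christoffel g 1 0 c p) * lower g X [c] p)"
proof -
  have "cov g (lower g X) [0, 1] p + cov g (lower g X) [1, 0] p = 0"
    using assms by (simp add: killing_def)
  then show ?thesis by (simp add: distrib_right sum.distrib)
qed

section \<open>Rigidity of conformally Kaehler metrics\<close>

lemma smooth_on_exp: "smooth_on I (\<lambda>z. a * exp (s * z))"
proof -
  have "(deriv ^^ n) (\<lambda>z. a * exp (s * z)) = (\<lambda>z. (a * s ^ n) * exp (s * z))" for n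
  proof (induction n)
    case (Suc n)
    have "deriv (\<lambda>z. (a * s ^ n) * exp (s * z)) = (\<lambda>z. (a * s ^ Suc n) * exp (s * z))"
      by (intro ext DERIV_imp_deriv) (auto intro!: derivative_eq_intros)
    then show ?case using Suc by simp
  qed simp
  moreover have "(\<lambda>z. b * exp (s * z)) differentiable (at z within I)" for b z
    by (auto intro!: derivative_eq_intros simp: real_differentiable_def intro: exI)
  ultimately show ?thesis
    by (auto simp: smooth_on_def differentiable_on_def)
qed

context kaehler_form
begin

text \<open>
  The form of type \<open>\<epsilon>\<close> is a multiple of \<open>e\<^sub>0\<^sub>1 + \<epsilon> e\<^sub>2\<^sub>3\<close>. Where it does not vanish, the equations for the vanishing
  components leave a single possibility for the derivatives of \<open>v\<close>.
\<close>

lemma aligned: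
  assumes nd: "\<And>p. p \<in> cyl I \<Longrightarrow> f2 p - 3 * \<epsilon> * f1 p + 2 * f p - 2 \<noteq> 0" and p: "p \<in> cyl I"
  shows "X2 p = 0" "X3 p = 0"
    and "X1 p \<noteq> 0 \<Longrightarrow> \<theta> 0 p = - \<epsilon> \<and> \<theta> 1 p = 0 \<and> \<theta> 2 p = 0 \<and> \<theta> 3 p = 0"
proof -
  have 0: "X2 q = 0" "X3 q = 0" if "q \<in> cyl I" for q
    using curvature_2[OF that] curvature_3[OF that] nd[OF that] by simp_all
  then show "X2 p = 0" "X3 p = 0" using p by blast+
  have D: "frame_D e X2 p = 0" "frame_D e X3 p = 0" for e
    using frame_D_cong[OF open_I p, of X2 "\<lambda>_. 0"] frame_D_cong[OF open_I p, of X3 "\<lambda>_. 0"] 0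
    by (simp_all add: frame_D_const)
  show "\<theta> 0 p = - \<epsilon> \<and> \<theta> 1 p = 0 \<and> \<theta> 2 p = 0 \<and> \<theta> 3 p = 0" if X1: "X1 p \<noteq> 0"
  proof -
    have "\<epsilon> * \<theta> 0 p + 1 = 0" "\<theta> 2 p = 0" "\<theta> 3 p = 0" "\<theta> 1 p = 0"
      using parallel(9)[OF p] parallel(5)[OF p] parallel(6)[OF p] parallel(8)[OF p] f_pos[OF p] X1 0[OF p] D
      by auto
    then show ?thesis using \<epsilon> by auto
  qed
qed

end

context conformally_kaehler
begin

lemma kaehler_form: "\<epsilon> = 1 \<or> \<epsilon> = - 1 \<Longrightarrow> kaehler_form I F v J \<epsilon>"
  by unfold_locales

text \<open>
  The signs \<open>s\<close> and \<open>\<kappa>\<close> encode the orientation of \<open>J\<close> and the direction of \<open>J \<partial>/\<partial>z\<close>. Since \<open>J\<^sup>2 = - 1\<close>, at each point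
  one of the two parts of the Kaehler form is nonzero and fixes the derivatives of \<open>v\<close>; connectedness makes the signs
  constant.
\<close>

lemma structure_determined:
  assumes I: "connected I"
    and nd: "\<forall>z\<in>I. \<forall>\<epsilon>\<in>{1, - 1}. deriv (deriv F) z - 3 * \<epsilon> * deriv F z + 2 * F z - 2 \<noteq> 0"
  shows "\<exists>s k \<kappa>. (s = 1 \<or> s = - 1) \<and> k > 0 \<and> (\<kappa> = 1 \<or> \<kappa> = - 1) \<and>
    (\<forall>p\<in>cyl I. v p = k * exp (s * fst p) \<and> J p $ 0 $ 2 = 0 \<and> J p $ 0 $ 3 = 0 \<and> 2 * F (fst p) * J p $ 0 $ 1 = \<kappa>)"
proof -
  interpret P: kaehler_form I F v J 1 by (rule kaehler_form) simp
  interpret N: kaehler_form I F v J "- 1" by (rule kaehler_form) simp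
  have ndP: "P.f2 p - 3 * 1 * P.f1 p + 2 * P.f p - 2 \<noteq> 0" and ndN: "N.f2 p - 3 * (- 1) * N.f1 p + 2 * N.f p - 2 \<noteq> 0"
    if "p \<in> cyl I" for p
    using bspec[OF bspec[OF nd fst_in_I[OF that]], of 1] bspec[OF bspec[OF nd fst_in_I[OF that]], of "- 1"]
    unfolding P.f_def P.f1_def P.f2_def N.f_def N.f1_def N.f2_def by simp_all
  have J: "J p $ 0 $ 2 = 0 \<and> J p $ 0 $ 3 = 0" "2 * F (fst p) * J p $ 0 $ 1 = 1 \<or> 2 * F (fst p) * J p $ 0 $ 1 = - 1"
    "(\<theta> 0 p = 1 \<or> \<theta> 0 p = - 1) \<and> \<theta> 1 p = 0 \<and> \<theta> 2 p = 0 \<and> \<theta> 3 p = 0" if p: "p \<in> cyl I" for p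
  proof -
    have nz: "F (fst p) \<noteq> 0" using F_pos[OF fst_in_I[OF p]] by simp
    note a = P.aligned[OF ndP p] N.aligned[OF ndN p]
    have 0: "J p $ 0 $ 2 = 0" "J p $ 0 $ 3 = 0" "J p $ 1 $ 2 = 0" "J p $ 3 $ 1 = 0"
      using a(1,2,4,5) nz unfolding P.X2_def N.X2_def P.X3_def N.X3_def by auto
    note e = J_entries[OF p]
    have "(J p ** J p) $ 0 $ 0 = - 1" "(J p ** J p) $ 2 $ 2 = - 1"
      unfolding J_square[OF p] by (simp_all add: mat_def)
    then have sq: "(2 * F (fst p) * J p $ 0 $ 1)\<^sup>2 = 1" "(J p $ 2 $ 3)\<^sup>2 = 1"
      by (simp_all add: matrix_matrix_mult_def sum_4 zero_in_4 e 0 power2_eq_square algebra_simps)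
    then show "J p $ 0 $ 2 = 0 \<and> J p $ 0 $ 3 = 0" "2 * F (fst p) * J p $ 0 $ 1 = 1 \<or> 2 * F (fst p) * J p $ 0 $ 1 = - 1"
      using 0 by (simp_all add: power2_eq_1_iff)
    have "P.X1 p \<noteq> 0 \<or> N.X1 p \<noteq> 0"
      using sq(2) unfolding P.X1_def N.X1_def by auto
    then show "(\<theta> 0 p = 1 \<or> \<theta> 0 p = - 1) \<and> \<theta> 1 p = 0 \<and> \<theta> 2 p = 0 \<and> \<theta> 3 p = 0"
      using a(3,6) by auto
  qed
  obtain s where s: "s = 1 \<or> s = - 1" "\<And>p. p \<in> cyl I \<Longrightarrow> \<theta> 0 p = s"
    by (rule constant_sign[OF I, of "\<theta> 0"]) (use along_\<theta>[of 0] J(3) in \<open>auto simp: along_def\<close>)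
  have "C2 I (\<lambda>p. (\<lambda>z. 2 * F z) (fst p) * J p $ 0 $ 1)"
    by (intro C2_mult C2_fst C2_J open_I smooth_on_intros smooth_F)
  then have "continuous_on (cyl I) (\<lambda>p. 2 * F (fst p) * J p $ 0 $ 1)"
    by (simp add: C2_def along_def)
  then obtain \<kappa> where \<kappa>: "\<kappa> = 1 \<or> \<kappa> = - 1" "\<And>p. p \<in> cyl I \<Longrightarrow> 2 * F (fst p) * J p $ 0 $ 1 = \<kappa>"
    by (rule constant_sign[OF I]) (use J(2) in auto)
  \<comment> \<open>All frame derivatives of this quotient vanish.\<close>
  define w where "w p = v p * exp (- s * fst p)" for p :: point
  have smooth_exp: "smooth_on I (\<lambda>z. exp (- s * z))"
    using smooth_on_exp[of I 1 "- s"] by simp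
  have along_w: "along I w"
    unfolding w_def[abs_def] by (rule along_mult[OF C2_along(1)[OF v] along_fst[OF open_I smooth_exp]])
  have zero: "frame_D i w p = 0" if p: "p \<in> cyl I" for i p
  proof -
    have "frame_D i w p = frame_D i v p * exp (- s * fst p) + v p * frame_D i (\<lambda>p. exp (- s * fst p)) p"
      unfolding w_def[abs_def] by (rule frame_D_mult[OF C2_along(1)[OF v] along_fst[OF open_I smooth_exp] p])
    also have "frame_D i (\<lambda>p. exp (- s * fst p)) p = (if i = 0 then - s * exp (- s * fst p) else 0)"
      unfolding frame_D_fst[of i "\<lambda>z. exp (- s * z)"]
      by (auto intro!: DERIV_imp_deriv derivative_eq_intros)
    also have "frame_D i v p = \<theta> i p * v p" using v_pos[OF p] by (simp add: \<theta>_def)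
    finally show ?thesis
      using J(3)[OF p] s(2)[OF p] exhaust_4[of i] by (auto simp: zero_in_4)
  qed
  have const: "w p = w p'" if "p \<in> cyl I" "p' \<in> cyl I" for p p'
    by (rule frame_D_zero_constant[OF open_I I along_w _ that]) (rule zero)
  have "\<exists>k>0. \<forall>p\<in>cyl I. w p = k"
  proof (cases "cyl I = {}")
    case False
    then obtain p0 where p0: "p0 \<in> cyl I" by blast
    then have "w p0 > 0" using v_pos by (simp add: w_def)
    then show ?thesis using const[OF _ p0] by blast
  qed (auto intro: exI[of _ 1])
  then obtain k where k: "k > 0" "\<And>p. p \<in> cyl I \<Longrightarrow> w p = k" by blast
  have "v p = k * exp (s * fst p)" if "p \<in> cyl I" for p
    using k(2)[OF that] by (simp add: w_def exp_minus field_simps)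
  then show ?thesis using s(1) k(1) \<kappa>(1) J(1) \<kappa>(2) by blast
qed

text \<open>
  On the domain the Kaehler metric is the metric with \<open>C = k exp (s z)\<close>, whose scalar curvature \<open>\<sigma>\<close> depends on
  \<open>z\<close> only, and \<open>J\<nabla>\<sigma>\<close> is a function of \<open>z\<close> times \<open>E\<^sub>1\<close>. The \<open>01\<close>-component of Killing's equation says that this function is constant,
  which is \<open>\<sigma>'' = s \<sigma>'\<close>. For this \<open>C\<close> the latter says that \<open>e\<^sub>1 = 0\<close>.
\<close>

lemma extremal_equation:
  assumes I: "connected I"
    and nd: "\<forall>z\<in>I. \<forall>\<epsilon>\<in>{1, - 1}. deriv (deriv F) z - 3 * \<epsilon> * deriv F z + 2 * F z - 2 \<noteq> 0"
    and kil: "killing I G (J_grad G J (scal G))" and z: "z \<in> I"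
  shows "u2_e1 F z = 0"
proof -
  obtain s k \<kappa> where s: "s = 1 \<or> s = - 1" and k: "k > 0" and \<kappa>: "\<kappa> = 1 \<or> \<kappa> = - 1"
    and vk: "\<And>p. p \<in> cyl I \<Longrightarrow> v p = k * exp (s * fst p)"
    and J: "\<And>p. p \<in> cyl I \<Longrightarrow> J p $ 0 $ 2 = 0 \<and> J p $ 0 $ 3 = 0 \<and> 2 * F (fst p) * J p $ 0 $ 1 = \<kappa>"
    using structure_determined[OF I nd] by blast
  define C where "C = (\<lambda>z. k * exp (s * z))"
  have dC: "deriv C = (\<lambda>z. s * C z)"
    unfolding C_def by (rule ext, rule DERIV_imp_deriv) (auto intro!: derivative_eq_intros)
  have C_pos: "C z > 0" for z using k by (simp add: C_def)
  have smooth_C: "smooth_on I C"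
    unfolding C_def by (rule smooth_on_exp)
  interpret c: u2 I F C
    using open_I smooth_F smooth_C F_pos C_pos by unfold_locales auto
  interpret e: equal_metrics I G "u2_metric F C"
  proof
    fix p assume p: "p \<in> cyl I"
    have "G p $ i $ j = u2_metric F C p $ i $ j" for i j
      unfolding G_entry c.g_entry by (simp add: u2_g_def vk[OF p] C_def)
    then show "G p = u2_metric F C p" by (simp only: vec_eq_iff) simp
  qed (rule open_I)
  let ?s = "u2_scal F C"
  have dscal: "frame_D i (scal G) p = (if i = 0 then deriv ?s (fst p) else 0)" if p: "p \<in> cyl I" for i p
    by (rule frame_D_fst_cong[OF open_I p]) (simp add: e.scal_eq c.scal_entry)
  define X where "X = lower G (J_grad G J (scal G))"
  have X: "X [i] p = (if i = 1 then 2 * \<kappa> * F (fst p) * deriv ?s (fst p) else 0)" if p: "p \<in> cyl I" for i p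
  proof -
    have "X [i] p = J_grad G J (scal G) i p * u2_g F C i (fst p)"
      unfolding X_def lower_def e.eq[OF p] c.g_entry by (simp add: if_distrib[of "\<lambda>x. _ * x"] cong: if_cong)
    also have "J_grad G J (scal G) i p = u2_ginv F C 0 (fst p) * deriv ?s (fst p) * J p $ 0 $ i"
      unfolding J_grad_def e.ginv_eq[OF p] c.ginv_entry[OF p] dscal[OF p] by (simp add: sum_4 zero_in_4)
    finally show ?thesis
      using J[OF p] J_entries(1)[OF p, of 0] exhaust_4[of i] F_pos[OF fst_in_I[OF p]] C_pos[of "fst p"]
      by (auto simp: u2_g_def u2_ginv_def zero_in_4 field_simps)
  qed
  have ode: "deriv (deriv ?s) z = s * deriv ?s z"
  proof -
    define p :: point where "p = (z, (1, 0))"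
    have p: "p \<in> cyl I" and fst: "fst p = z" using z by (auto simp: p_def cyl_def)
    have "frame_D 0 (X [1]) p = (if (0::4) = 0 then deriv (\<lambda>z. 2 * \<kappa> * F z * deriv ?s z) (fst p) else 0)"
      by (rule frame_D_fst_cong[OF open_I p]) (simp add: X)
    also have "\<dots> = 2 * \<kappa> * (deriv F z * deriv ?s z + F z * deriv (deriv ?s) z)"
      using smooth_on_has_derivative[OF open_I smooth_F z]
        smooth_on_has_derivative[OF open_I smooth_on_deriv[OF c.smooth_scal] z]
      by (auto simp: fst algebra_simps intro!: DERIV_imp_deriv derivative_eq_intros)
    finally have 1: "frame_D 0 (X [1]) p = 2 * \<kappa> * (deriv F z * deriv ?s z + F z * deriv (deriv ?s) z)" .
    have "frame_D 1 (X [0]) p = (if (1::4) = 0 then deriv (\<lambda>z. 0) (fst p) else 0)"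
      by (rule frame_D_fst_cong[OF open_I p]) (simp add: X)
    then have 2: "frame_D 1 (X [0]) p = 0" by simp
    have "frame_D 0 (X [1]) p + frame_D 1 (X [0]) p
        = (\<Sum>c\<in>UNIV. (christoffel G 0 1 c p + christoffel G 1 0 c p) * X [c] p)"
      unfolding X_def by (rule killing_component[OF kil p])
    also have "\<dots> = (s + deriv F z / F z) * (2 * \<kappa> * F z * deriv ?s z)"
      unfolding e.christoffel_eq[OF p] c.christoffel_entry[OF p] X[OF p] fst
      using C_pos[of z] by (simp add: sum_4 zero_in_4 u2_chr_def u2_log_def dC field_simps)
    finally have "2 * \<kappa> * F z * (deriv (deriv ?s) z - s * deriv ?s z) = 0"
      using 1 2 F_pos[OF z] by (simp add: field_simps)
    then show ?thesis using \<kappa> F_pos[OF z] by auto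
  qed
  have d2C: "deriv (deriv C) = C"
  proof
    fix z
    have "(C has_real_derivative s * C z) (at z)"
      unfolding C_def by (auto intro!: derivative_eq_intros)
    then have "deriv (\<lambda>z. s * C z) z = s * (s * C z)"
      by (intro DERIV_imp_deriv DERIV_cmult)
    then show "deriv (deriv C) z = C z" using s by (auto simp: dC)
  qed
  have C4: "deriv C z / C z = s" "deriv (deriv C) z / C z = 1" "deriv (deriv (deriv C)) z / C z = s"
    "deriv (deriv (deriv (deriv C))) z / C z = 1"
    unfolding d2C unfolding dC using C_pos[of z] by simp_all
  have "(sc2 (F z) (deriv F z) (deriv (deriv F) z) (deriv (deriv (deriv F)) z) s 1 s
       - 12 * F z * 1 - 4 * deriv (deriv (deriv (deriv F))) z)
     = s * sc1 (F z) (deriv F z) (deriv (deriv F) z) (deriv (deriv (deriv F)) z) s 1 s"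
    using ode C_pos[of z] unfolding c.scal_jets[OF z] C4 by (simp add: field_simps)
  then show ?thesis
    using s by (auto simp: u2_e1_def sc1_def sc2_def)
qed

end

lemma not_conformal_to_extremal_kaehler:
  assumes u: "u2 I F C" and I: "open_interval I"
    and nd: "\<forall>z\<in>I. \<forall>\<epsilon>\<in>{1, - 1}. deriv (deriv F) z - 3 * \<epsilon> * deriv F z + 2 * F z - 2 \<noteq> 0"
    and e1: "\<And>z. z \<in> I \<Longrightarrow> u2_e1 F z \<noteq> 0"
  shows "\<not> conformal_to_extremal_kaehler I (u2_metric F C)"
proof
  interpret u2 I F C by (rule u)
  assume "conformal_to_extremal_kaehler I (u2_metric F C)"
  then obtain u J where u: "smooth_fun I u" "\<And>p. p \<in> cyl I \<Longrightarrow> u p > 0"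
    and ek: "extremal_kaehler I (\<lambda>p. u p *\<^sub>R u2_metric F C p) J"
    by (auto simp: conformal_to_extremal_kaehler_def)
  \<comment> \<open>The conformal factor relative to the metric with \<open>C = 1\<close>.\<close>
  define v where "v p = u p * C (fst p)" for p
  have eq: "(\<lambda>p. u p *\<^sub>R u2_metric F C p) = (\<lambda>p. v p *\<^sub>R u2_metric F (\<lambda>_. 1) p)"
    by (rule ext) (simp add: vec_eq_iff u2_metric_def Let_def v_def)
  interpret conformally_kaehler I F v J
  proof
    show "C2 I v"
      unfolding v_def[abs_def] by (intro C2_mult C2_smooth_fun C2_fst open_I smooth u)
    show "v p > 0" if "p \<in> cyl I" for p
      using u(2)[OF that] pos fst_in_I[OF that] by (simp add: v_def)
    show "kaehler I (\<lambda>p. v p *\<^sub>R u2_metric F (\<lambda>_. 1) p) J"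
      using ek unfolding eq extremal_kaehler_def by blast
  qed (use open_I smooth pos in auto)
  have "connected I" "I \<noteq> {}" using I by (auto simp: open_interval_def is_interval_connected)
  then obtain z where z: "z \<in> I" by blast
  have "u2_e1 F z = 0"
    using ek unfolding eq extremal_kaehler_def by (intro extremal_equation[OF \<open>connected I\<close> nd _ z]) auto
  then show False using e1[OF z] by simp
qed

section \<open>A metric that is not conformally extremal\<close>

lemma csc_solution_subset:
  assumes "csc_Bt_flat_solution t I F C" "open_interval I'" "I' \<subseteq> I"
  shows "csc_Bt_flat_solution t I' F C"
proof -
  have "cyl I' \<subseteq> cyl I" using assms(3) by (auto simp: cyl_def)
  moreover have "smooth_on I' F" "smooth_on I' C"
    using assms by (auto simp: csc_Bt_flat_solution_def Bt_flat_solution_def smooth_on_def intro: differentiable_on_subset)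
  ultimately show ?thesis
    using assms unfolding csc_Bt_flat_solution_def Bt_flat_solution_def Bt_flat_def csc_def by blast
qed

text \<open>
  The initial data \<open>F = F' = C = 1\<close>, \<open>F'' = C' = C'' = s' = 0\<close> at 0 have \<open>s = 6\<close>, hence \<open>e\<^sub>1 = - N = 9 t / 4\<close>, and
  \<open>F'' \<minusplus> 3 F' + 2 F - 2 = \<minusplus> 3\<close>. The conditions are open, so they hold on an interval around 0.
\<close>

lemma csc_generic_solution:
  assumes t: "t \<noteq> 0"
  obtains I F C where "csc_Bt_flat_solution t I F C"
    "\<forall>z\<in>I. \<forall>\<epsilon>\<in>{1, - 1}. deriv (deriv F) z - 3 * \<epsilon> * deriv F z + 2 * F z - 2 \<noteq> 0" "\<forall>z\<in>I. u2_e1 F z \<noteq> 0"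
proof -
  define x where "x = chart t 1 1 0 1 0 0 0"
  have x: "x \<in> jU" "jK t x = 0" "jn1 x = 0"
    by (simp_all add: x_def jU_def chart_simps jK_chart jn1_chart)
  obtain I F C where S: "Bt_flat_solution t I F C" and 0: "0 \<in> I" and d: "data F C 0 = x"
    by (rule solution_exists[OF t x(1,2)])
  have csc: "csc_Bt_flat_solution t I F C"
    by (rule csc_solution[OF t S 0]) (simp add: d x)
  interpret u2 I F C by (rule u2_of_solution[OF S])
  have jets: "F 0 = 1" "deriv F 0 = 1" "deriv (deriv F) 0 = 0" "C 0 = 1" "deriv C 0 = 0" "deriv (deriv C) 0 = 0"
    using d unfolding x_def data_unfold by (auto simp: chart_def Let_def)
  have s1: "deriv (u2_scal F C) 0 = 0"
    unfolding deriv_scal_data[OF 0] d x by simp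
  have "u2_scal F C 0 = 6"
    by (simp add: u2_scal_def jets)
  then have "u2_N t F C 0 = - 9 * t / 4"
    by (simp add: u2_N_def s1 jets)
  moreover have "u2_e1 F 0 + u2_N t F C 0 = 0"
    using S Bt_flat_iff[OF t] 0 by (simp add: Bt_flat_solution_def)
  ultimately have e1: "u2_e1 F 0 \<noteq> 0" using t by simp
  define n where "n = (\<lambda>\<epsilon> z. deriv (deriv F) z - 3 * \<epsilon> * deriv F z + 2 * F z - 2)"
  define h where "h = (\<lambda>z. u2_e1 F z * (n 1 z * n (- 1) z))"
  have "smooth_on I h"
    unfolding h_def n_def u2_e1_def by (intro smooth_on_intros smooth_on_deriv open_I smooth)
  then have "continuous_on I h"
    using smooth_on_has_derivative[OF open_I] by (auto intro!: continuous_at_imp_continuous_on DERIV_isCont)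
  then have "open (I \<inter> h -` (- {0}))"
    by (intro continuous_open_preimage open_I) auto
  moreover have "0 \<in> I \<inter> h -` (- {0})"
    using 0 e1 by (simp add: h_def n_def jets)
  ultimately obtain r where r: "r > 0" "ball 0 r \<subseteq> I \<inter> h -` (- {0})"
    by (rule openE)
  have "open_interval (ball 0 r)"
    using r(1) by (auto simp: open_interval_def is_interval_ball_real)
  then have "csc_Bt_flat_solution t (ball 0 r) F C"
    by (rule csc_solution_subset[OF csc]) (use r(2) in auto)
  then show thesis
    by (rule that) (use r(2) in \<open>auto simp: h_def n_def subset_iff\<close>)
qed

theorem theorem1p5:
  fixes t :: real
  assumes "t \<noteq> 0"
  shows "(\<forall>z0. determined_by_data (Bt_flat_solution t) z0 \<and>
            has_parameters TYPE(real^7) (initial_data (Bt_flat_solution t) z0) (=)) \<and>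
         (\<forall>z0. has_parameters TYPE(real^5) (initial_data (Bt_flat_solution t) z0)
            (homothetic_data (Bt_flat_solution t) z0)) \<and>
         (\<forall>z0. has_parameters TYPE(real^4) (initial_data (csc_Bt_flat_solution t) z0)
            (homothetic_data (csc_Bt_flat_solution t) z0)) \<and>
         (\<exists>I F C. csc_Bt_flat_solution t I F C \<and>
            (\<forall>I'. open_interval I' \<and> I' \<subseteq> I \<longrightarrow>
               \<not> conformal_to_extremal_kaehler I' (u2_metric F C)))"
proof (intro conjI allI)
  note t = assms
  show "determined_by_data (Bt_flat_solution t) z0" for z0
    by (rule solutions_determined_by_data[OF t])
  show "has_parameters TYPE(real^7) (initial_data (Bt_flat_solution t) z0) (=)" for z0
    by (rule seven_parameters[OF t])
  show "has_parameters TYPE(real^5) (initial_data (Bt_flat_solution t) z0)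
      (homothetic_data (Bt_flat_solution t) z0)" for z0
    by (rule five_parameters[OF t])
  show "has_parameters TYPE(real^4) (initial_data (csc_Bt_flat_solution t) z0)
      (homothetic_data (csc_Bt_flat_solution t) z0)" for z0
    by (rule csc_four_parameters[OF t])
  obtain I F C where S: "csc_Bt_flat_solution t I F C"
    and nd: "\<forall>z\<in>I. \<forall>\<epsilon>\<in>{1, - 1}. deriv (deriv F) z - 3 * \<epsilon> * deriv F z + 2 * F z - 2 \<noteq> 0"
    and e1: "\<forall>z\<in>I. u2_e1 F z \<noteq> 0"
    by (rule csc_generic_solution[OF t])
  have "\<not> conformal_to_extremal_kaehler I' (u2_metric F C)" if I': "open_interval I'" "I' \<subseteq> I" for I'
  proof (rule not_conformal_to_extremal_kaehler)
    show "u2 I' F C"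
      by (rule u2_of_solution[OF csc_imp_solution[OF csc_solution_subset[OF S I']]])
  qed (use I' nd e1 in auto)
  then show "\<exists>I F C. csc_Bt_flat_solution t I F C \<and>
      (\<forall>I'. open_interval I' \<and> I' \<subseteq> I \<longrightarrow> \<not> conformal_to_extremal_kaehler I' (u2_metric F C))"
    using S by blast
qed

end
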